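(* Assume axioms (1)–(4) of the context. In the sheaf model, $R$ is a local ring; that is, $(1=_R0)\to\bot_S$, and for all $x,y:R$ such that $x+y$ is invertible, the proposition $\|\mathrm{inv}(x)+\mathrm{inv}(y)\|_S$ holds, where $\mathrm{inv}(x):=\sum_{z:R}xz=1$.
   Context: We work in univalent type theory; $\|\cdot\|$ is propositional truncation and "merely" refers to it. An $R$-algebra $A$ is finitely presented (f.p.) if there merely are $n,m$, polynomials $f_1,\dots,f_m:R[X_1,\dots,X_n]$ and an $R$-algebra equivalence $A\simeq R[X_1,\dots,X_n]/(f_1,\dots,f_m)$; $\mathrm{Spec}(A):=\mathrm{Hom}_{R\text{-Alg}}(A,R)$; for $r:R$, $D(r)$ is the proposition $\mathrm{Spec}(R_r)$ (equivalently, $r$ is invertible). Standing axioms: (1) $R$ is a (commutative) ring; (2) for any f.p. $R$-algebra $A$, the canonical map $A\to R^{\mathrm{Spec}(A)}$, $a\mapsto(\varphi\mapsto\varphi(a))$, is an equivalence; (3) for any f.p. $R$-algebra $A$ and any family of types $P(x)$ for $x:\mathrm{Spec}(A)$, there is a map $\left(\prod_{x:\mathrm{Spec}(A)}\|P(x)\|\right)\to\left\|\prod_{x:\mathrm{Spec}(A)}P(x)\right\|$; (4) for any f.p. $R$-algebra $A$, the diagonal map $\mathbb{N}\to\mathbb{N}^{\mathrm{Spec}(A)}$ is an equivalence. $\mathrm{Um}(A)$ is the type of finite sequences $f_1,\dots,f_n$ in $A$ ($n:\mathbb{N}$, $n=0$ allowed) with $(f_1,\dots,f_n)=(1)$. For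 $\vec r=(r_1,\dots,r_n):\mathrm{Um}(R)$ let $D(\vec r):=D(r_1)\vee\dots\vee D(r_n)$ (the empty proposition if $n=0$, in which case unimodularity means $1=_R0$). A type $T$ is modal if for all $\vec r:\mathrm{Um}(R)$ the diagonal map $T\to T^{D(\vec r)}$ is an equivalence. The sheaf model is the model of univalent type theory whose types are the modal types. The sheafification of a proposition $P$ is the modal proposition $P_S$ with $P\to P_S$ such that any implication $P\to Q$ with $Q$ a modal proposition factors through $P_S$. In the sheaf model the empty type is interpreted by $\bot_S$, the sheafification of the empty proposition, and propositional truncation by $\|T\|_S:=(\|T\|)_S$. The ring $R$ is a modal type. *)

theory Defs
  imports Main
begin

text \<open>
  The ambient foundation is univalent type theory. It cannot be replaced by HOL sets and HOL logic:
  classically the duality axiom below forces the base ring to be trivial. So the type theory is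
  formalized as a syntactic calculus, and to assert a theorem of it is to assert that the
  corresponding closed type is inhabited.

  The calculus has cumulative Russell universes, \<open>\<Pi>\<close> (with \<open>\<beta>\<close>, \<open>\<eta>\<close>), \<open>\<Sigma>\<close>, identity types, \<open>0\<close>,
  \<open>1\<close>, \<open>+\<close>, \<open>\<nat>\<close>, propositional truncation, set quotients, function extensionality (which also
  follows from univalence) and univalence.
\<close>

section \<open>Raw terms\<close>

datatype const =
    CEmpty | CEmptyInd
  | CUnit | CStar | CUnitInd
  | CSum | CInl | CInr | CSumInd
  | CNat | CZero | CSucc | CNatInd
  | CId | CRefl | CJ
  | CSigInd
  | CTrunc | CTrIn | CTrProp | CTrInd
  | CQuot | CCls | CQuotEq | CQuotSet | CQuotRec | CQuotInd
  | CFunExt | CUnivalence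

text \<open>De Bruijn indices; \<open>Pi A B\<close>, \<open>Sig A B\<close> and \<open>Lam t\<close> bind one variable in \<open>B\<close>, \<open>B\<close>, \<open>t\<close>.\<close>

datatype tm =
    Var nat
  | Univ nat
  | Pi tm tm
  | Lam tm
  | App tm tm
  | Sig tm tm
  | Pair tm tm
  | Fst tm
  | Snd tm
  | Con const

primrec up_ren :: "(nat \<Rightarrow> nat) \<Rightarrow> nat \<Rightarrow> nat" where
  "up_ren \<rho> 0 = 0"
| "up_ren \<rho> (Suc n) = Suc (\<rho> n)"

primrec ren :: "(nat \<Rightarrow> nat) \<Rightarrow> tm \<Rightarrow> tm" where
  "ren \<rho> (Var n) = Var (\<rho> n)"
| "ren \<rho> (Univ i) = Univ i"
| "ren \<rho> (Pi A B) = Pi (ren \<rho> A) (ren (up_ren \<rho>) B)"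
| "ren \<rho> (Lam t) = Lam (ren (up_ren \<rho>) t)"
| "ren \<rho> (App f a) = App (ren \<rho> f) (ren \<rho> a)"
| "ren \<rho> (Sig A B) = Sig (ren \<rho> A) (ren (up_ren \<rho>) B)"
| "ren \<rho> (Pair a b) = Pair (ren \<rho> a) (ren \<rho> b)"
| "ren \<rho> (Fst p) = Fst (ren \<rho> p)"
| "ren \<rho> (Snd p) = Snd (ren \<rho> p)"
| "ren \<rho> (Con c) = Con c"

primrec up_subst :: "(nat \<Rightarrow> tm) \<Rightarrow> nat \<Rightarrow> tm" where
  "up_subst \<sigma> 0 = Var 0"
| "up_subst \<sigma> (Suc n) = ren Suc (\<sigma> n)"

primrec subst :: "(nat \<Rightarrow> tm) \<Rightarrow> tm \<Rightarrow> tm" where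
  "subst \<sigma> (Var n) = \<sigma> n"
| "subst \<sigma> (Univ i) = Univ i"
| "subst \<sigma> (Pi A B) = Pi (subst \<sigma> A) (subst (up_subst \<sigma>) B)"
| "subst \<sigma> (Lam t) = Lam (subst (up_subst \<sigma>) t)"
| "subst \<sigma> (App f a) = App (subst \<sigma> f) (subst \<sigma> a)"
| "subst \<sigma> (Sig A B) = Sig (subst \<sigma> A) (subst (up_subst \<sigma>) B)"
| "subst \<sigma> (Pair a b) = Pair (subst \<sigma> a) (subst \<sigma> b)"
| "subst \<sigma> (Fst p) = Fst (subst \<sigma> p)"
| "subst \<sigma> (Snd p) = Snd (subst \<sigma> p)"
| "subst \<sigma> (Con c) = Con c"

definition inst :: "tm \<Rightarrow> tm \<Rightarrow> tm" where
  "inst B a = subst (case_nat a Var) B"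

section \<open>Notation for terms with named binders\<close>

text \<open>
  An expression is a function from the number of enclosing binders to a term. A variable bound at
  depth \<open>d\<close> is, at depth \<open>e > d\<close>, the de Bruijn index \<open>e - (d + 1)\<close>; this lets HOL abstraction stand
  for object-level binding. A closed expression \<open>X\<close> denotes the term \<open>X 0\<close>.
\<close>

type_synonym ex = "nat \<Rightarrow> tm"

definition bind :: "(ex \<Rightarrow> ex) \<Rightarrow> ex" where
  "bind F = (\<lambda>d. F (\<lambda>e. Var (e - Suc d)) (Suc d))"

definition PI :: "ex \<Rightarrow> (ex \<Rightarrow> ex) \<Rightarrow> ex" where
  "PI A F = (\<lambda>d. Pi (A d) (bind F d))"

definition SIG :: "ex \<Rightarrow> (ex \<Rightarrow> ex) \<Rightarrow> ex" where
  "SIG A F = (\<lambda>d. Sig (A d) (bind F d))"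

definition LAM :: "(ex \<Rightarrow> ex) \<Rightarrow> ex" where
  "LAM F = (\<lambda>d. Lam (bind F d))"

definition AP :: "ex \<Rightarrow> ex \<Rightarrow> ex" (infixl \<open>\<cdot>\<close> 90) where
  "f \<cdot> a = (\<lambda>d. App (f d) (a d))"

definition PAIR :: "ex \<Rightarrow> ex \<Rightarrow> ex" where
  "PAIR a b = (\<lambda>d. Pair (a d) (b d))"

definition FST :: "ex \<Rightarrow> ex" where
  "FST p = (\<lambda>d. Fst (p d))"

definition SND :: "ex \<Rightarrow> ex" where
  "SND p = (\<lambda>d. Snd (p d))"

definition UNI :: "nat \<Rightarrow> ex" where
  "UNI i = (\<lambda>d. Univ i)"

definition CON :: "const \<Rightarrow> ex" where
  "CON c = (\<lambda>d. Con c)"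

abbreviation ARR :: "ex \<Rightarrow> ex \<Rightarrow> ex" (infixr \<open>\<rightarrow>\<^sub>t\<close> 60) where
  "A \<rightarrow>\<^sub>t B \<equiv> PI A (\<lambda>_. B)"

abbreviation PROD :: "ex \<Rightarrow> ex \<Rightarrow> ex" (infixr \<open>\<times>\<^sub>t\<close> 65) where
  "A \<times>\<^sub>t B \<equiv> SIG A (\<lambda>_. B)"

abbreviation EMPTY :: ex where "EMPTY \<equiv> CON CEmpty"
abbreviation UNIT :: ex where "UNIT \<equiv> CON CUnit"
abbreviation STAR :: ex where "STAR \<equiv> CON CStar"
abbreviation PLUS :: "ex \<Rightarrow> ex \<Rightarrow> ex" where "PLUS A B \<equiv> CON CSum \<cdot> A \<cdot> B"
abbreviation INL :: "ex \<Rightarrow> ex \<Rightarrow> ex \<Rightarrow> ex" where "INL A B a \<equiv> CON CInl \<cdot> A \<cdot> B \<cdot> a"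
abbreviation INR :: "ex \<Rightarrow> ex \<Rightarrow> ex \<Rightarrow> ex" where "INR A B b \<equiv> CON CInr \<cdot> A \<cdot> B \<cdot> b"
abbreviation NAT :: ex where "NAT \<equiv> CON CNat"
abbreviation ZERO :: ex where "ZERO \<equiv> CON CZero"
abbreviation SUCC :: "ex \<Rightarrow> ex" where "SUCC n \<equiv> CON CSucc \<cdot> n"
abbreviation ID :: "ex \<Rightarrow> ex \<Rightarrow> ex \<Rightarrow> ex" where "ID A a b \<equiv> CON CId \<cdot> A \<cdot> a \<cdot> b"
abbreviation REFL :: "ex \<Rightarrow> ex \<Rightarrow> ex" where "REFL A a \<equiv> CON CRefl \<cdot> A \<cdot> a"
abbreviation TRUNC :: "ex \<Rightarrow> ex" where "TRUNC A \<equiv> CON CTrunc \<cdot> A"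
abbreviation TRIN :: "ex \<Rightarrow> ex \<Rightarrow> ex" where "TRIN A a \<equiv> CON CTrIn \<cdot> A \<cdot> a"
abbreviation QUOT :: "ex \<Rightarrow> ex \<Rightarrow> ex" where "QUOT A R \<equiv> CON CQuot \<cdot> A \<cdot> R"
abbreviation CLS :: "ex \<Rightarrow> ex \<Rightarrow> ex \<Rightarrow> ex" where "CLS A R a \<equiv> CON CCls \<cdot> A \<cdot> R \<cdot> a"

section \<open>Basic univalent notions\<close>

definition is_contr :: "ex \<Rightarrow> ex" where
  "is_contr A = SIG A (\<lambda>c. PI A (\<lambda>x. ID A c x))"

definition is_prop :: "ex \<Rightarrow> ex" where
  "is_prop A = PI A (\<lambda>x. PI A (\<lambda>y. ID A x y))"

definition is_set :: "ex \<Rightarrow> ex" where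
  "is_set A = PI A (\<lambda>x. PI A (\<lambda>y. is_prop (ID A x y)))"

definition fiber :: "ex \<Rightarrow> ex \<Rightarrow> ex \<Rightarrow> ex \<Rightarrow> ex" where
  "fiber A B f y = SIG A (\<lambda>x. ID B (f \<cdot> x) y)"

definition is_equiv :: "ex \<Rightarrow> ex \<Rightarrow> ex \<Rightarrow> ex" where
  "is_equiv A B f = PI B (\<lambda>y. is_contr (fiber A B f y))"

definition tequiv :: "ex \<Rightarrow> ex \<Rightarrow> ex" where
  "tequiv A B = SIG (A \<rightarrow>\<^sub>t B) (\<lambda>f. is_equiv A B f)"

text \<open>
  The identity equivalence. Every \<open>(x, p) : \<Sigma> x. x = y\<close> equals \<open>(y, refl)\<close>, by path induction on \<open>p\<close>.
\<close>

definition id_equiv :: "ex \<Rightarrow> ex" where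
  "id_equiv A =
     PAIR (LAM (\<lambda>x. x))
       (LAM (\<lambda>y. PAIR (PAIR y (REFL A y))
         (CON CSigInd \<cdot> A \<cdot> LAM (\<lambda>x. ID A x y)
           \<cdot> LAM (\<lambda>z. ID (SIG A (\<lambda>x. ID A x y)) (PAIR y (REFL A y)) z)
           \<cdot> LAM (\<lambda>x. LAM (\<lambda>p.
               CON CJ \<cdot> A \<cdot> x
                 \<cdot> LAM (\<lambda>y'. LAM (\<lambda>q. ID (SIG A (\<lambda>x'. ID A x' y')) (PAIR y' (REFL A y')) (PAIR x q)))
                 \<cdot> REFL (SIG A (\<lambda>x'. ID A x' x)) (PAIR x (REFL A x))
                 \<cdot> y \<cdot> p)))))"

definition id_to_equiv :: "nat \<Rightarrow> ex \<Rightarrow> ex \<Rightarrow> ex" where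
  "id_to_equiv i A B =
     LAM (\<lambda>p. CON CJ \<cdot> UNI i \<cdot> A \<cdot> LAM (\<lambda>X. LAM (\<lambda>_. tequiv A X)) \<cdot> id_equiv A \<cdot> B \<cdot> p)"

section \<open>Types of the constants\<close>

text \<open>
  Constants carry no universe level: \<open>Con c\<close> has type \<open>ctype i c\<close> for every \<open>i\<close> (typical ambiguity).
\<close>

primrec ctype :: "nat \<Rightarrow> const \<Rightarrow> ex" where
  "ctype i CEmpty = UNI i"
| "ctype i CEmptyInd = PI (EMPTY \<rightarrow>\<^sub>t UNI i) (\<lambda>P. PI EMPTY (\<lambda>x. P \<cdot> x))"
| "ctype i CUnit = UNI i"
| "ctype i CStar = UNIT"
| "ctype i CUnitInd = PI (UNIT \<rightarrow>\<^sub>t UNI i) (\<lambda>P. P \<cdot> STAR \<rightarrow>\<^sub>t PI UNIT (\<lambda>x. P \<cdot> x))"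
| "ctype i CSum = UNI i \<rightarrow>\<^sub>t UNI i \<rightarrow>\<^sub>t UNI i"
| "ctype i CInl = PI (UNI i) (\<lambda>A. PI (UNI i) (\<lambda>B. A \<rightarrow>\<^sub>t PLUS A B))"
| "ctype i CInr = PI (UNI i) (\<lambda>A. PI (UNI i) (\<lambda>B. B \<rightarrow>\<^sub>t PLUS A B))"
| "ctype i CSumInd =
     PI (UNI i) (\<lambda>A. PI (UNI i) (\<lambda>B. PI (PLUS A B \<rightarrow>\<^sub>t UNI i) (\<lambda>P.
       PI A (\<lambda>a. P \<cdot> INL A B a) \<rightarrow>\<^sub>t PI B (\<lambda>b. P \<cdot> INR A B b) \<rightarrow>\<^sub>t PI (PLUS A B) (\<lambda>x. P \<cdot> x))))"
| "ctype i CNat = UNI i"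
| "ctype i CZero = NAT"
| "ctype i CSucc = NAT \<rightarrow>\<^sub>t NAT"
| "ctype i CNatInd =
     PI (NAT \<rightarrow>\<^sub>t UNI i) (\<lambda>P.
       P \<cdot> ZERO \<rightarrow>\<^sub>t PI NAT (\<lambda>n. P \<cdot> n \<rightarrow>\<^sub>t P \<cdot> SUCC n) \<rightarrow>\<^sub>t PI NAT (\<lambda>n. P \<cdot> n))"
| "ctype i CId = PI (UNI i) (\<lambda>A. A \<rightarrow>\<^sub>t A \<rightarrow>\<^sub>t UNI i)"
| "ctype i CRefl = PI (UNI i) (\<lambda>A. PI A (\<lambda>a. ID A a a))"
| "ctype i CJ =
     PI (UNI i) (\<lambda>A. PI A (\<lambda>a. PI (PI A (\<lambda>x. ID A a x \<rightarrow>\<^sub>t UNI i)) (\<lambda>P.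
       P \<cdot> a \<cdot> REFL A a \<rightarrow>\<^sub>t PI A (\<lambda>x. PI (ID A a x) (\<lambda>p. P \<cdot> x \<cdot> p)))))"
| "ctype i CSigInd =
     PI (UNI i) (\<lambda>A. PI (A \<rightarrow>\<^sub>t UNI i) (\<lambda>B. PI (SIG A (\<lambda>a. B \<cdot> a) \<rightarrow>\<^sub>t UNI i) (\<lambda>P.
       PI A (\<lambda>a. PI (B \<cdot> a) (\<lambda>b. P \<cdot> PAIR a b)) \<rightarrow>\<^sub>t PI (SIG A (\<lambda>a. B \<cdot> a)) (\<lambda>z. P \<cdot> z))))"
| "ctype i CTrunc = UNI i \<rightarrow>\<^sub>t UNI i"
| "ctype i CTrIn = PI (UNI i) (\<lambda>A. A \<rightarrow>\<^sub>t TRUNC A)"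
| "ctype i CTrProp = PI (UNI i) (\<lambda>A. is_prop (TRUNC A))"
| "ctype i CTrInd =
     PI (UNI i) (\<lambda>A. PI (TRUNC A \<rightarrow>\<^sub>t UNI i) (\<lambda>P.
       PI (TRUNC A) (\<lambda>z. is_prop (P \<cdot> z)) \<rightarrow>\<^sub>t PI A (\<lambda>a. P \<cdot> TRIN A a)
         \<rightarrow>\<^sub>t PI (TRUNC A) (\<lambda>z. P \<cdot> z)))"
| "ctype i CQuot = PI (UNI i) (\<lambda>A. (A \<rightarrow>\<^sub>t A \<rightarrow>\<^sub>t UNI i) \<rightarrow>\<^sub>t UNI i)"
| "ctype i CCls = PI (UNI i) (\<lambda>A. PI (A \<rightarrow>\<^sub>t A \<rightarrow>\<^sub>t UNI i) (\<lambda>R. A \<rightarrow>\<^sub>t QUOT A R))"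
| "ctype i CQuotEq =
     PI (UNI i) (\<lambda>A. PI (A \<rightarrow>\<^sub>t A \<rightarrow>\<^sub>t UNI i) (\<lambda>R. PI A (\<lambda>a. PI A (\<lambda>b.
       R \<cdot> a \<cdot> b \<rightarrow>\<^sub>t ID (QUOT A R) (CLS A R a) (CLS A R b)))))"
| "ctype i CQuotSet = PI (UNI i) (\<lambda>A. PI (A \<rightarrow>\<^sub>t A \<rightarrow>\<^sub>t UNI i) (\<lambda>R. is_set (QUOT A R)))"
| "ctype i CQuotRec =
     PI (UNI i) (\<lambda>A. PI (A \<rightarrow>\<^sub>t A \<rightarrow>\<^sub>t UNI i) (\<lambda>R. PI (UNI i) (\<lambda>B.
       is_set B \<rightarrow>\<^sub>t PI (A \<rightarrow>\<^sub>t B) (\<lambda>f.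
         PI A (\<lambda>a. PI A (\<lambda>b. R \<cdot> a \<cdot> b \<rightarrow>\<^sub>t ID B (f \<cdot> a) (f \<cdot> b))) \<rightarrow>\<^sub>t QUOT A R \<rightarrow>\<^sub>t B))))"
| "ctype i CQuotInd =
     PI (UNI i) (\<lambda>A. PI (A \<rightarrow>\<^sub>t A \<rightarrow>\<^sub>t UNI i) (\<lambda>R. PI (QUOT A R \<rightarrow>\<^sub>t UNI i) (\<lambda>P.
       PI (QUOT A R) (\<lambda>z. is_prop (P \<cdot> z)) \<rightarrow>\<^sub>t PI A (\<lambda>a. P \<cdot> CLS A R a)
         \<rightarrow>\<^sub>t PI (QUOT A R) (\<lambda>z. P \<cdot> z))))"
| "ctype i CFunExt =
     PI (UNI i) (\<lambda>A. PI (A \<rightarrow>\<^sub>t UNI i) (\<lambda>B.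
       PI (PI A (\<lambda>x. B \<cdot> x)) (\<lambda>f. PI (PI A (\<lambda>x. B \<cdot> x)) (\<lambda>g.
         PI A (\<lambda>x. ID (B \<cdot> x) (f \<cdot> x) (g \<cdot> x)) \<rightarrow>\<^sub>t ID (PI A (\<lambda>x. B \<cdot> x)) f g))))"
| "ctype i CUnivalence =
     PI (UNI i) (\<lambda>A. PI (UNI i) (\<lambda>B. is_equiv (ID (UNI i) A B) (tequiv A B) (id_to_equiv i A B)))"

section \<open>Conversion and typing\<close>

abbreviation apps :: "tm \<Rightarrow> tm list \<Rightarrow> tm" where
  "apps f as \<equiv> foldl App f as"

inductive conv :: "tm \<Rightarrow> tm \<Rightarrow> bool" (infix \<open>\<approx>\<close> 50) where
  conv_refl: "t \<approx> t"
| conv_sym: "s \<approx> t \<Longrightarrow> t \<approx> s"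
| conv_trans: "s \<approx> t \<Longrightarrow> t \<approx> u \<Longrightarrow> s \<approx> u"
| conv_Pi: "A \<approx> A' \<Longrightarrow> B \<approx> B' \<Longrightarrow> Pi A B \<approx> Pi A' B'"
| conv_Lam: "t \<approx> t' \<Longrightarrow> Lam t \<approx> Lam t'"
| conv_App: "f \<approx> f' \<Longrightarrow> a \<approx> a' \<Longrightarrow> App f a \<approx> App f' a'"
| conv_Sig: "A \<approx> A' \<Longrightarrow> B \<approx> B' \<Longrightarrow> Sig A B \<approx> Sig A' B'"
| conv_Pair: "a \<approx> a' \<Longrightarrow> b \<approx> b' \<Longrightarrow> Pair a b \<approx> Pair a' b'"
| conv_Fst: "p \<approx> p' \<Longrightarrow> Fst p \<approx> Fst p'"
| conv_Snd: "p \<approx> p' \<Longrightarrow> Snd p \<approx> Snd p'"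
| conv_beta: "App (Lam t) a \<approx> inst t a"
| conv_eta: "Lam (App (ren Suc f) (Var 0)) \<approx> f"
| conv_fst: "Fst (Pair a b) \<approx> a"
| conv_snd: "Snd (Pair a b) \<approx> b"
| conv_UnitInd: "apps (Con CUnitInd) [P, c, Con CStar] \<approx> c"
| conv_SumInl: "apps (Con CSumInd) [A, B, P, l, r, apps (Con CInl) [A', B', a]] \<approx> App l a"
| conv_SumInr: "apps (Con CSumInd) [A, B, P, l, r, apps (Con CInr) [A', B', b]] \<approx> App r b"
| conv_NatZero: "apps (Con CNatInd) [P, z, s, Con CZero] \<approx> z"
| conv_NatSucc:
    "apps (Con CNatInd) [P, z, s, App (Con CSucc) n] \<approx> apps s [n, apps (Con CNatInd) [P, z, s, n]]"
| conv_J: "apps (Con CJ) [A, a, P, c, x, apps (Con CRefl) [A', a']] \<approx> c"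
| conv_SigInd: "apps (Con CSigInd) [A, B, P, f, Pair a b] \<approx> apps f [a, b]"
| conv_TrInd: "apps (Con CTrInd) [A, P, h, f, apps (Con CTrIn) [A', a]] \<approx> App f a"
| conv_QuotRec: "apps (Con CQuotRec) [A, R, B, h, f, c, apps (Con CCls) [A', R', a]] \<approx> App f a"

text \<open>
  Contexts are lists, innermost variable first. A context is only ever extended by a well-formed
  type, so every context in a derivation starting from \<open>[]\<close> is well-formed.
\<close>

inductive typing :: "tm list \<Rightarrow> tm \<Rightarrow> tm \<Rightarrow> bool" (\<open>_ \<turnstile> _ : _\<close> [51, 51, 51] 50) where
  ty_Var: "n < length \<Gamma> \<Longrightarrow> \<Gamma> \<turnstile> Var n : ren (\<lambda>k. k + Suc n) (\<Gamma> ! n)"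
| ty_Univ: "\<Gamma> \<turnstile> Univ i : Univ (Suc i)"
| ty_cumul: "\<Gamma> \<turnstile> A : Univ i \<Longrightarrow> \<Gamma> \<turnstile> A : Univ (Suc i)"
| ty_Pi: "\<Gamma> \<turnstile> A : Univ i \<Longrightarrow> A # \<Gamma> \<turnstile> B : Univ i \<Longrightarrow> \<Gamma> \<turnstile> Pi A B : Univ i"
| ty_Lam: "\<Gamma> \<turnstile> A : Univ i \<Longrightarrow> A # \<Gamma> \<turnstile> t : B \<Longrightarrow> \<Gamma> \<turnstile> Lam t : Pi A B"
| ty_App: "\<Gamma> \<turnstile> f : Pi A B \<Longrightarrow> \<Gamma> \<turnstile> a : A \<Longrightarrow> \<Gamma> \<turnstile> App f a : inst B a"
| ty_Sig: "\<Gamma> \<turnstile> A : Univ i \<Longrightarrow> A # \<Gamma> \<turnstile> B : Univ i \<Longrightarrow> \<Gamma> \<turnstile> Sig A B : Univ i"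
| ty_Pair: "\<Gamma> \<turnstile> Sig A B : Univ i \<Longrightarrow> \<Gamma> \<turnstile> a : A \<Longrightarrow> \<Gamma> \<turnstile> b : inst B a \<Longrightarrow> \<Gamma> \<turnstile> Pair a b : Sig A B"
| ty_Fst: "\<Gamma> \<turnstile> p : Sig A B \<Longrightarrow> \<Gamma> \<turnstile> Fst p : A"
| ty_Snd: "\<Gamma> \<turnstile> p : Sig A B \<Longrightarrow> \<Gamma> \<turnstile> Snd p : inst B (Fst p)"
| ty_Con: "\<Gamma> \<turnstile> Con c : ctype i c 0"
| ty_conv: "\<Gamma> \<turnstile> t : A \<Longrightarrow> A \<approx> B \<Longrightarrow> \<Gamma> \<turnstile> B : Univ i \<Longrightarrow> \<Gamma> \<turnstile> t : B"

definition inhabited :: "ex \<Rightarrow> bool" where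
  "inhabited X \<longleftrightarrow> (\<exists>t. [] \<turnstile> t : X 0)"

section \<open>Rings and algebras\<close>

definition fin :: "ex \<Rightarrow> ex" where
  "fin n = CON CNatInd \<cdot> LAM (\<lambda>_. UNI 0) \<cdot> EMPTY \<cdot> LAM (\<lambda>_. LAM (\<lambda>F. PLUS F UNIT)) \<cdot> n"

datatype ring_data = Ring (car: ex) (rzero: ex) (rone: ex) (radd: ex) (rneg: ex) (rmul: ex)

abbreviation plus_in :: "ring_data \<Rightarrow> ex \<Rightarrow> ex \<Rightarrow> ex" where
  "plus_in K x y \<equiv> radd K \<cdot> x \<cdot> y"

abbreviation times_in :: "ring_data \<Rightarrow> ex \<Rightarrow> ex \<Rightarrow> ex" where
  "times_in K x y \<equiv> rmul K \<cdot> x \<cdot> y"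

abbreviation eq_in :: "ring_data \<Rightarrow> ex \<Rightarrow> ex \<Rightarrow> ex" where
  "eq_in K x y \<equiv> ID (car K) x y"

definition is_comm_ring :: "ring_data \<Rightarrow> ex" where
  "is_comm_ring K =
     is_set (car K)
     \<times>\<^sub>t PI (car K) (\<lambda>x. PI (car K) (\<lambda>y. PI (car K) (\<lambda>z.
          eq_in K (plus_in K (plus_in K x y) z) (plus_in K x (plus_in K y z)))))
     \<times>\<^sub>t PI (car K) (\<lambda>x. PI (car K) (\<lambda>y. eq_in K (plus_in K x y) (plus_in K y x)))
     \<times>\<^sub>t PI (car K) (\<lambda>x. eq_in K (plus_in K (rzero K) x) x)
     \<times>\<^sub>t PI (car K) (\<lambda>x. eq_in K (plus_in K (rneg K \<cdot> x) x) (rzero K))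
     \<times>\<^sub>t PI (car K) (\<lambda>x. PI (car K) (\<lambda>y. PI (car K) (\<lambda>z.
          eq_in K (times_in K (times_in K x y) z) (times_in K x (times_in K y z)))))
     \<times>\<^sub>t PI (car K) (\<lambda>x. PI (car K) (\<lambda>y. eq_in K (times_in K x y) (times_in K y x)))
     \<times>\<^sub>t PI (car K) (\<lambda>x. eq_in K (times_in K (rone K) x) x)
     \<times>\<^sub>t PI (car K) (\<lambda>x. PI (car K) (\<lambda>y. PI (car K) (\<lambda>z.
          eq_in K (times_in K x (plus_in K y z)) (plus_in K (times_in K x y) (times_in K x z)))))"

text \<open>
  Quantification over all commutative rings in \<open>UNI l\<close>, where the quantifier \<open>Q\<close> is \<open>PI\<close> or \<open>SIG\<close>.
\<close>

definition over_rings :: "(ex \<Rightarrow> (ex \<Rightarrow> ex) \<Rightarrow> ex) \<Rightarrow> nat \<Rightarrow> (ring_data \<Rightarrow> ex) \<Rightarrow> ex" where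
  "over_rings Q l F =
     Q (UNI l) (\<lambda>K. Q K (\<lambda>z. Q K (\<lambda>u. Q (K \<rightarrow>\<^sub>t K \<rightarrow>\<^sub>t K) (\<lambda>a. Q (K \<rightarrow>\<^sub>t K) (\<lambda>n. Q (K \<rightarrow>\<^sub>t K \<rightarrow>\<^sub>t K) (\<lambda>m.
       Q (is_comm_ring (Ring K z u a n m)) (\<lambda>_. F (Ring K z u a n m))))))))"

definition is_ring_hom :: "ring_data \<Rightarrow> ring_data \<Rightarrow> ex \<Rightarrow> ex" where
  "is_ring_hom K L f =
     eq_in L (f \<cdot> rone K) (rone L)
     \<times>\<^sub>t PI (car K) (\<lambda>x. PI (car K) (\<lambda>y. eq_in L (f \<cdot> plus_in K x y) (plus_in L (f \<cdot> x) (f \<cdot> y))))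
     \<times>\<^sub>t PI (car K) (\<lambda>x. PI (car K) (\<lambda>y. eq_in L (f \<cdot> times_in K x y) (times_in L (f \<cdot> x) (f \<cdot> y))))"

text \<open>The second component is the structure map from the base ring.\<close>

datatype alg_data = Alg (aring: ring_data) (amap: ex)

abbreviation acar :: "alg_data \<Rightarrow> ex" where
  "acar A \<equiv> car (aring A)"

definition over_algs ::
    "(ex \<Rightarrow> (ex \<Rightarrow> ex) \<Rightarrow> ex) \<Rightarrow> nat \<Rightarrow> ring_data \<Rightarrow> (alg_data \<Rightarrow> ex) \<Rightarrow> ex" where
  "over_algs Q l R F =
     over_rings Q l (\<lambda>K. Q (car R \<rightarrow>\<^sub>t car K) (\<lambda>h. Q (is_ring_hom R K h) (\<lambda>_. F (Alg K h))))"

definition base_alg :: "ring_data \<Rightarrow> alg_data" where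
  "base_alg R = Alg R (LAM (\<lambda>x. x))"

definition alg_hom :: "ring_data \<Rightarrow> alg_data \<Rightarrow> alg_data \<Rightarrow> ex" where
  "alg_hom R A B =
     SIG (acar A \<rightarrow>\<^sub>t acar B) (\<lambda>f.
       is_ring_hom (aring A) (aring B) f
       \<times>\<^sub>t PI (car R) (\<lambda>r. ID (acar B) (f \<cdot> (amap A \<cdot> r)) (amap B \<cdot> r)))"

definition alg_equiv :: "ring_data \<Rightarrow> alg_data \<Rightarrow> alg_data \<Rightarrow> ex" where
  "alg_equiv R A B = SIG (alg_hom R A B) (\<lambda>f. is_equiv (acar A) (acar B) (FST f))"

definition Spec :: "ring_data \<Rightarrow> alg_data \<Rightarrow> ex" where
  "Spec R A = alg_hom R A (base_alg R)"

definition has_inv :: "ring_data \<Rightarrow> ex \<Rightarrow> ex" where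
  "has_inv K x = SIG (car K) (\<lambda>z. eq_in K (times_in K x z) (rone K))"

text \<open>
  Polynomial algebras, quotients by finitely many elements, and localizations are given by their
  universal properties, which determine them up to a unique equivalence, hence, by univalence, up
  to a unique identification.
\<close>

definition is_poly_alg :: "nat \<Rightarrow> ring_data \<Rightarrow> ex \<Rightarrow> alg_data \<Rightarrow> ex \<Rightarrow> ex" where
  "is_poly_alg l R n P X =
     over_algs PI l R (\<lambda>B. PI (fin n \<rightarrow>\<^sub>t acar B) (\<lambda>b.
       is_contr (SIG (alg_hom R P B) (\<lambda>h. PI (fin n) (\<lambda>i. ID (acar B) (FST h \<cdot> (X \<cdot> i)) (b \<cdot> i))))))"

definition is_quotient_alg :: "nat \<Rightarrow> ring_data \<Rightarrow> alg_data \<Rightarrow> ex \<Rightarrow> ex \<Rightarrow> alg_data \<Rightarrow> ex \<Rightarrow> ex" where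
  "is_quotient_alg l R P m f Q q =
     PI (fin m) (\<lambda>i. ID (acar Q) (FST q \<cdot> (f \<cdot> i)) (rzero (aring Q)))
     \<times>\<^sub>t over_algs PI l R (\<lambda>B. PI (alg_hom R P B) (\<lambda>h.
          PI (fin m) (\<lambda>i. ID (acar B) (FST h \<cdot> (f \<cdot> i)) (rzero (aring B))) \<rightarrow>\<^sub>t
          is_contr (SIG (alg_hom R Q B) (\<lambda>k.
            PI (acar P) (\<lambda>p. ID (acar B) (FST k \<cdot> (FST q \<cdot> p)) (FST h \<cdot> p))))))"

definition is_localization :: "nat \<Rightarrow> ring_data \<Rightarrow> ex \<Rightarrow> alg_data \<Rightarrow> ex" where
  "is_localization l R r L =
     has_inv (aring L) (amap L \<cdot> r)
     \<times>\<^sub>t over_algs PI l R (\<lambda>B. has_inv (aring B) (amap B \<cdot> r) \<rightarrow>\<^sub>t is_contr (alg_hom R L B))"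

text \<open>\<open>A \<simeq> R[X\<^sub>1, \<dots>, X\<^sub>n] / (f\<^sub>1, \<dots>, f\<^sub>m)\<close>, merely.\<close>

definition is_fp :: "nat \<Rightarrow> ring_data \<Rightarrow> alg_data \<Rightarrow> ex" where
  "is_fp l R A =
     TRUNC (SIG NAT (\<lambda>n. SIG NAT (\<lambda>m.
       over_algs SIG l R (\<lambda>P. SIG (fin n \<rightarrow>\<^sub>t acar P) (\<lambda>X. is_poly_alg l R n P X \<times>\<^sub>t
         SIG (fin m \<rightarrow>\<^sub>t acar P) (\<lambda>f.
           over_algs SIG l R (\<lambda>Q. SIG (alg_hom R P Q) (\<lambda>q.
             is_quotient_alg l R P m f Q q \<times>\<^sub>t alg_equiv R A Q))))))))"

section \<open>The axioms\<close>

definition axiom_duality :: "nat \<Rightarrow> ring_data \<Rightarrow> ex" where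
  "axiom_duality l R =
     over_algs PI l R (\<lambda>A. is_fp l R A \<rightarrow>\<^sub>t
       is_equiv (acar A) (Spec R A \<rightarrow>\<^sub>t car R) (LAM (\<lambda>a. LAM (\<lambda>\<phi>. FST \<phi> \<cdot> a))))"

definition axiom_choice :: "nat \<Rightarrow> ring_data \<Rightarrow> ex" where
  "axiom_choice l R =
     over_algs PI l R (\<lambda>A. is_fp l R A \<rightarrow>\<^sub>t
       PI (Spec R A \<rightarrow>\<^sub>t UNI l) (\<lambda>P.
         PI (Spec R A) (\<lambda>x. TRUNC (P \<cdot> x)) \<rightarrow>\<^sub>t TRUNC (PI (Spec R A) (\<lambda>x. P \<cdot> x))))"

definition axiom_constant :: "nat \<Rightarrow> ring_data \<Rightarrow> ex" where
  "axiom_constant l R =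
     over_algs PI l R (\<lambda>A. is_fp l R A \<rightarrow>\<^sub>t
       is_equiv NAT (Spec R A \<rightarrow>\<^sub>t NAT) (LAM (\<lambda>k. LAM (\<lambda>_. k))))"

section \<open>Modal types and sheafification\<close>

definition big_sum :: "ring_data \<Rightarrow> ex \<Rightarrow> ex \<Rightarrow> ex" where
  "big_sum K n f =
     CON CNatInd \<cdot> LAM (\<lambda>k. (fin k \<rightarrow>\<^sub>t car K) \<rightarrow>\<^sub>t car K)
       \<cdot> LAM (\<lambda>_. rzero K)
       \<cdot> LAM (\<lambda>k. LAM (\<lambda>s. LAM (\<lambda>g.
           plus_in K (s \<cdot> LAM (\<lambda>i. g \<cdot> INL (fin k) UNIT i)) (g \<cdot> INR (fin k) UNIT STAR))))
       \<cdot> n \<cdot> f"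

text \<open>\<open>(f\<^sub>1, \<dots>, f\<^sub>n) = (1)\<close> says that \<open>1\<close> is, merely, a linear combination of the \<open>f\<^sub>i\<close>.\<close>

definition Um :: "ring_data \<Rightarrow> ex" where
  "Um K = SIG NAT (\<lambda>n. SIG (fin n \<rightarrow>\<^sub>t car K) (\<lambda>f.
     TRUNC (SIG (fin n \<rightarrow>\<^sub>t car K) (\<lambda>c.
       eq_in K (big_sum K n (LAM (\<lambda>i. times_in K (c \<cdot> i) (f \<cdot> i)))) (rone K)))))"

text \<open>
  A definite description ``\<open>T\<close> of the object \<open>x\<close> such that \<open>U x\<close>'' is rendered \<open>\<Sigma> x. U x \<times> T x\<close>: for a
  universal property \<open>U\<close> the type \<open>\<Sigma> x. U x\<close> is a proposition, so this is \<open>T x\<close> for the essentially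
  unique such \<open>x\<close>. The next definition is in this sense the spectrum of the localization of \<open>R\<close> at
  \<open>r\<close>, and \<open>sheafified\<close> below is the sheafification of a proposition.
\<close>

definition D :: "nat \<Rightarrow> ring_data \<Rightarrow> ex \<Rightarrow> ex" where
  "D l R r = over_algs SIG l R (\<lambda>L. is_localization l R r L \<times>\<^sub>t Spec R L)"

definition D_Um :: "nat \<Rightarrow> ring_data \<Rightarrow> ex \<Rightarrow> ex" where
  "D_Um l R u = TRUNC (SIG (fin (FST u)) (\<lambda>i. D l R (FST (SND u) \<cdot> i)))"

definition is_modal :: "nat \<Rightarrow> ring_data \<Rightarrow> ex \<Rightarrow> ex" where
  "is_modal l R T =
     PI (Um R) (\<lambda>u. is_equiv T (D_Um l R u \<rightarrow>\<^sub>t T) (LAM (\<lambda>t. LAM (\<lambda>_. t))))"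

definition is_sheafification :: "nat \<Rightarrow> ring_data \<Rightarrow> ex \<Rightarrow> ex \<Rightarrow> ex" where
  "is_sheafification l R P S =
     is_prop S \<times>\<^sub>t is_modal l R S \<times>\<^sub>t (P \<rightarrow>\<^sub>t S)
     \<times>\<^sub>t PI (UNI l) (\<lambda>Q. is_prop Q \<rightarrow>\<^sub>t is_modal l R Q \<rightarrow>\<^sub>t (P \<rightarrow>\<^sub>t Q) \<rightarrow>\<^sub>t S \<rightarrow>\<^sub>t Q)"

definition sheafified :: "nat \<Rightarrow> ring_data \<Rightarrow> ex \<Rightarrow> ex" where
  "sheafified l R P = SIG (UNI l) (\<lambda>S. is_sheafification l R P S \<times>\<^sub>t S)"

definition sheaf_empty :: "nat \<Rightarrow> ring_data \<Rightarrow> ex" where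
  "sheaf_empty l R = sheafified l R EMPTY"

definition sheaf_trunc :: "nat \<Rightarrow> ring_data \<Rightarrow> ex \<Rightarrow> ex" where
  "sheaf_trunc l R T = sheafified l R (TRUNC T)"

text \<open>Being a local ring, read in the sheaf model.\<close>

definition sheaf_local :: "nat \<Rightarrow> ring_data \<Rightarrow> ex" where
  "sheaf_local l R =
     (eq_in R (rone R) (rzero R) \<rightarrow>\<^sub>t sheaf_empty l R)
     \<times>\<^sub>t PI (car R) (\<lambda>x. PI (car R) (\<lambda>y.
          has_inv R (plus_in R x y) \<rightarrow>\<^sub>t sheaf_trunc l R (PLUS (has_inv R x) (has_inv R y))))"

end

theory Submission
  imports Defs
begin

text \<open>
  The unit type is a proposition and it is modal, because all maps into it agree. Hence it is the
  sheafification of a proposition \<open>P\<close> as soon as every modal proposition \<open>Q\<close> implied by \<open>P\<close> is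
  inhabited (\<open>sheafified_intro\<close>), and both halves of locality reduce to inhabiting such a \<open>Q\<close>. Since
  \<open>Q\<close> is modal, it suffices to choose a unimodular sequence \<open>u\<close> and to derive \<open>Q\<close> from \<open>D(u)\<close>
  (\<open>modal_elim\<close>). A point of \<open>D(r)\<close> is a homomorphism from the localization at \<open>r\<close> to the base ring;
  it carries the inverse of \<open>r\<close> in the localization to an inverse of \<open>r\<close> (\<open>D_has_inv\<close>). So \<open>Q\<close> only
  has to be derived from the invertibility of each single entry of \<open>u\<close> (\<open>cover_elim\<close>).

  If \<open>1 = 0\<close>, the empty sequence is unimodular and has no entries (\<open>trivial_ring_sheaf_empty\<close>). If
  \<open>(x + y) v = 1\<close>, then \<open>v x + v y = 1\<close>, so \<open>(x, y)\<close> is unimodular; each of its two entries being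
  invertible yields \<open>P\<close>, hence \<open>Q\<close> (\<open>invertible_sum_sheaf_local\<close>).

  What has to be shown formally is that a derivation exists in the calculus. The derivations are
  built in a higher-order abstract syntax on top of the typing relation, whose judgements are \<open>ty\<close>
  (being a type), \<open>el\<close> (being an element) and \<open>inh\<close> (having an element). HOL variables play the
  role of object variables, and the type of an application is computed by \<open>\<beta>\<close>-reduction in HOL instead
  of substitution in terms. This is sound for families that commute with substitution; the relation
  \<open>sim\<close> expresses this condition, and all families written with the term formers satisfy it.
\<close>

section \<open>Renaming and substitution\<close>

lemma up_ren_comp: "up_ren \<rho> \<circ> up_ren \<rho>' = up_ren (\<rho> \<circ> \<rho>')"
proof
  fix n show "(up_ren \<rho> \<circ> up_ren \<rho>') n = up_ren (\<rho> \<circ> \<rho>') n" by (cases n) auto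
qed

lemma ren_ren: "ren \<rho> (ren \<rho>' t) = ren (\<rho> \<circ> \<rho>') t"
  by (induction t arbitrary: \<rho> \<rho>') (auto simp: up_ren_comp)

lemma up_subst_up_ren: "up_subst \<sigma> \<circ> up_ren \<rho> = up_subst (\<sigma> \<circ> \<rho>)"
proof
  fix n show "(up_subst \<sigma> \<circ> up_ren \<rho>) n = up_subst (\<sigma> \<circ> \<rho>) n" by (cases n) auto
qed

lemma subst_ren: "subst \<sigma> (ren \<rho> t) = subst (\<sigma> \<circ> \<rho>) t"
  by (induction t arbitrary: \<sigma> \<rho>) (auto simp: up_subst_up_ren)

lemma up_ren_up_subst: "ren (up_ren \<rho>) \<circ> up_subst \<sigma> = up_subst (ren \<rho> \<circ> \<sigma>)"
proof
  fix n show "(ren (up_ren \<rho>) \<circ> up_subst \<sigma>) n = up_subst (ren \<rho> \<circ> \<sigma>) n"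
    by (cases n) (auto simp: ren_ren comp_def)
qed

lemma ren_subst: "ren \<rho> (subst \<sigma> t) = subst (ren \<rho> \<circ> \<sigma>) t"
  by (induction t arbitrary: \<sigma> \<rho>) (auto simp: up_ren_up_subst)

lemma up_subst_Var: "up_subst (Var \<circ> \<rho>) = Var \<circ> up_ren \<rho>"
proof
  fix n show "up_subst (Var \<circ> \<rho>) n = (Var \<circ> up_ren \<rho>) n" by (cases n) auto
qed

lemma ren_eq_subst: "ren \<rho> t = subst (Var \<circ> \<rho>) t"
  by (induction t arbitrary: \<rho>) (auto simp: up_subst_Var)

lemma up_ren_id: "up_ren (\<lambda>n. n) = (\<lambda>n. n)"
proof
  fix n show "up_ren (\<lambda>n. n) n = n" by (cases n) auto
qed

lemma ren_id: "ren (\<lambda>n. n) t = t"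
  by (induction t) (auto simp: up_ren_id)

lemma ren_inst: "ren \<rho> (inst t a) = inst (ren (up_ren \<rho>) t) (ren \<rho> a)"
proof -
  have "ren \<rho> \<circ> case_nat a Var = case_nat (ren \<rho> a) Var \<circ> up_ren \<rho>"
  proof
    fix n show "(ren \<rho> \<circ> case_nat a Var) n = (case_nat (ren \<rho> a) Var \<circ> up_ren \<rho>) n"
      by (cases n) auto
  qed
  then show ?thesis by (simp add: inst_def ren_subst subst_ren)
qed

section \<open>Weakening\<close>

text \<open>
  The types of the constants are closed, so neither a substitution nor the depth at which they are
  read changes them.
\<close>

lemma subst_ctype: "subst \<sigma> (ctype i c d) = ctype i c d'"
  by (cases c)
    (simp_all add: PI_def SIG_def LAM_def AP_def PAIR_def UNI_def CON_def bind_def is_prop_def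
      is_set_def is_equiv_def is_contr_def fiber_def tequiv_def id_equiv_def id_to_equiv_def numeral_eq_Suc)

lemma ren_ctype: "ren \<rho> (ctype i c d) = ctype i c d'"
  by (simp add: ren_eq_subst subst_ctype)

lemma up_ren_Suc: "ren (up_ren \<rho>) (ren Suc t) = ren Suc (ren \<rho> t)"
  by (simp add: ren_ren comp_def)

lemma conv_ren: "s \<approx> t \<Longrightarrow> ren \<rho> s \<approx> ren \<rho> t"
proof (induction arbitrary: \<rho> rule: conv.induct)
  case (conv_sym s t) then show ?case by (blast intro: conv.conv_sym)
next
  case (conv_trans s t u) then show ?case by (blast intro: conv.conv_trans)
next
  case (conv_beta t a) show ?case by (simp add: ren_inst conv.conv_beta)
next
  case (conv_eta f)
  show ?case using conv.conv_eta[of "ren \<rho> f"] by (simp add: up_ren_Suc)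
qed (simp_all add: conv.conv_refl conv.conv_Pi conv.conv_Lam conv.conv_App conv.conv_Sig
  conv.conv_Pair conv.conv_Fst conv.conv_Snd conv.conv_fst conv.conv_snd conv.conv_UnitInd[simplified] conv.conv_SumInl[simplified]
  conv.conv_SumInr[simplified] conv.conv_NatZero[simplified] conv.conv_NatSucc[simplified]
  conv.conv_J[simplified] conv.conv_SigInd[simplified] conv.conv_TrInd[simplified]
  conv.conv_QuotRec[simplified])

definition ren_typed :: "(nat \<Rightarrow> nat) \<Rightarrow> tm list \<Rightarrow> tm list \<Rightarrow> bool" where
  "ren_typed \<rho> \<Gamma> \<Delta> \<longleftrightarrow> (\<forall>n < length \<Gamma>. \<rho> n < length \<Delta> \<and>
     ren \<rho> (ren (\<lambda>k. k + Suc n) (\<Gamma> ! n)) = ren (\<lambda>k. k + Suc (\<rho> n)) (\<Delta> ! \<rho> n))"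

lemma ren_typed_up:
  assumes "ren_typed \<rho> \<Gamma> \<Delta>"
  shows "ren_typed (up_ren \<rho>) (A # \<Gamma>) (ren \<rho> A # \<Delta>)"
  unfolding ren_typed_def
proof (intro allI impI)
  fix n assume n: "n < length (A # \<Gamma>)"
  show "up_ren \<rho> n < length (ren \<rho> A # \<Delta>) \<and>
     ren (up_ren \<rho>) (ren (\<lambda>k. k + Suc n) ((A # \<Gamma>) ! n))
       = ren (\<lambda>k. k + Suc (up_ren \<rho> n)) ((ren \<rho> A # \<Delta>) ! up_ren \<rho> n)"
  proof (cases n)
    case 0
    then show ?thesis by (simp add: ren_ren comp_def)
  next
    case (Suc j)
    then have j: "j < length \<Gamma>" using n by simp
    have eq: "ren \<rho> (ren (\<lambda>k. k + Suc j) (\<Gamma> ! j)) = ren (\<lambda>k. k + Suc (\<rho> j)) (\<Delta> ! \<rho> j)"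
      and lt: "\<rho> j < length \<Delta>"
      using assms j by (auto simp: ren_typed_def)
    have "ren (up_ren \<rho>) (ren (\<lambda>k. k + Suc n) ((A # \<Gamma>) ! n))
        = ren Suc (ren \<rho> (ren (\<lambda>k. k + Suc j) (\<Gamma> ! j)))"
      using Suc by (simp add: ren_ren comp_def)
    also have "\<dots> = ren Suc (ren (\<lambda>k. k + Suc (\<rho> j)) (\<Delta> ! \<rho> j))"
      by (simp only: eq)
    also have "\<dots> = ren (\<lambda>k. k + Suc (up_ren \<rho> n)) ((ren \<rho> A # \<Delta>) ! up_ren \<rho> n)"
      using Suc by (simp add: ren_ren comp_def)
    finally show ?thesis using Suc lt by simp
  qed
qed

lemma typing_ren: "\<Gamma> \<turnstile> t : A \<Longrightarrow> ren_typed \<rho> \<Gamma> \<Delta> \<Longrightarrow> \<Delta> \<turnstile> ren \<rho> t : ren \<rho> A"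
proof (induction arbitrary: \<rho> \<Delta> rule: typing.induct)
  case (ty_Var n \<Gamma>)
  then show ?case using typing.ty_Var[of "\<rho> n" \<Delta>] by (auto simp: ren_typed_def)
next
  case (ty_Lam \<Gamma> A i t B)
  then show ?case by (auto intro!: typing.ty_Lam simp: ren_typed_up)
next
  case (ty_App \<Gamma> f A B a)
  from typing.ty_App[OF ty_App.IH(1)[OF ty_App.prems, simplified] ty_App.IH(2)[OF ty_App.prems]]
  show ?case by (simp add: ren_inst)
next
  case (ty_Pair \<Gamma> A B i a b)
  from typing.ty_Pair[OF ty_Pair.IH(1)[OF ty_Pair.prems, simplified] ty_Pair.IH(2)[OF ty_Pair.prems]]
    ty_Pair.IH(3)[OF ty_Pair.prems]
  show ?case by (simp add: ren_inst)
next
  case (ty_Snd \<Gamma> p A B)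
  from typing.ty_Snd[OF ty_Snd.IH[OF ty_Snd.prems, simplified]]
  show ?case by (simp add: ren_inst)
next
  case (ty_Con \<Gamma> c i)
  then show ?case by (auto simp: ren_ctype[where d' = 0] intro: typing.ty_Con)
next
  case (ty_conv \<Gamma> t A B i)
  show ?case
    by (rule typing.ty_conv[OF ty_conv.IH(1)[OF ty_conv.prems] conv_ren[OF ty_conv.hyps(2)]
          ty_conv.IH(2)[OF ty_conv.prems, simplified]])
next
  case (ty_Pi \<Gamma> A i B)
  then show ?case by (auto intro!: typing.ty_Pi simp: ren_typed_up)
next
  case (ty_Sig \<Gamma> A i B)
  then show ?case by (auto intro!: typing.ty_Sig simp: ren_typed_up)
qed (auto intro: typing.ty_Univ typing.ty_cumul typing.ty_Fst)

lemma typing_weaken: "\<Gamma> \<turnstile> t : A \<Longrightarrow> \<Theta> @ \<Gamma> \<turnstile> ren (\<lambda>k. k + length \<Theta>) t : ren (\<lambda>k. k + length \<Theta>) A"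
  by (erule typing_ren) (auto simp: ren_typed_def ren_ren comp_def nth_append algebra_simps)

section \<open>Naturality of named expressions\<close>

text \<open>
  \<open>World \<sigma> m n\<close> is a substitution \<open>\<sigma>\<close> from depth \<open>m\<close> to depth \<open>n\<close>. An expression is an arbitrary
  function of the depth, and a body \<open>F :: ex \<Rightarrow> ex\<close> is an arbitrary function of expressions; neither
  is forced to commute with substitution. The logical relation \<open>sim w x y\<close> below says that \<open>y\<close> is the
  image of \<open>x\<close> along \<open>w\<close>, also under further binders. A body \<open>F\<close> that takes related arguments to
  related results is a genuine family of terms. This is the parametricity of \<open>F\<close>, and it holds for
  everything that is composed of the term formers.
\<close>

datatype world = World "nat \<Rightarrow> tm" nat nat

primrec ups :: "nat \<Rightarrow> (nat \<Rightarrow> tm) \<Rightarrow> nat \<Rightarrow> tm" where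
  "ups 0 \<sigma> = \<sigma>"
| "ups (Suc k) \<sigma> = up_subst (ups k \<sigma>)"

lemma ups_ups: "ups j (ups k \<sigma>) = ups (j + k) \<sigma>"
  by (induction j) auto

lemma ups_below: "j < k \<Longrightarrow> ups k \<sigma> j = Var j"
proof (induction k arbitrary: j)
  case (Suc k)
  then show ?case by (cases j) auto
qed simp

lemma ups_above: "ups k \<sigma> (i + k) = ren (\<lambda>n. n + k) (\<sigma> i)"
  by (induction k) (auto simp: ren_id ren_ren comp_def)

text \<open>
  The worlds above \<open>w\<close> are those reached from \<open>w\<close> by going under binders.
\<close>

definition wle :: "world \<Rightarrow> world \<Rightarrow> bool" where
  "wle w w' \<longleftrightarrow> (\<exists>k. w' = (case w of (World \<sigma> m n) \<Rightarrow> (World (ups k \<sigma>) (m + k) (n + k))))"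

definition sim :: "world \<Rightarrow> ex \<Rightarrow> ex \<Rightarrow> bool" where
  "sim w x y \<longleftrightarrow> (case w of (World \<sigma> m n) \<Rightarrow> \<forall>k. subst (ups k \<sigma>) (x (m + k)) = y (n + k))"

text \<open>
  A world over \<open>\<Gamma>\<close> is the identity on the variables of \<open>\<Gamma>\<close>, up to the difference in depth.
\<close>

definition over :: "tm list \<Rightarrow> world \<Rightarrow> bool" where
  "over \<Gamma> w \<longleftrightarrow> (case w of (World \<sigma> m n) \<Rightarrow> length \<Gamma> \<le> m \<and> length \<Gamma> \<le> n \<and>
     (\<forall>i. \<sigma> (i + (m - length \<Gamma>)) = Var (i + (n - length \<Gamma>))))"

definition sub_ctx :: "tm list \<Rightarrow> tm list \<Rightarrow> bool" (infix \<open>\<sqsubseteq>\<close> 50) where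
  "\<Gamma> \<sqsubseteq> \<Delta> \<longleftrightarrow> (\<exists>\<Theta>. \<Delta> = \<Theta> @ \<Gamma>)"

lemma sub_ctx_refl: "\<Gamma> \<sqsubseteq> \<Gamma>"
  by (auto simp: sub_ctx_def)

lemma sub_ctx_trans: "\<Gamma> \<sqsubseteq> \<Delta> \<Longrightarrow> \<Delta> \<sqsubseteq> \<Theta> \<Longrightarrow> \<Gamma> \<sqsubseteq> \<Theta>"
  by (auto simp: sub_ctx_def)

lemma sub_ctx_Cons: "\<Gamma> \<sqsubseteq> A # \<Gamma>"
  by (auto simp: sub_ctx_def)

lemma wle_trans: "wle w w' \<Longrightarrow> wle w' w'' \<Longrightarrow> wle w w''"
proof (cases w)
  case (World \<sigma> m n)
  assume "wle w w'" "wle w' w''"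
  then obtain j k where "w' = (World (ups j \<sigma>) (m + j) (n + j))" "w'' = World (ups k (ups j \<sigma>)) (m + j + k) (n + j + k)"
    by (auto simp: wle_def World)
  then show "wle w w''"
    by (auto simp: wle_def World ups_ups add.commute[of k j] intro!: exI[of _ "j + k"])

qed

lemma sim_wle: "wle w w' \<Longrightarrow> sim w x y \<Longrightarrow> sim w' x y"
proof (cases w)
  case (World \<sigma> m n)
  assume "wle w w'" and s: "sim w x y"
  then obtain j where w': "w' = (World (ups j \<sigma>) (m + j) (n + j))" by (auto simp: wle_def World)
  show "sim w' x y"
    using s unfolding sim_def w' World
    by (auto simp: ups_ups) (metis add.assoc add.commute)
qed

lemma over_up:
  assumes "over \<Gamma> (World \<sigma> m n)"
  shows "over \<Gamma> (World (up_subst \<sigma>) (Suc m) (Suc n))"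
proof -
  have "up_subst \<sigma> (i + (Suc m - length \<Gamma>)) = Var (i + (Suc n - length \<Gamma>))" for i
    using assms by (auto simp: over_def Suc_diff_le)
  then show ?thesis using assms by (auto simp: over_def)
qed

lemma over_wle: "wle w w' \<Longrightarrow> over \<Gamma> w \<Longrightarrow> over \<Gamma> w'"
proof (cases w)
  case (World \<sigma> m n)
  assume "wle w w'" and ov: "over \<Gamma> w"
  then obtain j where w': "w' = (World (ups j \<sigma>) (m + j) (n + j))" by (auto simp: wle_def World)
  have "over \<Gamma> (World (ups j \<sigma>) (m + j) (n + j))"
    using ov unfolding World by (induction j) (auto intro: over_up)
  then show "over \<Gamma> w'" by (simp add: w')
qed

lemma over_sub_ctx:
  assumes "\<Gamma> \<sqsubseteq> \<Delta>" "over \<Delta> w"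
  shows "over \<Gamma> w"
proof -
  obtain \<sigma> m n where w: "w = (World \<sigma> m n)" by (cases w)
  obtain \<Theta> where \<Delta>: "\<Delta> = \<Theta> @ \<Gamma>" using assms(1) by (auto simp: sub_ctx_def)
  have "\<sigma> (i + (m - length \<Gamma>)) = Var (i + (n - length \<Gamma>))" for i
  proof -
    have "\<sigma> ((i + length \<Theta>) + (m - length \<Delta>)) = Var ((i + length \<Theta>) + (n - length \<Delta>))"
      using assms(2) by (simp only: over_def w world.case)
    then show ?thesis using assms(2) by (auto simp: over_def w \<Delta> algebra_simps)
  qed
  then show ?thesis using assms(2) by (auto simp: over_def w \<Delta>)
qed

lemma sim_AP: "sim w f f' \<Longrightarrow> sim w a a' \<Longrightarrow> sim w (f \<cdot> a) (f' \<cdot> a')"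
  by (cases w) (auto simp: sim_def AP_def)

lemma sim_PAIR: "sim w a a' \<Longrightarrow> sim w b b' \<Longrightarrow> sim w (PAIR a b) (PAIR a' b')"
  by (cases w) (auto simp: sim_def PAIR_def)

lemma sim_FST: "sim w p p' \<Longrightarrow> sim w (FST p) (FST p')"
  by (cases w) (auto simp: sim_def FST_def)

lemma sim_SND: "sim w p p' \<Longrightarrow> sim w (SND p) (SND p')"
  by (cases w) (auto simp: sim_def SND_def)

lemma sim_UNI: "sim w (UNI i) (UNI i)"
  by (cases w) (auto simp: sim_def UNI_def)

lemma sim_CON: "sim w (CON c) (CON c)"
  by (cases w) (auto simp: sim_def CON_def)

text \<open>
  The variables that are bound at the two depths are related, because a substitution that has been
  taken under a binder fixes the index of the bound variable.
\<close>

lemma sim_bind: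
  assumes "\<And>w' x y. wle w w' \<Longrightarrow> sim w' x y \<Longrightarrow> sim w' (F x) (F' y)" and w: "w = (World \<sigma> m n)"
  shows "subst (up_subst (ups k \<sigma>)) (bind F (m + k)) = bind F' (n + k)"
proof -
  let ?w = "(World (ups (Suc k) \<sigma>) (m + Suc k) (n + Suc k))"
  have le: "wle w ?w" by (auto simp: wle_def w)
  have "sim ?w (\<lambda>e. Var (e - Suc (m + k))) (\<lambda>e. Var (e - Suc (n + k)))"
    by (auto simp del: ups.simps simp: sim_def ups_ups ups_below)
  from assms(1)[OF le this]
  show ?thesis by (auto simp: sim_def bind_def dest: spec[of _ 0])
qed

lemma sim_PI:
  assumes "sim w A A'" "\<And>w' x y. wle w w' \<Longrightarrow> sim w' x y \<Longrightarrow> sim w' (F x) (F' y)"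
  shows "sim w (PI A F) (PI A' F')"
  using assms(1) by (cases w) (auto simp: sim_def PI_def intro: sim_bind assms(2))

lemma sim_SIG:
  assumes "sim w A A'" "\<And>w' x y. wle w w' \<Longrightarrow> sim w' x y \<Longrightarrow> sim w' (F x) (F' y)"
  shows "sim w (SIG A F) (SIG A' F')"
  using assms(1) by (cases w) (auto simp: sim_def SIG_def intro: sim_bind assms(2))

lemma sim_LAM:
  assumes "\<And>w' x y. wle w w' \<Longrightarrow> sim w' x y \<Longrightarrow> sim w' (F x) (F' y)"
  shows "sim w (LAM F) (LAM F')"
  by (cases w) (auto simp: sim_def LAM_def intro: sim_bind assms)

section \<open>Judgements\<close>

text \<open>
  An expression over \<open>\<Gamma>\<close> is read at depth \<open>length \<Gamma>\<close>; naturality makes its value at any greater depth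
  the weakening of that value (\<open>natural_ren\<close>). The judgement \<open>ty\<close> hides the universe level, so that
  levels only appear where a type has to belong to a given universe. The judgement \<open>inh\<close> hides the
  element; it reads a type as a proposition, and most of the mathematics takes place there.
\<close>

definition natural :: "tm list \<Rightarrow> ex \<Rightarrow> bool" where
  "natural \<Gamma> X \<longleftrightarrow> (\<forall>w. over \<Gamma> w \<longrightarrow> sim w X X)"

definition ty :: "tm list \<Rightarrow> ex \<Rightarrow> bool" where
  "ty \<Gamma> A \<longleftrightarrow> natural \<Gamma> A \<and> (\<exists>i. \<Gamma> \<turnstile> A (length \<Gamma>) : Univ i)"

definition el :: "tm list \<Rightarrow> ex \<Rightarrow> ex \<Rightarrow> bool" where
  "el \<Gamma> X T \<longleftrightarrow> natural \<Gamma> X \<and> natural \<Gamma> T \<and> \<Gamma> \<turnstile> X (length \<Gamma>) : T (length \<Gamma>)"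

definition inh :: "tm list \<Rightarrow> ex \<Rightarrow> bool" where
  "inh \<Gamma> T \<longleftrightarrow> (\<exists>X. el \<Gamma> X T)"

lemma natural_sub_ctx: "\<Gamma> \<sqsubseteq> \<Delta> \<Longrightarrow> natural \<Gamma> X \<Longrightarrow> natural \<Delta> X"
  by (auto simp: natural_def intro: over_sub_ctx)

lemma natural_ren:
  assumes "natural \<Gamma> X" "length \<Gamma> \<le> d"
  shows "X d = ren (\<lambda>k. k + (d - length \<Gamma>)) (X (length \<Gamma>))"
proof -
  have "over \<Gamma> (World (Var \<circ> (\<lambda>k. k + (d - length \<Gamma>))) (length \<Gamma>) d)"
    using assms(2) by (auto simp: over_def)
  then have "sim (World (Var \<circ> (\<lambda>k. k + (d - length \<Gamma>))) (length \<Gamma>) d) X X"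
    using assms(1) by (auto simp: natural_def)
  then show ?thesis by (auto simp: sim_def ren_eq_subst dest: spec[of _ 0])
qed

lemma typing_sub_ctx:
  assumes "\<Gamma> \<sqsubseteq> \<Delta>" "natural \<Gamma> X" "natural \<Gamma> T" "\<Gamma> \<turnstile> X (length \<Gamma>) : T (length \<Gamma>)"
  shows "\<Delta> \<turnstile> X (length \<Delta>) : T (length \<Delta>)"
proof -
  obtain \<Theta> where \<Delta>: "\<Delta> = \<Theta> @ \<Gamma>" using assms(1) by (auto simp: sub_ctx_def)
  have "Z (length \<Delta>) = ren (\<lambda>k. k + length \<Theta>) (Z (length \<Gamma>))" if "natural \<Gamma> Z" for Z
    using natural_ren[OF that, of "length \<Delta>"] by (simp add: \<Delta>)
  then show ?thesis using typing_weaken[OF assms(4), of \<Theta>] assms(2,3) by (simp add: \<Delta>)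
qed

lemma el_sub_ctx: "\<Gamma> \<sqsubseteq> \<Delta> \<Longrightarrow> el \<Gamma> X T \<Longrightarrow> el \<Delta> X T"
  by (auto simp: el_def intro: natural_sub_ctx typing_sub_ctx)

lemma natural_UNI: "natural \<Gamma> (UNI i)"
  by (simp add: natural_def sim_UNI)

lemma ty_iff_el: "ty \<Gamma> A \<longleftrightarrow> (\<exists>i. el \<Gamma> A (UNI i))"
  by (auto simp: ty_def el_def natural_UNI) (auto simp: UNI_def)

lemma ty_sub_ctx: "\<Gamma> \<sqsubseteq> \<Delta> \<Longrightarrow> ty \<Gamma> A \<Longrightarrow> ty \<Delta> A"
  by (auto simp: ty_iff_el intro: el_sub_ctx)

lemma inh_sub_ctx: "\<Gamma> \<sqsubseteq> \<Delta> \<Longrightarrow> inh \<Gamma> A \<Longrightarrow> inh \<Delta> A"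
  by (auto simp: inh_def intro: el_sub_ctx)

lemma el_cumul: "el \<Gamma> A (UNI i) \<Longrightarrow> i \<le> j \<Longrightarrow> el \<Gamma> A (UNI j)"
proof (induction j)
  case (Suc j)
  show ?case
  proof (cases "i = Suc j")
    case False
    then have "el \<Gamma> A (UNI j)" using Suc by simp
    then have "natural \<Gamma> A" "\<Gamma> \<turnstile> A (length \<Gamma>) : Univ j" by (simp_all add: el_def UNI_def)
    then show ?thesis using natural_UNI[of \<Gamma> "Suc j"] by (auto simp: el_def UNI_def intro: ty_cumul)
  qed (use Suc in simp)
qed simp

lemma ty_max:
  assumes "ty \<Gamma> A" "ty \<Delta> B"
  obtains i where "el \<Gamma> A (UNI i)" "el \<Delta> B (UNI i)"
proof -
  obtain i j where "el \<Gamma> A (UNI i)" "el \<Delta> B (UNI j)" using assms by (auto simp: ty_iff_el)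
  then have "el \<Gamma> A (UNI (max i j))" "el \<Delta> B (UNI (max i j))" by (auto elim: el_cumul)
  then show thesis by (rule that)
qed

text \<open>
  The variable that a binder adds to \<open>\<Gamma>\<close>.
\<close>

abbreviation var :: "tm list \<Rightarrow> ex" where
  "var \<Gamma> \<equiv> (\<lambda>e. Var (e - Suc (length \<Gamma>)))"

lemma el_var:
  assumes "natural \<Gamma> A"
  shows "el (A (length \<Gamma>) # \<Gamma>) (var \<Gamma>) A"
proof -
  let ?\<Delta> = "A (length \<Gamma>) # \<Gamma>"
  have "sim w (var \<Gamma>) (var \<Gamma>)" if "over ?\<Delta> w" for w
  proof -
    obtain \<sigma> m n where w: "w = (World \<sigma> m n)" by (cases w)
    have "subst (ups k \<sigma>) (var \<Gamma> (m + k)) = var \<Gamma> (n + k)" for k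
    proof -
      have "over ?\<Delta> (World (ups k \<sigma>) (m + k) (n + k))"
        using over_wle[OF _ that, of "(World (ups k \<sigma>) (m + k) (n + k))"] by (auto simp: wle_def w)
      then have "ups k \<sigma> (0 + (m + k - length ?\<Delta>)) = Var (0 + (n + k - length ?\<Delta>))"
        by (simp only: over_def world.case)
      then show ?thesis by simp
    qed
    then show ?thesis by (simp add: sim_def w)
  qed
  then have "natural ?\<Delta> (var \<Gamma>)" by (simp add: natural_def)
  moreover have "natural ?\<Delta> A" using assms by (rule natural_sub_ctx[OF sub_ctx_Cons])
  moreover have "A (length ?\<Delta>) = ren (\<lambda>k. k + Suc 0) (A (length \<Gamma>))"
    using natural_ren[OF assms, of "length ?\<Delta>"] by simp
  moreover have "?\<Delta> \<turnstile> Var 0 : ren (\<lambda>k. k + Suc 0) (?\<Delta> ! 0)"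
    by (rule ty_Var) simp
  ultimately show ?thesis by (simp add: el_def)
qed

text \<open>
  The instantiation of the last variable is a substitution from depth \<open>d + 1\<close> to depth \<open>d\<close>.
\<close>

lemma over_inst:
  assumes "length \<Gamma> \<le> d"
  shows "over \<Gamma> (World (case_nat t Var) (Suc d) d)"
  using assms by (auto simp: over_def Suc_diff_le)

text \<open>
  The instantiation relates the bound variable to \<open>a\<close>, so the naturality of \<open>F\<close> turns the syntactic
  instance of its body into \<open>F a\<close>. This is why dependent types can be computed by HOL itself.
\<close>

lemma bind_inst:
  assumes nat: "\<And>w x y. over \<Gamma> w \<Longrightarrow> sim w x y \<Longrightarrow> sim w (F x) (F y)"
    and a: "natural \<Gamma> a" and d: "length \<Gamma> \<le> d"
  shows "inst (bind F d) (a d) = F a d"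
proof -
  let ?\<sigma> = "case_nat (a d) Var"
  have "a (d + k) = ren (\<lambda>n. n + k) (a d)" for k
    using natural_ren[OF a, of "d + k"] natural_ren[OF a d] d by (simp add: ren_ren comp_def algebra_simps)
  then have "sim (World ?\<sigma> (Suc d) d) (\<lambda>e. Var (e - Suc d)) a"
    using ups_above[of _ ?\<sigma> 0] by (auto simp: sim_def)
  from nat[OF over_inst[OF d] this] show ?thesis
    by (auto simp: sim_def inst_def bind_def dest: spec[of _ 0])
qed

lemma natural_family:
  assumes nat: "\<And>w x y. over \<Gamma> w \<Longrightarrow> sim w x y \<Longrightarrow> sim w (F x) (F y)"
    and a: "natural \<Gamma> a"
  shows "natural \<Gamma> (F a)"
  using assms by (auto simp: natural_def)

lemma natural_PI:
  assumes "natural \<Gamma> A" "\<And>w x y. over \<Gamma> w \<Longrightarrow> sim w x y \<Longrightarrow> sim w (F x) (F y)"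
  shows "natural \<Gamma> (PI A F)"
  using assms by (auto simp: natural_def intro!: sim_PI assms(2) intro: over_wle)

lemma natural_SIG:
  assumes "natural \<Gamma> A" "\<And>w x y. over \<Gamma> w \<Longrightarrow> sim w x y \<Longrightarrow> sim w (F x) (F y)"
  shows "natural \<Gamma> (SIG A F)"
  using assms by (auto simp: natural_def intro!: sim_SIG assms(2) intro: over_wle)

lemma natural_LAM:
  assumes "\<And>w x y. over \<Gamma> w \<Longrightarrow> sim w x y \<Longrightarrow> sim w (F x) (F y)"
  shows "natural \<Gamma> (LAM F)"
  using assms by (auto simp: natural_def intro!: sim_LAM intro: over_wle)

text \<open>
  The instance of the premise on \<open>F\<close> that the typing rule calls for is the fresh variable in \<open>A # \<Gamma>\<close>.
  Letting the variable range over all elements of \<open>A\<close> in all extensions of \<open>\<Gamma>\<close> keeps contexts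
  abstract: a fact about \<open>\<Gamma>\<close> is carried to \<open>\<Delta>\<close> along \<open>\<Gamma> \<sqsubseteq> \<Delta>\<close>.
\<close>

lemma ty_PI:
  assumes A: "ty \<Gamma> A"
    and nat: "\<And>w x y. over \<Gamma> w \<Longrightarrow> sim w x y \<Longrightarrow> sim w (F x) (F y)"
    and F: "\<And>\<Delta> x. \<Gamma> \<sqsubseteq> \<Delta> \<Longrightarrow> el \<Delta> x A \<Longrightarrow> ty \<Delta> (F x)"
  shows "ty \<Gamma> (PI A F)"
proof -
  have "natural \<Gamma> A" using A by (simp add: ty_def)
  obtain i where "el \<Gamma> A (UNI i)" "el (A (length \<Gamma>) # \<Gamma>) (F (var \<Gamma>)) (UNI i)"
    using ty_max[OF A F[OF sub_ctx_Cons el_var[OF \<open>natural \<Gamma> A\<close>]]] .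
  then have "\<Gamma> \<turnstile> PI A F (length \<Gamma>) : Univ i"
    by (auto simp: el_def UNI_def PI_def bind_def intro: ty_Pi)
  then show ?thesis using natural_PI[OF \<open>natural \<Gamma> A\<close> nat] by (auto simp: ty_def)
qed

lemma ty_SIG:
  assumes A: "ty \<Gamma> A"
    and nat: "\<And>w x y. over \<Gamma> w \<Longrightarrow> sim w x y \<Longrightarrow> sim w (F x) (F y)"
    and F: "\<And>\<Delta> x. \<Gamma> \<sqsubseteq> \<Delta> \<Longrightarrow> el \<Delta> x A \<Longrightarrow> ty \<Delta> (F x)"
  shows "ty \<Gamma> (SIG A F)"
proof -
  have "natural \<Gamma> A" using A by (simp add: ty_def)
  obtain i where "el \<Gamma> A (UNI i)" "el (A (length \<Gamma>) # \<Gamma>) (F (var \<Gamma>)) (UNI i)"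
    using ty_max[OF A F[OF sub_ctx_Cons el_var[OF \<open>natural \<Gamma> A\<close>]]] .
  then have "\<Gamma> \<turnstile> SIG A F (length \<Gamma>) : Univ i"
    by (auto simp: el_def UNI_def SIG_def bind_def intro: ty_Sig)
  then show ?thesis using natural_SIG[OF \<open>natural \<Gamma> A\<close> nat] by (auto simp: ty_def)
qed

lemma el_LAM_var:
  assumes A: "ty \<Gamma> A"
    and natF: "\<And>w x y. over \<Gamma> w \<Longrightarrow> sim w x y \<Longrightarrow> sim w (F x) (F y)"
    and natB: "\<And>w x y. over \<Gamma> w \<Longrightarrow> sim w x y \<Longrightarrow> sim w (B x) (B y)"
    and F: "el (A (length \<Gamma>) # \<Gamma>) (F (var \<Gamma>)) (B (var \<Gamma>))"
  shows "el \<Gamma> (LAM F) (PI A B)"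
proof -
  have natural: "natural \<Gamma> A" using A by (simp add: ty_def)
  from F have "\<Gamma> \<turnstile> LAM F (length \<Gamma>) : PI A B (length \<Gamma>)"
    using A by (auto simp: ty_def el_def LAM_def PI_def bind_def intro: ty_Lam)
  then show ?thesis using natural_PI[OF natural natB] natural_LAM[OF natF] by (simp add: el_def)
qed

lemma el_LAM:
  assumes A: "ty \<Gamma> A"
    and natF: "\<And>w x y. over \<Gamma> w \<Longrightarrow> sim w x y \<Longrightarrow> sim w (F x) (F y)"
    and natB: "\<And>w x y. over \<Gamma> w \<Longrightarrow> sim w x y \<Longrightarrow> sim w (B x) (B y)"
    and F: "\<And>\<Delta> x. \<Gamma> \<sqsubseteq> \<Delta> \<Longrightarrow> el \<Delta> x A \<Longrightarrow> el \<Delta> (F x) (B x)"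
  shows "el \<Gamma> (LAM F) (PI A B)"
proof (rule el_LAM_var[OF A natF natB])
  show "el (A (length \<Gamma>) # \<Gamma>) (F (var \<Gamma>)) (B (var \<Gamma>))"
    by (rule F[OF sub_ctx_Cons el_var]) (use A in \<open>simp add: ty_def\<close>)
qed

text \<open>
  Every raw term over \<open>\<Gamma>\<close> is the value of a natural expression, namely of its own weakenings.
  Therefore an inhabitant of a type may be constructed as a raw term.
\<close>

lemma natural_wk: "natural \<Gamma> (\<lambda>e. ren (\<lambda>k. k + (e - length \<Gamma>)) t)"
  unfolding natural_def
proof (intro allI impI)
  fix w :: world assume ov: "over \<Gamma> w"
  obtain \<sigma> m n where w: "w = (World \<sigma> m n)" by (cases w)
  have "subst (ups k \<sigma>) (ren (\<lambda>i. i + (m + k - length \<Gamma>)) t) = ren (\<lambda>i. i + (n + k - length \<Gamma>)) t" for k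
  proof -
    have "over \<Gamma> (World (ups k \<sigma>) (m + k) (n + k))"
      using over_wle[OF _ ov, of "(World (ups k \<sigma>) (m + k) (n + k))"] by (auto simp: wle_def w)
    then have "ups k \<sigma> \<circ> (\<lambda>i. i + (m + k - length \<Gamma>)) = Var \<circ> (\<lambda>i. i + (n + k - length \<Gamma>))"
      by (auto simp: over_def)
    then show ?thesis by (simp only: subst_ren) (simp only: ren_eq_subst)
  qed
  then show "sim w (\<lambda>e. ren (\<lambda>k. k + (e - length \<Gamma>)) t) (\<lambda>e. ren (\<lambda>k. k + (e - length \<Gamma>)) t)"
    by (simp add: sim_def w)
qed

lemma inhI:
  assumes "\<Gamma> \<turnstile> t : T (length \<Gamma>)" "natural \<Gamma> T"
  shows "inh \<Gamma> T"
  unfolding inh_def el_def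
  by (rule exI[of _ "\<lambda>e. ren (\<lambda>k. k + (e - length \<Gamma>)) t"]) (use assms in \<open>simp add: natural_wk ren_id\<close>)

lemma inh_PI:
  assumes A: "ty \<Gamma> A"
    and natB: "\<And>w x y. over \<Gamma> w \<Longrightarrow> sim w x y \<Longrightarrow> sim w (B x) (B y)"
    and F: "\<And>\<Delta> x. \<Gamma> \<sqsubseteq> \<Delta> \<Longrightarrow> el \<Delta> x A \<Longrightarrow> inh \<Delta> (B x)"
  shows "inh \<Gamma> (PI A B)"
proof -
  have natural: "natural \<Gamma> A" using A by (simp add: ty_def)
  have "inh (A (length \<Gamma>) # \<Gamma>) (B (var \<Gamma>))"
    by (rule F[OF sub_ctx_Cons el_var[OF natural]])
  then obtain X where "el (A (length \<Gamma>) # \<Gamma>) X (B (var \<Gamma>))" by (auto simp: inh_def)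
  then have "\<Gamma> \<turnstile> Lam (X (Suc (length \<Gamma>))) : PI A B (length \<Gamma>)"
    using A by (auto simp: ty_def el_def PI_def bind_def intro: ty_Lam)
  then show ?thesis using natural_PI[OF natural natB] by (rule inhI)
qed

lemma el_AP:
  assumes f: "el \<Gamma> f (PI A B)" and a: "el \<Gamma> a A"
    and natB: "\<And>w x y. over \<Gamma> w \<Longrightarrow> sim w x y \<Longrightarrow> sim w (B x) (B y)"
  shows "el \<Gamma> (f \<cdot> a) (B a)"
proof -
  have natural: "natural \<Gamma> f" "natural \<Gamma> a" using f a by (auto simp: el_def)
  have "\<Gamma> \<turnstile> (f \<cdot> a) (length \<Gamma>) : inst (bind B (length \<Gamma>)) (a (length \<Gamma>))"
    using f a by (auto simp: el_def AP_def PI_def intro: ty_App)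
  moreover have "inst (bind B (length \<Gamma>)) (a (length \<Gamma>)) = B a (length \<Gamma>)"
    by (rule bind_inst[OF natB natural(2)]) auto
  moreover have "natural \<Gamma> (f \<cdot> a)" using natural by (auto simp: natural_def intro: sim_AP)
  ultimately show ?thesis using natural_family[OF natB natural(2)] by (simp add: el_def)
qed

lemma el_PAIR:
  assumes T: "ty \<Gamma> (SIG A B)" and a: "el \<Gamma> a A" and b: "el \<Gamma> b (B a)"
    and natB: "\<And>w x y. over \<Gamma> w \<Longrightarrow> sim w x y \<Longrightarrow> sim w (B x) (B y)"
  shows "el \<Gamma> (PAIR a b) (SIG A B)"
proof -
  have natural: "natural \<Gamma> a" "natural \<Gamma> b" "natural \<Gamma> (SIG A B)" using T a b by (auto simp: el_def ty_def)
  have "inst (bind B (length \<Gamma>)) (a (length \<Gamma>)) = B a (length \<Gamma>)"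
    by (rule bind_inst[OF natB natural(1)]) auto
  then have "\<Gamma> \<turnstile> PAIR a b (length \<Gamma>) : SIG A B (length \<Gamma>)"
    using T a b by (auto simp: el_def ty_def PAIR_def SIG_def intro: ty_Pair)
  moreover have "natural \<Gamma> (PAIR a b)" using natural by (auto simp: natural_def intro: sim_PAIR)
  ultimately show ?thesis using natural by (simp add: el_def)
qed

lemma el_FST:
  assumes p: "el \<Gamma> p (SIG A B)" and A: "ty \<Gamma> A"
  shows "el \<Gamma> (FST p) A"
proof -
  have "\<Gamma> \<turnstile> FST p (length \<Gamma>) : A (length \<Gamma>)"
    using p by (auto simp: el_def FST_def SIG_def intro: ty_Fst)
  moreover have "natural \<Gamma> (FST p)" using p by (auto simp: el_def natural_def intro: sim_FST)
  ultimately show ?thesis using A by (simp add: el_def ty_def)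
qed

lemma el_SND:
  assumes p: "el \<Gamma> p (SIG A B)"
    and natB: "\<And>w x y. over \<Gamma> w \<Longrightarrow> sim w x y \<Longrightarrow> sim w (B x) (B y)"
  shows "el \<Gamma> (SND p) (B (FST p))"
proof -
  have natural: "natural \<Gamma> p" using p by (auto simp: el_def)
  then have natural': "natural \<Gamma> (FST p)" "natural \<Gamma> (SND p)"
    by (auto simp: natural_def intro: sim_FST sim_SND)
  have "\<Gamma> \<turnstile> (SND p) (length \<Gamma>) : inst (bind B (length \<Gamma>)) (FST p (length \<Gamma>))"
    using p by (auto simp: el_def SND_def FST_def SIG_def intro: ty_Snd)
  moreover have "inst (bind B (length \<Gamma>)) (FST p (length \<Gamma>)) = B (FST p) (length \<Gamma>)"
    by (rule bind_inst[OF natB natural'(1)]) auto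
  ultimately show ?thesis using natural' natural_family[OF natB natural'(1)] by (simp add: el_def)
qed

section \<open>Conversion\<close>

text \<open>
  Conversion is required at all depths beyond \<open>\<Gamma>\<close>, so that it can be applied under binders.
\<close>

definition cv :: "tm list \<Rightarrow> ex \<Rightarrow> ex \<Rightarrow> bool" where
  "cv \<Gamma> T U \<longleftrightarrow> (\<forall>e \<ge> length \<Gamma>. T e \<approx> U e)"

lemma el_cv: "el \<Gamma> X T \<Longrightarrow> cv \<Gamma> T U \<Longrightarrow> ty \<Gamma> U \<Longrightarrow> el \<Gamma> X U"
  by (auto simp: el_def ty_def cv_def intro: ty_conv)

lemma inh_cv: "inh \<Gamma> T \<Longrightarrow> cv \<Gamma> T U \<Longrightarrow> ty \<Gamma> U \<Longrightarrow> inh \<Gamma> U"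
  by (auto simp: inh_def intro: el_cv)

lemma cv_refl: "cv \<Gamma> T T"
  by (auto simp: cv_def intro: conv_refl)

lemma cv_sym: "cv \<Gamma> T U \<Longrightarrow> cv \<Gamma> U T"
  by (auto simp: cv_def intro: conv_sym)

lemma cv_trans: "cv \<Gamma> T U \<Longrightarrow> cv \<Gamma> U V \<Longrightarrow> cv \<Gamma> T V"
  by (auto simp: cv_def intro: conv_trans)

lemma cv_sub_ctx: "\<Gamma> \<sqsubseteq> \<Delta> \<Longrightarrow> cv \<Gamma> T U \<Longrightarrow> cv \<Delta> T U"
  by (auto simp: cv_def sub_ctx_def)

lemma cv_AP: "cv \<Gamma> f f' \<Longrightarrow> cv \<Gamma> a a' \<Longrightarrow> cv \<Gamma> (f \<cdot> a) (f' \<cdot> a')"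
  by (auto simp: cv_def AP_def intro: conv_App)

lemma cv_FST: "cv \<Gamma> p p' \<Longrightarrow> cv \<Gamma> (FST p) (FST p')"
  by (auto simp: cv_def FST_def intro: conv_Fst)

text \<open>
  Conversion is untyped, so \<open>\<Gamma>\<close> can be padded with arbitrary types to a context of length \<open>e\<close>; the
  variable bound at depth \<open>e\<close> is then the last variable of a context that extends \<open>\<Gamma>\<close>.
\<close>

lemma cv_bind:
  assumes "\<And>\<Delta> x. \<Gamma> \<sqsubseteq> \<Delta> \<Longrightarrow> natural \<Delta> x \<Longrightarrow> cv \<Delta> (F x) (F' x)" and e: "length \<Gamma> \<le> e"
  shows "bind F e \<approx> bind F' e"
proof -
  let ?\<Delta> = "replicate (e - length \<Gamma>) (Univ 0) @ \<Gamma>"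
  have len: "length ?\<Delta> = e" using e by simp
  have "natural (Univ 0 # ?\<Delta>) (var ?\<Delta>)"
    using el_var[OF natural_UNI[of ?\<Delta> 0]] by (simp add: el_def UNI_def)
  moreover have "\<Gamma> \<sqsubseteq> Univ 0 # ?\<Delta>" by (auto simp: sub_ctx_def)
  ultimately have "cv (Univ 0 # ?\<Delta>) (F (var ?\<Delta>)) (F' (var ?\<Delta>))" using assms(1) by blast
  then show ?thesis unfolding cv_def bind_def len by (auto simp: len e)
qed

lemma cv_SIG:
  assumes "cv \<Gamma> A A'" "\<And>\<Delta> x. \<Gamma> \<sqsubseteq> \<Delta> \<Longrightarrow> natural \<Delta> x \<Longrightarrow> cv \<Delta> (F x) (F' x)"
  shows "cv \<Gamma> (SIG A F) (SIG A' F')"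
  using assms(1) cv_bind[OF assms(2)] by (auto simp: cv_def SIG_def intro!: conv_Sig)

lemma cv_PI:
  assumes "cv \<Gamma> A A'" "\<And>\<Delta> x. \<Gamma> \<sqsubseteq> \<Delta> \<Longrightarrow> natural \<Delta> x \<Longrightarrow> cv \<Delta> (F x) (F' x)"
  shows "cv \<Gamma> (PI A F) (PI A' F')"
  using assms(1) cv_bind[OF assms(2)] by (auto simp: cv_def PI_def intro!: conv_Pi)

lemma cv_beta:
  assumes "\<And>w x y. over \<Gamma> w \<Longrightarrow> sim w x y \<Longrightarrow> sim w (F x) (F y)" "natural \<Gamma> a"
  shows "cv \<Gamma> (LAM F \<cdot> a) (F a)"
  unfolding cv_def
proof (intro allI impI)
  fix e assume e: "length \<Gamma> \<le> e"
  show "(LAM F \<cdot> a) e \<approx> F a e"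
    using conv_beta[of "bind F e" "a e"] bind_inst[OF assms e] by (simp add: LAM_def AP_def)
qed

lemma cv_FST_PAIR: "cv \<Gamma> (FST (PAIR a b)) a"
  by (auto simp: cv_def FST_def PAIR_def intro: conv_fst)

lemma cv_SND_PAIR: "cv \<Gamma> (SND (PAIR a b)) b"
  by (auto simp: cv_def SND_def PAIR_def intro: conv_snd)

section \<open>Typing rules for the constants\<close>

text \<open>
  The method expression \<open>(assumption | rule form | rule app | erule leaf | erule lift)+\<close>, or a part
  of it, checks types and naturality throughout. The collection \<open>form\<close> holds the rules directed by
  the head symbol of the goal, and \<open>app\<close> the general rules for application, which come second since a
  type former such as \<open>ID A a b\<close> is itself an application. The rules \<open>leaf\<close> finish goals about
  expressions taken from the context. When nothing else fits, \<open>lift\<close> goes back one step, to the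
  context or world in which the expression at hand was introduced.
\<close>

named_theorems form
named_theorems lift
named_theorems leaf
named_theorems app

lemmas [form] = sim_PAIR sim_FST sim_SND sim_UNI sim_CON sim_PI sim_SIG sim_LAM sim_AP
lemmas [lift] = sim_wle over_wle natural_sub_ctx el_sub_ctx ty_sub_ctx inh_sub_ctx

lemma wle_pred [lift]: "wle w' w'' \<Longrightarrow> wle w w' \<Longrightarrow> wle w w''"
  by (rule wle_trans)

lemma sub_ctx_pred [lift]: "\<Delta>' \<sqsubseteq> \<Delta> \<Longrightarrow> \<Gamma> \<sqsubseteq> \<Delta>' \<Longrightarrow> \<Gamma> \<sqsubseteq> \<Delta>"
  by (rule sub_ctx_trans)

lemma over_pred [lift]: "over \<Delta> w \<Longrightarrow> \<Gamma> \<sqsubseteq> \<Delta> \<Longrightarrow> over \<Gamma> w"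
  by (rule over_sub_ctx)

lemma sim_natural [leaf]: "over \<Gamma> w \<Longrightarrow> natural \<Gamma> X \<Longrightarrow> sim w X X"
  by (auto simp: natural_def)

lemma natural_el [leaf]: "el \<Gamma> a A \<Longrightarrow> natural \<Gamma> a"
  by (auto simp: el_def)

lemma natural_ty [leaf]: "ty \<Gamma> a \<Longrightarrow> natural \<Gamma> a"
  by (auto simp: ty_def)

lemma sim_el: "over \<Gamma> w \<Longrightarrow> el \<Gamma> X T \<Longrightarrow> sim w X X"
  by (blast intro: sim_natural natural_el)

lemma sim_ty: "over \<Gamma> w \<Longrightarrow> ty \<Gamma> X \<Longrightarrow> sim w X X"
  by (blast intro: sim_natural natural_ty)

lemma ty_UNI [form]: "ty \<Gamma> (UNI i)"
  by (auto simp: ty_def natural_UNI) (auto simp: UNI_def intro: ty_Univ)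

lemmas [form] = ty_PI ty_SIG

lemma ty_el [leaf]: "el \<Gamma> A (UNI i) \<Longrightarrow> ty \<Gamma> A"
  by (auto simp: ty_iff_el)

lemma el_app [app]:
  assumes "el \<Gamma> f (A \<rightarrow>\<^sub>t B)" "el \<Gamma> a A" "\<And>w. over \<Gamma> w \<Longrightarrow> sim w B B"
  shows "el \<Gamma> (f \<cdot> a) B"
  by (rule el_AP[OF assms(1,2)]) (rule assms(3))

lemma ty_app [app]:
  assumes "el \<Gamma> f (A \<rightarrow>\<^sub>t UNI i)" "el \<Gamma> a A"
  shows "ty \<Gamma> (f \<cdot> a)"
  by (rule ty_el, rule el_app[OF assms]) (rule sim_UNI)

lemma el_CON: "el \<Gamma> (CON c) (ctype i c)"
proof -
  have "sim w (ctype i c) (ctype i c)" for w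
    by (cases w) (simp add: sim_def subst_ctype)
  moreover have "ctype i c 0 = ctype i c (length \<Gamma>)"
    by (rule subst_ctype[of Var, folded ren_eq_subst[of "\<lambda>n. n", unfolded comp_def]
        , unfolded ren_id])
  ultimately show ?thesis
    using ty_Con[of \<Gamma> c i] by (auto simp: el_def natural_def sim_CON) (auto simp: CON_def)
qed

lemma el_EMPTY [form]: "el \<Gamma> EMPTY (UNI i)"
  using el_CON[of \<Gamma> CEmpty i] by simp

lemma el_UNIT [form]: "el \<Gamma> UNIT (UNI i)"
  using el_CON[of \<Gamma> CUnit i] by simp

lemma el_NAT [form]: "el \<Gamma> NAT (UNI i)"
  using el_CON[of \<Gamma> CNat i] by simp

lemmas [form] = el_EMPTY[THEN ty_el] el_UNIT[THEN ty_el] el_NAT[THEN ty_el]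

lemma el_STAR [form]: "el \<Gamma> STAR UNIT"
  using el_CON[of \<Gamma> CStar 0] by simp

lemma el_ZERO [form]: "el \<Gamma> ZERO NAT"
  using el_CON[of \<Gamma> CZero 0] by simp

lemma el_SUCC [form]: "el \<Gamma> n NAT \<Longrightarrow> el \<Gamma> (SUCC n) NAT"
  using el_CON[of \<Gamma> CSucc 0, simplified]
  by (rule el_app) (assumption | rule form | erule leaf | erule lift)+

lemma el_ID: "el \<Gamma> A (UNI i) \<Longrightarrow> el \<Gamma> a A \<Longrightarrow> el \<Gamma> b A \<Longrightarrow> el \<Gamma> (ID A a b) (UNI i)"
proof -
  assume A: "el \<Gamma> A (UNI i)" and ab: "el \<Gamma> a A" "el \<Gamma> b A"
  have 1: "el \<Gamma> (CON CId \<cdot> A) (A \<rightarrow>\<^sub>t A \<rightarrow>\<^sub>t UNI i)"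
    by (rule el_AP[OF el_CON[of \<Gamma> CId i, simplified] A]) (assumption | rule form | erule leaf | erule lift)+
  show ?thesis
    by (rule el_app[OF el_app[OF 1 ab(1)] ab(2)]) (insert A, (assumption | rule form | erule leaf | erule lift)+)
qed

lemma ty_ID [form]: "ty \<Gamma> A \<Longrightarrow> el \<Gamma> a A \<Longrightarrow> el \<Gamma> b A \<Longrightarrow> ty \<Gamma> (ID A a b)"
  by (meson ty_iff_el el_ID)

lemma el_REFL [form]: "ty \<Gamma> A \<Longrightarrow> el \<Gamma> a A \<Longrightarrow> el \<Gamma> (REFL A a) (ID A a a)"
proof -
  assume A: "ty \<Gamma> A" and a: "el \<Gamma> a A"
  then obtain i where A': "el \<Gamma> A (UNI i)" by (auto simp: ty_iff_el)
  have 1: "el \<Gamma> (CON CRefl \<cdot> A) (PI A (\<lambda>a. ID A a a))"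
    by (rule el_AP[OF el_CON[of \<Gamma> CRefl i, simplified] A']) (assumption | rule form | erule leaf | erule lift)+
  show ?thesis
    by (rule el_AP[OF 1 a]) (insert A, (assumption | rule form | erule leaf | erule lift)+)
qed

lemma el_TRUNC: "el \<Gamma> A (UNI i) \<Longrightarrow> el \<Gamma> (TRUNC A) (UNI i)"
  using el_CON[of \<Gamma> CTrunc i, simplified]
  by (rule el_app) (assumption | rule form | erule leaf | erule lift)+

lemma ty_TRUNC [form]: "ty \<Gamma> A \<Longrightarrow> ty \<Gamma> (TRUNC A)"
  by (meson ty_iff_el el_TRUNC)

lemma el_TRIN [form]: "ty \<Gamma> A \<Longrightarrow> el \<Gamma> a A \<Longrightarrow> el \<Gamma> (TRIN A a) (TRUNC A)"
proof -
  assume A: "ty \<Gamma> A" and a: "el \<Gamma> a A"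
  then obtain i where A': "el \<Gamma> A (UNI i)" by (auto simp: ty_iff_el)
  have 1: "el \<Gamma> (CON CTrIn \<cdot> A) (A \<rightarrow>\<^sub>t TRUNC A)"
    by (rule el_AP[OF el_CON[of \<Gamma> CTrIn i, simplified] A']) (assumption | rule form | erule leaf | erule lift)+
  show ?thesis
    by (rule el_app[OF 1 a]) (insert A, (assumption | rule form | erule leaf | erule lift)+)
qed

lemma el_PLUS [form]: "el \<Gamma> A (UNI i) \<Longrightarrow> el \<Gamma> B (UNI i) \<Longrightarrow> el \<Gamma> (PLUS A B) (UNI i)"
  using el_CON[of \<Gamma> CSum i, simplified]
  by (elim el_app[rotated 1, OF _ _ el_app]) (assumption | rule form | erule leaf | erule lift)+

lemma ty_PLUS [form]: "ty \<Gamma> A \<Longrightarrow> ty \<Gamma> B \<Longrightarrow> ty \<Gamma> (PLUS A B)"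
  by (metis ty_max el_PLUS ty_el)

lemma el_INL [form]: "ty \<Gamma> A \<Longrightarrow> ty \<Gamma> B \<Longrightarrow> el \<Gamma> a A \<Longrightarrow> el \<Gamma> (INL A B a) (PLUS A B)"
proof -
  assume A: "ty \<Gamma> A" and B: "ty \<Gamma> B" and a: "el \<Gamma> a A"
  then obtain i where A': "el \<Gamma> A (UNI i)" "el \<Gamma> B (UNI i)" by (metis ty_max)
  have 1: "el \<Gamma> (CON CInl \<cdot> A) (PI (UNI i) (\<lambda>B. A \<rightarrow>\<^sub>t PLUS A B))"
    by (rule el_AP[OF el_CON[of \<Gamma> CInl i, simplified] A'(1)]) (assumption | rule form | erule leaf | erule lift)+
  have 2: "el \<Gamma> (CON CInl \<cdot> A \<cdot> B) (A \<rightarrow>\<^sub>t PLUS A B)"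
    by (rule el_AP[OF 1 A'(2)]) (insert A B, (assumption | rule form | erule leaf | erule lift)+)
  show ?thesis
    by (rule el_app[OF 2 a]) (insert A B, (assumption | rule form | erule leaf | erule lift)+)
qed

lemma el_INR [form]: "ty \<Gamma> A \<Longrightarrow> ty \<Gamma> B \<Longrightarrow> el \<Gamma> b B \<Longrightarrow> el \<Gamma> (INR A B b) (PLUS A B)"
proof -
  assume A: "ty \<Gamma> A" and B: "ty \<Gamma> B" and b: "el \<Gamma> b B"
  then obtain i where A': "el \<Gamma> A (UNI i)" "el \<Gamma> B (UNI i)" by (metis ty_max)
  have 1: "el \<Gamma> (CON CInr \<cdot> A) (PI (UNI i) (\<lambda>B. B \<rightarrow>\<^sub>t PLUS A B))"
    by (rule el_AP[OF el_CON[of \<Gamma> CInr i, simplified] A'(1)]) (assumption | rule form | erule leaf | erule lift)+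
  have 2: "el \<Gamma> (CON CInr \<cdot> A \<cdot> B) (B \<rightarrow>\<^sub>t PLUS A B)"
    by (rule el_AP[OF 1 A'(2)]) (insert A B, (assumption | rule form | erule leaf | erule lift)+)
  show ?thesis
    by (rule el_app[OF 2 b]) (insert A B, (assumption | rule form | erule leaf | erule lift)+)
qed

section \<open>Eliminators\<close>

lemma ty_levels: "ty \<Gamma> A \<Longrightarrow> \<exists>j. \<forall>i\<ge>j. el \<Gamma> A (UNI i)"
  by (auto simp: ty_iff_el intro: el_cumul)

text \<open>
  All type arguments of an eliminator must lie in one universe. Stating membership for all
  sufficiently large levels makes a common level available.
\<close>

lemma motive_levels:
  assumes A: "ty \<Gamma> A"
    and nat: "\<And>w x y. over \<Gamma> w \<Longrightarrow> sim w x y \<Longrightarrow> sim w (C x) (C y)"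
    and C: "\<And>\<Delta> x. \<Gamma> \<sqsubseteq> \<Delta> \<Longrightarrow> el \<Delta> x A \<Longrightarrow> ty \<Delta> (C x)"
  shows "\<exists>j. \<forall>i\<ge>j. el \<Gamma> (LAM C) (A \<rightarrow>\<^sub>t UNI i)"
proof -
  have "el (A (length \<Gamma>) # \<Gamma>) (var \<Gamma>) A" by (rule el_var) (use A in \<open>simp add: ty_def\<close>)
  then have "ty (A (length \<Gamma>) # \<Gamma>) (C (var \<Gamma>))" using C sub_ctx_Cons by blast
  then obtain j where "\<forall>i\<ge>j. el (A (length \<Gamma>) # \<Gamma>) (C (var \<Gamma>)) (UNI i)"
    using ty_levels by blast
  then have "\<forall>i\<ge>j. el \<Gamma> (LAM C) (A \<rightarrow>\<^sub>t UNI i)"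
    using A nat by (auto intro!: el_LAM_var sim_UNI)
  then show ?thesis by blast
qed

lemma cv_motive:
  assumes "\<And>w x y. over \<Gamma> w \<Longrightarrow> sim w x y \<Longrightarrow> sim w (C x) (C y)" "el \<Gamma> a A"
  shows "cv \<Gamma> (LAM C \<cdot> a) (C a)"
  using assms by (auto intro!: cv_beta simp: el_def)

text \<open>
  The motives of the following rules are functions \<open>C\<close> of HOL, whereas the types of the eliminators
  contain the object-level application \<open>LAM C \<cdot> x\<close>; the proofs mediate by \<open>\<beta>\<close>-conversion.
\<close>

lemma el_EmptyInd:
  assumes T: "ty \<Gamma> T" and x: "el \<Gamma> x EMPTY"
  shows "el \<Gamma> (CON CEmptyInd \<cdot> LAM (\<lambda>_. T) \<cdot> x) T"
proof -
  obtain i where P: "el \<Gamma> (LAM (\<lambda>_. T)) (EMPTY \<rightarrow>\<^sub>t UNI i)"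
    using motive_levels[OF el_EMPTY[THEN ty_el], of \<Gamma> "\<lambda>_. T"] sim_ty[OF _ T] ty_sub_ctx[OF _ T]
    by blast
  have 1: "el \<Gamma> (CON CEmptyInd \<cdot> LAM (\<lambda>_. T)) (PI EMPTY (\<lambda>x. LAM (\<lambda>_. T) \<cdot> x))"
    by (rule el_AP[OF el_CON[of \<Gamma> CEmptyInd i, simplified] P]) (assumption | rule form | erule leaf | erule lift)+
  have 2: "el \<Gamma> (CON CEmptyInd \<cdot> LAM (\<lambda>_. T) \<cdot> x) (LAM (\<lambda>_. T) \<cdot> x)"
    by (rule el_AP[OF 1 x]) (insert T, (assumption | rule form | erule leaf | erule lift)+)
  show ?thesis
    by (rule el_cv[OF 2 cv_motive[OF _ x] T]) (insert T, (assumption | rule form | erule leaf | erule lift)+)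
qed

lemma el_UnitInd:
  assumes nat: "\<And>w x y. over \<Gamma> w \<Longrightarrow> sim w x y \<Longrightarrow> sim w (C x) (C y)"
    and C: "\<And>\<Delta> x. \<Gamma> \<sqsubseteq> \<Delta> \<Longrightarrow> el \<Delta> x UNIT \<Longrightarrow> ty \<Delta> (C x)"
    and c: "el \<Gamma> c (C STAR)" and x: "el \<Gamma> x UNIT"
  shows "el \<Gamma> (CON CUnitInd \<cdot> LAM C \<cdot> c \<cdot> x) (C x)"
proof -
  let ?P = "LAM C"
  obtain i where P: "el \<Gamma> ?P (UNIT \<rightarrow>\<^sub>t UNI i)"
    using motive_levels[where C = C and \<Gamma> = \<Gamma>, OF el_UNIT[THEN ty_el] nat C] by blast
  have 1: "el \<Gamma> (CON CUnitInd \<cdot> ?P) (?P \<cdot> STAR \<rightarrow>\<^sub>t PI UNIT (\<lambda>x. ?P \<cdot> x))"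
    by (rule el_AP[OF el_CON[of \<Gamma> CUnitInd i, simplified] P]) (assumption | rule form | erule leaf | erule lift)+
  have c': "el \<Gamma> c (?P \<cdot> STAR)"
    by (rule el_cv[OF c cv_sym[OF cv_motive[OF nat]] ty_app[OF P]]) (assumption | rule form | erule leaf | erule lift)+
  have 2: "el \<Gamma> (CON CUnitInd \<cdot> ?P \<cdot> c) (PI UNIT (\<lambda>x. ?P \<cdot> x))"
    by (rule el_app[OF 1 c']) (insert P, (assumption | rule sim_PI sim_AP sim_CON | erule leaf | erule lift)+)
  have 3: "el \<Gamma> (CON CUnitInd \<cdot> ?P \<cdot> c \<cdot> x) (?P \<cdot> x)"
    by (rule el_AP[OF 2 x]) (insert P, (assumption | rule sim_PI sim_AP sim_CON | erule leaf | erule lift)+)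
  show ?thesis by (rule el_cv[OF 3 cv_motive[OF nat x] C[OF sub_ctx_refl x]])
qed

lemma el_SumInd:
  assumes A: "ty \<Gamma> A" and B: "ty \<Gamma> B"
    and nat: "\<And>w x y. over \<Gamma> w \<Longrightarrow> sim w x y \<Longrightarrow> sim w (C x) (C y)"
    and C: "\<And>\<Delta> x. \<Gamma> \<sqsubseteq> \<Delta> \<Longrightarrow> el \<Delta> x (PLUS A B) \<Longrightarrow> ty \<Delta> (C x)"
    and l: "el \<Gamma> l (PI A (\<lambda>a. C (INL A B a)))"
    and r: "el \<Gamma> r (PI B (\<lambda>b. C (INR A B b)))"
    and x: "el \<Gamma> x (PLUS A B)"
  shows "el \<Gamma> (CON CSumInd \<cdot> A \<cdot> B \<cdot> LAM C \<cdot> l \<cdot> r \<cdot> x) (C x)"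
proof -
  let ?P = "LAM C"
  obtain jA jB jC where j: "\<forall>i\<ge>jA. el \<Gamma> A (UNI i)" "\<forall>i\<ge>jB. el \<Gamma> B (UNI i)"
      "\<forall>i\<ge>jC. el \<Gamma> ?P (PLUS A B \<rightarrow>\<^sub>t UNI i)"
    using motive_levels[where C = C and \<Gamma> = \<Gamma>, OF ty_PLUS[OF A B] nat C] ty_levels[OF A] ty_levels[OF B] by blast
  define i where "i = max jA (max jB jC)"
  have A': "el \<Gamma> A (UNI i)" and B': "el \<Gamma> B (UNI i)" and P: "el \<Gamma> ?P (PLUS A B \<rightarrow>\<^sub>t UNI i)"
    using j by (auto simp: i_def)
  have 1: "el \<Gamma> (CON CSumInd \<cdot> A) (PI (UNI i) (\<lambda>B. PI (PLUS A B \<rightarrow>\<^sub>t UNI i) (\<lambda>P.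
       PI A (\<lambda>a. P \<cdot> INL A B a) \<rightarrow>\<^sub>t PI B (\<lambda>b. P \<cdot> INR A B b) \<rightarrow>\<^sub>t PI (PLUS A B) (\<lambda>x. P \<cdot> x))))"
    by (rule el_AP[OF el_CON[of \<Gamma> CSumInd i, simplified] A']) (assumption | rule form | erule leaf | erule lift)+
  have 2: "el \<Gamma> (CON CSumInd \<cdot> A \<cdot> B) (PI (PLUS A B \<rightarrow>\<^sub>t UNI i) (\<lambda>P.
       PI A (\<lambda>a. P \<cdot> INL A B a) \<rightarrow>\<^sub>t PI B (\<lambda>b. P \<cdot> INR A B b) \<rightarrow>\<^sub>t PI (PLUS A B) (\<lambda>x. P \<cdot> x)))"
    by (rule el_AP[OF 1 B']) (insert A, (assumption | rule form | erule leaf | erule lift)+)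
  have 3: "el \<Gamma> (CON CSumInd \<cdot> A \<cdot> B \<cdot> ?P)
       (PI A (\<lambda>a. ?P \<cdot> INL A B a) \<rightarrow>\<^sub>t PI B (\<lambda>b. ?P \<cdot> INR A B b) \<rightarrow>\<^sub>t PI (PLUS A B) (\<lambda>x. ?P \<cdot> x))"
    by (rule el_AP[OF 2 P]) (insert A B, (assumption | rule form | erule leaf | erule lift)+)
  have tyl: "ty \<Gamma> (PI A (\<lambda>a. ?P \<cdot> INL A B a))"
    by (insert A B P, (assumption | rule sim_PI sim_AP sim_CON ty_PI el_INL ty_app[of _ _ "PLUS A B"] | erule leaf | erule lift)+)
  have tyr: "ty \<Gamma> (PI B (\<lambda>b. ?P \<cdot> INR A B b))"
    by (insert A B P, (assumption | rule sim_PI sim_AP sim_CON ty_PI el_INR ty_app[of _ _ "PLUS A B"] | erule leaf | erule lift)+)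
  have l': "el \<Gamma> l (PI A (\<lambda>a. ?P \<cdot> INL A B a))"
  proof (rule el_cv[OF l _ tyl], rule cv_PI[OF cv_refl], rule cv_sym, rule cv_beta)
    fix \<Delta> a w x y assume *: "\<Gamma> \<sqsubseteq> \<Delta>" "natural \<Delta> a"
    show "sim w (C x) (C y)" if "over \<Delta> w" "sim w x y"
      using that * by (auto intro: nat over_sub_ctx)
    show "natural \<Delta> (INL A B a)"
      using * natural_sub_ctx[OF *(1) natural_ty[OF A]] natural_sub_ctx[OF *(1) natural_ty[OF B]]
      by (auto simp: natural_def intro!: sim_AP sim_CON)
  qed
  have r': "el \<Gamma> r (PI B (\<lambda>b. ?P \<cdot> INR A B b))"
  proof (rule el_cv[OF r _ tyr], rule cv_PI[OF cv_refl], rule cv_sym, rule cv_beta)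
    fix \<Delta> a w x y assume *: "\<Gamma> \<sqsubseteq> \<Delta>" "natural \<Delta> a"
    show "sim w (C x) (C y)" if "over \<Delta> w" "sim w x y"
      using that * by (auto intro: nat over_sub_ctx)
    show "natural \<Delta> (INR A B a)"
      using * natural_sub_ctx[OF *(1) natural_ty[OF A]] natural_sub_ctx[OF *(1) natural_ty[OF B]]
      by (auto simp: natural_def intro!: sim_AP sim_CON)
  qed
  have 4: "el \<Gamma> (CON CSumInd \<cdot> A \<cdot> B \<cdot> ?P \<cdot> l)
      (PI B (\<lambda>b. ?P \<cdot> INR A B b) \<rightarrow>\<^sub>t PI (PLUS A B) (\<lambda>x. ?P \<cdot> x))"
    by (rule el_app[OF 3 l']) (insert A B P, (assumption | rule sim_PI sim_AP sim_CON | erule leaf | erule lift)+)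
  have 5: "el \<Gamma> (CON CSumInd \<cdot> A \<cdot> B \<cdot> ?P \<cdot> l \<cdot> r) (PI (PLUS A B) (\<lambda>x. ?P \<cdot> x))"
    by (rule el_app[OF 4 r']) (insert A B P, (assumption | rule sim_PI sim_AP sim_CON | erule leaf | erule lift)+)
  have 6: "el \<Gamma> (CON CSumInd \<cdot> A \<cdot> B \<cdot> ?P \<cdot> l \<cdot> r \<cdot> x) (?P \<cdot> x)"
    by (rule el_AP[OF 5 x]) (insert P, (assumption | rule sim_PI sim_AP sim_CON | erule leaf | erule lift)+)
  show ?thesis by (rule el_cv[OF 6 cv_motive[OF nat x] C[OF sub_ctx_refl x]])
qed

lemma el_NatInd:
  assumes nat: "\<And>w x y. over \<Gamma> w \<Longrightarrow> sim w x y \<Longrightarrow> sim w (C x) (C y)"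
    and C: "\<And>\<Delta> x. \<Gamma> \<sqsubseteq> \<Delta> \<Longrightarrow> el \<Delta> x NAT \<Longrightarrow> ty \<Delta> (C x)"
    and z: "el \<Gamma> z (C ZERO)" and s: "el \<Gamma> s (PI NAT (\<lambda>n. C n \<rightarrow>\<^sub>t C (SUCC n)))"
    and n: "el \<Gamma> n NAT"
  shows "el \<Gamma> (CON CNatInd \<cdot> LAM C \<cdot> z \<cdot> s \<cdot> n) (C n)"
proof -
  let ?P = "LAM C"
  obtain i where P: "el \<Gamma> ?P (NAT \<rightarrow>\<^sub>t UNI i)"
    using motive_levels[where C = C and \<Gamma> = \<Gamma>, OF el_NAT[THEN ty_el] nat C] by blast
  have 1: "el \<Gamma> (CON CNatInd \<cdot> ?P)
      (?P \<cdot> ZERO \<rightarrow>\<^sub>t PI NAT (\<lambda>n. ?P \<cdot> n \<rightarrow>\<^sub>t ?P \<cdot> SUCC n) \<rightarrow>\<^sub>t PI NAT (\<lambda>n. ?P \<cdot> n))"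
    by (rule el_AP[OF el_CON[of \<Gamma> CNatInd i, simplified] P]) (assumption | rule form | erule leaf | erule lift)+
  have z': "el \<Gamma> z (?P \<cdot> ZERO)"
    by (rule el_cv[OF z cv_sym[OF cv_motive[OF nat]] ty_app[OF P]]) (assumption | rule form | erule leaf | erule lift)+
  have tys: "ty \<Gamma> (PI NAT (\<lambda>n. ?P \<cdot> n \<rightarrow>\<^sub>t ?P \<cdot> SUCC n))"
    by (insert P, (assumption | rule sim_PI sim_AP sim_CON ty_PI el_SUCC el_NAT[THEN ty_el] ty_app[of _ _ NAT] | erule leaf | erule lift)+)
  have s': "el \<Gamma> s (PI NAT (\<lambda>n. ?P \<cdot> n \<rightarrow>\<^sub>t ?P \<cdot> SUCC n))"
  proof (rule el_cv[OF s _ tys], rule cv_PI[OF cv_refl], rule cv_PI; rule cv_sym, rule cv_beta)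
    fix \<Delta> \<Delta>' a b w x y assume *: "\<Gamma> \<sqsubseteq> \<Delta>" "natural \<Delta> a"
    show n1: "sim w (C x) (C y)" if "over \<Delta> w" "sim w x y"
      using that * by (auto intro: nat over_sub_ctx)
    show "natural \<Delta> a" by fact
    assume **: "\<Delta> \<sqsubseteq> \<Delta>'" "natural \<Delta>' b"
    show "sim w (C x) (C y)" if "over \<Delta>' w" "sim w x y"
      using that * ** by (auto intro: nat over_sub_ctx sub_ctx_trans)
    show "natural \<Delta>' (SUCC a)"
      using natural_sub_ctx[OF **(1) *(2)] by (auto simp: natural_def intro!: sim_AP sim_CON)
  qed
  have 2: "el \<Gamma> (CON CNatInd \<cdot> ?P \<cdot> z)
      (PI NAT (\<lambda>n. ?P \<cdot> n \<rightarrow>\<^sub>t ?P \<cdot> SUCC n) \<rightarrow>\<^sub>t PI NAT (\<lambda>n. ?P \<cdot> n))"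
    by (rule el_app[OF 1 z']) (insert P, (assumption | rule sim_PI sim_AP sim_CON | erule leaf | erule lift)+)
  have 3: "el \<Gamma> (CON CNatInd \<cdot> ?P \<cdot> z \<cdot> s) (PI NAT (\<lambda>n. ?P \<cdot> n))"
    by (rule el_app[OF 2 s']) (insert P, (assumption | rule sim_PI sim_AP sim_CON | erule leaf | erule lift)+)
  have 4: "el \<Gamma> (CON CNatInd \<cdot> ?P \<cdot> z \<cdot> s \<cdot> n) (?P \<cdot> n)"
    by (rule el_AP[OF 3 n]) (insert P, (assumption | rule sim_PI sim_AP sim_CON | erule leaf | erule lift)+)
  show ?thesis by (rule el_cv[OF 4 cv_motive[OF nat n] C[OF sub_ctx_refl n]])
qed

lemma el_J:
  assumes A: "ty \<Gamma> A" and a: "el \<Gamma> a A"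
    and nat: "\<And>w x y p q. over \<Gamma> w \<Longrightarrow> sim w x y \<Longrightarrow> sim w p q \<Longrightarrow> sim w (C x p) (C y q)"
    and C: "\<And>\<Delta> x p. \<Gamma> \<sqsubseteq> \<Delta> \<Longrightarrow> el \<Delta> x A \<Longrightarrow> el \<Delta> p (ID A a x) \<Longrightarrow> ty \<Delta> (C x p)"
    and c: "el \<Gamma> c (C a (REFL A a))"
    and x: "el \<Gamma> x A" and p: "el \<Gamma> p (ID A a x)"
  shows "el \<Gamma> (CON CJ \<cdot> A \<cdot> a \<cdot> LAM (\<lambda>x. LAM (C x)) \<cdot> c \<cdot> x \<cdot> p) (C x p)"
proof -
  let ?P = "LAM (\<lambda>x. LAM (C x))"
  let ?x = "var \<Gamma>" and ?\<Gamma>1 = "A (length \<Gamma>) # \<Gamma>"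
  have x1: "el ?\<Gamma>1 ?x A" by (rule el_var[OF natural_ty[OF A]])
  have A1: "ty ?\<Gamma>1 A" and a1: "el ?\<Gamma>1 a A" by (rule ty_sub_ctx el_sub_ctx, rule sub_ctx_Cons, fact)+
  have I1: "ty ?\<Gamma>1 (ID A a ?x)" by (rule ty_ID) fact+
  have natC: "sim w (C ?x p) (C ?x q)" if "over ?\<Gamma>1 w" "sim w p q" for w p q
    by (rule nat[OF over_sub_ctx[OF sub_ctx_Cons that(1)] sim_el[OF that(1) x1] that(2)])
  have formC: "ty \<Delta> (C ?x p)" if "?\<Gamma>1 \<sqsubseteq> \<Delta>" "el \<Delta> p (ID A a ?x)" for \<Delta> p
    by (rule C[OF sub_ctx_trans[OF sub_ctx_Cons that(1)] el_sub_ctx[OF that(1) x1] that(2)])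
  obtain jA j where jA: "\<forall>i\<ge>jA. el \<Gamma> A (UNI i)" and
      j: "\<forall>i\<ge>j. el ?\<Gamma>1 (LAM (C ?x)) (ID A a ?x \<rightarrow>\<^sub>t UNI i)"
    using ty_levels[OF A] motive_levels[where C = "C ?x", OF I1 natC formC] by blast
  define i where "i = max jA j"
  have A': "el \<Gamma> A (UNI i)" using jA by (simp add: i_def)
  have P: "el \<Gamma> ?P (PI A (\<lambda>x. ID A a x \<rightarrow>\<^sub>t UNI i))"
  proof (rule el_LAM_var[OF A])
    show "el ?\<Gamma>1 (LAM (C ?x)) (ID A a ?x \<rightarrow>\<^sub>t UNI i)" using j by (simp add: i_def)
  qed (insert A a, (assumption | rule nat sim_LAM sim_PI sim_AP sim_CON sim_UNI | erule leaf | erule lift)+)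
  have cvP: "cv \<Delta> (?P \<cdot> x \<cdot> p) (C x p)" if "\<Gamma> \<sqsubseteq> \<Delta>" "natural \<Delta> x" "natural \<Delta> p" for \<Delta> x p
  proof -
    have n: "sim w (C y q) (C z r)" if "over \<Delta> w" "sim w y z" "sim w q r" for w y z q r
      by (rule nat[OF over_sub_ctx[OF \<open>\<Gamma> \<sqsubseteq> \<Delta>\<close> that(1)] that(2,3)])
    have "cv \<Delta> (?P \<cdot> x) (LAM (C x))"
      by (rule cv_beta) (use that(2) in \<open>auto intro!: sim_LAM n intro: over_wle sim_wle\<close>)
    moreover have "cv \<Delta> (LAM (C x) \<cdot> p) (C x p)"
      by (rule cv_beta) (use that in \<open>auto intro!: n intro: sim_natural\<close>)
    ultimately show ?thesis by (blast intro: cv_trans cv_AP cv_refl)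
  qed
  have 1: "el \<Gamma> (CON CJ \<cdot> A) (PI A (\<lambda>a. PI (PI A (\<lambda>x. ID A a x \<rightarrow>\<^sub>t UNI i)) (\<lambda>P.
       P \<cdot> a \<cdot> REFL A a \<rightarrow>\<^sub>t PI A (\<lambda>x. PI (ID A a x) (\<lambda>p. P \<cdot> x \<cdot> p)))))"
    by (rule el_AP[OF el_CON[of \<Gamma> CJ i, simplified] A']) (assumption | rule form | erule leaf | erule lift)+
  have 2: "el \<Gamma> (CON CJ \<cdot> A \<cdot> a) (PI (PI A (\<lambda>x. ID A a x \<rightarrow>\<^sub>t UNI i)) (\<lambda>P.
       P \<cdot> a \<cdot> REFL A a \<rightarrow>\<^sub>t PI A (\<lambda>x. PI (ID A a x) (\<lambda>p. P \<cdot> x \<cdot> p))))"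
    by (rule el_AP[OF 1 a]) (insert A, (assumption | rule form | erule leaf | erule lift)+)
  have 3: "el \<Gamma> (CON CJ \<cdot> A \<cdot> a \<cdot> ?P)
       (?P \<cdot> a \<cdot> REFL A a \<rightarrow>\<^sub>t PI A (\<lambda>x. PI (ID A a x) (\<lambda>p. ?P \<cdot> x \<cdot> p)))"
    by (rule el_AP[OF 2 P]) (insert A a, (assumption | rule form | erule leaf | erule lift)+)
  have tyP: "ty \<Gamma> (?P \<cdot> x \<cdot> p)" if "el \<Gamma> x A" "el \<Gamma> p (ID A a x)" for x p
    by (rule ty_app[OF el_AP[OF P that(1)] that(2)]) (insert A a, (assumption | rule form | erule leaf | erule lift)+)
  have ra: "el \<Gamma> (REFL A a) (ID A a a)" by (rule el_REFL) fact+
  have c': "el \<Gamma> c (?P \<cdot> a \<cdot> REFL A a)"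
    by (rule el_cv[OF c cv_sym[OF cvP[OF sub_ctx_refl natural_el[OF a] natural_el[OF ra]]] tyP[OF a ra]])
  have 4: "el \<Gamma> (CON CJ \<cdot> A \<cdot> a \<cdot> ?P \<cdot> c) (PI A (\<lambda>x. PI (ID A a x) (\<lambda>p. ?P \<cdot> x \<cdot> p)))"
    by (rule el_app[OF 3 c']) (insert A a P, (assumption | rule sim_PI sim_AP sim_CON | erule leaf | erule lift)+)
  have 5: "el \<Gamma> (CON CJ \<cdot> A \<cdot> a \<cdot> ?P \<cdot> c \<cdot> x) (PI (ID A a x) (\<lambda>p. ?P \<cdot> x \<cdot> p))"
    by (rule el_AP[OF 4 x]) (insert A a P, (assumption | rule sim_PI sim_AP sim_CON | erule leaf | erule lift)+)
  have 6: "el \<Gamma> (CON CJ \<cdot> A \<cdot> a \<cdot> ?P \<cdot> c \<cdot> x \<cdot> p) (?P \<cdot> x \<cdot> p)"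
    by (rule el_AP[OF 5 p]) (insert x P, (assumption | rule sim_PI sim_AP sim_CON | erule leaf | erule lift)+)
  show ?thesis
    by (rule el_cv[OF 6 cvP[OF sub_ctx_refl natural_el[OF x] natural_el[OF p]] C[OF sub_ctx_refl x p]])
qed

lemma el_SigInd:
  assumes A: "ty \<Gamma> A"
    and natB: "\<And>w x y. over \<Gamma> w \<Longrightarrow> sim w x y \<Longrightarrow> sim w (B x) (B y)"
    and B: "\<And>\<Delta> x. \<Gamma> \<sqsubseteq> \<Delta> \<Longrightarrow> el \<Delta> x A \<Longrightarrow> ty \<Delta> (B x)"
    and nat: "\<And>w x y. over \<Gamma> w \<Longrightarrow> sim w x y \<Longrightarrow> sim w (C x) (C y)"
    and C: "\<And>\<Delta> x. \<Gamma> \<sqsubseteq> \<Delta> \<Longrightarrow> el \<Delta> x (SIG A B) \<Longrightarrow> ty \<Delta> (C x)"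
    and f: "el \<Gamma> f (PI A (\<lambda>a. PI (B a) (\<lambda>b. C (PAIR a b))))"
    and z: "el \<Gamma> z (SIG A B)"
  shows "el \<Gamma> (CON CSigInd \<cdot> A \<cdot> LAM B \<cdot> LAM C \<cdot> f \<cdot> z) (C z)"
proof -
  let ?B = "LAM B" and ?P = "LAM C"
  let ?S = "SIG A (\<lambda>a. ?B \<cdot> a)"
  have cvB: "cv \<Delta> (?B \<cdot> a) (B a)" if "\<Gamma> \<sqsubseteq> \<Delta>" "natural \<Delta> a" for \<Delta> a
    by (rule cv_beta) (use that in \<open>auto intro: natB over_sub_ctx\<close>)
  have cvC: "cv \<Delta> (?P \<cdot> a) (C a)" if "\<Gamma> \<sqsubseteq> \<Delta>" "natural \<Delta> a" for \<Delta> a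
    by (rule cv_beta) (use that in \<open>auto intro: nat over_sub_ctx\<close>)
  have cvS: "cv \<Delta> ?S (SIG A B)" if "\<Gamma> \<sqsubseteq> \<Delta>" for \<Delta>
    by (rule cv_SIG[OF cv_refl cvB]) (use that in \<open>auto intro: sub_ctx_trans\<close>)
  have tyS: "ty \<Gamma> (SIG A B)" by (rule ty_SIG) (fact | erule natB B, assumption)+
  obtain jA jB where jA: "\<forall>i\<ge>jA. el \<Gamma> A (UNI i)" and jB: "\<forall>i\<ge>jB. el \<Gamma> ?B (A \<rightarrow>\<^sub>t UNI i)"
    using ty_levels[OF A] motive_levels[where C = B and \<Gamma> = \<Gamma>, OF A natB B] by blast
  have B': "el \<Gamma> ?B (A \<rightarrow>\<^sub>t UNI jB)" using jB by blast
  have tyS': "ty \<Gamma> ?S"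
    by (insert A B', (assumption | rule sim_AP ty_SIG ty_app[of _ _ A] | erule leaf | erule lift)+)
  have C': "ty \<Delta> (C x)" if "\<Gamma> \<sqsubseteq> \<Delta>" "el \<Delta> x ?S" for \<Delta> x
    by (rule C[OF that(1) el_cv[OF that(2) cvS[OF that(1)] ty_sub_ctx[OF that(1) tyS]]])
  obtain jC where jC: "\<forall>i\<ge>jC. el \<Gamma> ?P (?S \<rightarrow>\<^sub>t UNI i)"
    using motive_levels[where C = C and \<Gamma> = \<Gamma>, OF tyS' nat C'] by blast
  define i where "i = max jA (max jB jC)"
  have A': "el \<Gamma> A (UNI i)" and B': "el \<Gamma> ?B (A \<rightarrow>\<^sub>t UNI i)" and P: "el \<Gamma> ?P (?S \<rightarrow>\<^sub>t UNI i)"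
    using jA jB jC by (auto simp: i_def)
  have 1: "el \<Gamma> (CON CSigInd \<cdot> A) (PI (A \<rightarrow>\<^sub>t UNI i) (\<lambda>B. PI (SIG A (\<lambda>a. B \<cdot> a) \<rightarrow>\<^sub>t UNI i) (\<lambda>P.
       PI A (\<lambda>a. PI (B \<cdot> a) (\<lambda>b. P \<cdot> PAIR a b)) \<rightarrow>\<^sub>t PI (SIG A (\<lambda>a. B \<cdot> a)) (\<lambda>z. P \<cdot> z))))"
    by (rule el_AP[OF el_CON[of \<Gamma> CSigInd i, simplified] A']) (assumption | rule form | erule leaf | erule lift)+
  have 2: "el \<Gamma> (CON CSigInd \<cdot> A \<cdot> ?B) (PI (?S \<rightarrow>\<^sub>t UNI i) (\<lambda>P.
       PI A (\<lambda>a. PI (?B \<cdot> a) (\<lambda>b. P \<cdot> PAIR a b)) \<rightarrow>\<^sub>t PI ?S (\<lambda>z. P \<cdot> z)))"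
    by (rule el_AP[OF 1 B']) (insert A, (assumption | rule form | erule leaf | erule lift)+)
  have 3: "el \<Gamma> (CON CSigInd \<cdot> A \<cdot> ?B \<cdot> ?P)
       (PI A (\<lambda>a. PI (?B \<cdot> a) (\<lambda>b. ?P \<cdot> PAIR a b)) \<rightarrow>\<^sub>t PI ?S (\<lambda>z. ?P \<cdot> z))"
    by (rule el_AP[OF 2 P])
      (insert A B', (assumption | rule sim_PI sim_SIG sim_AP sim_PAIR | erule leaf | erule lift)+)
  have tyf: "ty \<Gamma> (PI A (\<lambda>a. PI (?B \<cdot> a) (\<lambda>b. ?P \<cdot> PAIR a b)))"
    by (insert A B' P tyS', (assumption | rule sim_PI sim_AP sim_PAIR ty_PI ty_app[of _ _ ?S]
      ty_app[of _ _ A] el_PAIR | erule leaf | erule lift)+)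
  have f': "el \<Gamma> f (PI A (\<lambda>a. PI (?B \<cdot> a) (\<lambda>b. ?P \<cdot> PAIR a b)))"
  proof (rule el_cv[OF f _ tyf], rule cv_PI[OF cv_refl], rule cv_PI; rule cv_sym)
    fix \<Delta> a assume *: "\<Gamma> \<sqsubseteq> \<Delta>" "natural \<Delta> a"
    show "cv \<Delta> (?B \<cdot> a) (B a)" by (rule cvB) fact+
    fix \<Delta>' b assume **: "\<Delta> \<sqsubseteq> \<Delta>'" "natural \<Delta>' b"
    show "cv \<Delta>' (?P \<cdot> PAIR a b) (C (PAIR a b))"
      using natural_sub_ctx[OF **(1) *(2)] **(2)
      by (intro cvC sub_ctx_trans[OF *(1) **(1)]) (auto simp: natural_def intro!: sim_PAIR)
  qed
  have 4: "el \<Gamma> (CON CSigInd \<cdot> A \<cdot> ?B \<cdot> ?P \<cdot> f) (PI ?S (\<lambda>z. ?P \<cdot> z))"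
    by (rule el_app[OF 3 f']) (insert A B' P, (assumption | rule sim_PI sim_SIG sim_AP | erule leaf | erule lift)+)
  have z': "el \<Gamma> z ?S" by (rule el_cv[OF z cv_sym[OF cvS[OF sub_ctx_refl]] tyS'])
  have 5: "el \<Gamma> (CON CSigInd \<cdot> A \<cdot> ?B \<cdot> ?P \<cdot> f \<cdot> z) (?P \<cdot> z)"
    by (rule el_AP[OF 4 z']) (insert P, (assumption | rule sim_AP | erule leaf | erule lift)+)
  show ?thesis by (rule el_cv[OF 5 cv_motive[OF nat z] C[OF sub_ctx_refl z]])
qed

lemma el_TrInd:
  assumes A: "ty \<Gamma> A" and Q: "ty \<Gamma> Q"
    and h: "el \<Gamma> h (PI Q (\<lambda>x. PI Q (\<lambda>y. ID Q x y)))" and f: "el \<Gamma> f (A \<rightarrow>\<^sub>t Q)"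
    and z: "el \<Gamma> z (TRUNC A)"
  shows "el \<Gamma> (CON CTrInd \<cdot> A \<cdot> LAM (\<lambda>_. Q) \<cdot> LAM (\<lambda>_. h) \<cdot> f \<cdot> z) Q"
proof -
  let ?P = "LAM (\<lambda>_. Q)"
  have natQ: "sim w Q Q" if "over \<Gamma> w" for w using sim_ty[OF that Q] .
  obtain jA jP where j: "\<forall>i\<ge>jA. el \<Gamma> A (UNI i)" "\<forall>i\<ge>jP. el \<Gamma> ?P (TRUNC A \<rightarrow>\<^sub>t UNI i)"
    using ty_levels[OF A] motive_levels[where C = "\<lambda>_. Q" and \<Gamma> = \<Gamma>, OF ty_TRUNC[OF A] natQ ty_sub_ctx[OF _ Q]]
    by blast
  define i where "i = max jA jP"
  have A': "el \<Gamma> A (UNI i)" and P: "el \<Gamma> ?P (TRUNC A \<rightarrow>\<^sub>t UNI i)"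
    using j by (auto simp: i_def)
  have cvQ: "cv \<Delta> (?P \<cdot> a) Q" if "\<Gamma> \<sqsubseteq> \<Delta>" "natural \<Delta> a" for \<Delta> a
    by (rule cv_beta) (use that in \<open>auto intro: natQ over_sub_ctx\<close>)
  have 1: "el \<Gamma> (CON CTrInd \<cdot> A) (PI (TRUNC A \<rightarrow>\<^sub>t UNI i) (\<lambda>P.
       PI (TRUNC A) (\<lambda>z. is_prop (P \<cdot> z)) \<rightarrow>\<^sub>t PI A (\<lambda>a. P \<cdot> TRIN A a)
         \<rightarrow>\<^sub>t PI (TRUNC A) (\<lambda>z. P \<cdot> z)))"
    unfolding is_prop_def
    by (rule el_AP[OF el_CON[of \<Gamma> CTrInd i, simplified, unfolded is_prop_def] A'])
      (assumption | rule form | erule leaf | erule lift)+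
  have 2: "el \<Gamma> (CON CTrInd \<cdot> A \<cdot> ?P)
       (PI (TRUNC A) (\<lambda>z. is_prop (?P \<cdot> z)) \<rightarrow>\<^sub>t PI A (\<lambda>a. ?P \<cdot> TRIN A a)
         \<rightarrow>\<^sub>t PI (TRUNC A) (\<lambda>z. ?P \<cdot> z))"
    unfolding is_prop_def
    by (rule el_AP[OF 1[unfolded is_prop_def] P])
      (insert A, (assumption | rule form | erule leaf | erule lift)+)
  have tyh: "ty \<Gamma> (PI (TRUNC A) (\<lambda>z. is_prop (?P \<cdot> z)))"
    unfolding is_prop_def
    by (insert A P, (assumption | rule sim_PI sim_AP sim_CON ty_PI ty_ID ty_TRUNC ty_app[of _ _ "TRUNC A"]
      | erule leaf | erule lift)+)
  have h1: "el \<Gamma> (LAM (\<lambda>_. h)) (TRUNC A \<rightarrow>\<^sub>t PI Q (\<lambda>x. PI Q (\<lambda>y. ID Q x y)))"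
    by (rule el_LAM) (insert A Q h, (assumption | rule form | erule leaf | erule lift)+)
  have h': "el \<Gamma> (LAM (\<lambda>_. h)) (PI (TRUNC A) (\<lambda>z. is_prop (?P \<cdot> z)))"
  proof (rule el_cv[OF h1 _ tyh], unfold is_prop_def, rule cv_PI[OF cv_refl])
    fix \<Delta> z assume *: "\<Gamma> \<sqsubseteq> \<Delta>" "natural \<Delta> z"
    have c: "cv \<Theta> Q (?P \<cdot> z)" if "\<Delta> \<sqsubseteq> \<Theta>" for \<Theta>
      by (rule cv_sym[OF cvQ[OF sub_ctx_trans[OF *(1) that] natural_sub_ctx[OF that *(2)]]])
    show "cv \<Delta> (PI Q (\<lambda>x. PI Q (\<lambda>y. ID Q x y))) (PI (?P \<cdot> z) (\<lambda>x. PI (?P \<cdot> z) (\<lambda>y. ID (?P \<cdot> z) x y)))"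
      by (intro cv_PI cv_AP cv_refl c) (auto intro: sub_ctx_refl sub_ctx_trans)
  qed
  have tyf: "ty \<Gamma> (PI A (\<lambda>a. ?P \<cdot> TRIN A a))"
    by (insert A P, (assumption | rule sim_PI sim_AP sim_CON ty_PI ty_app[of _ _ "TRUNC A"] el_TRIN
      | erule leaf | erule lift)+)
  have f': "el \<Gamma> f (PI A (\<lambda>a. ?P \<cdot> TRIN A a))"
  proof (rule el_cv[OF f _ tyf], rule cv_PI[OF cv_refl], rule cv_sym, rule cvQ)
    fix \<Delta> a assume *: "\<Gamma> \<sqsubseteq> \<Delta>" "natural \<Delta> a"
    then show "natural \<Delta> (TRIN A a)" using natural_sub_ctx[OF *(1) natural_ty[OF A]]
      by (auto simp: natural_def intro!: sim_AP sim_CON)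
  qed
  have 3: "el \<Gamma> (CON CTrInd \<cdot> A \<cdot> ?P \<cdot> LAM (\<lambda>_. h))
       (PI A (\<lambda>a. ?P \<cdot> TRIN A a) \<rightarrow>\<^sub>t PI (TRUNC A) (\<lambda>z. ?P \<cdot> z))"
    by (rule el_app[OF 2 h']) (insert A P, (assumption | rule sim_PI sim_AP sim_CON | erule leaf | erule lift)+)
  have 4: "el \<Gamma> (CON CTrInd \<cdot> A \<cdot> ?P \<cdot> LAM (\<lambda>_. h) \<cdot> f) (PI (TRUNC A) (\<lambda>z. ?P \<cdot> z))"
    by (rule el_app[OF 3 f']) (insert A P, (assumption | rule sim_PI sim_AP sim_CON | erule leaf | erule lift)+)
  have 5: "el \<Gamma> (CON CTrInd \<cdot> A \<cdot> ?P \<cdot> LAM (\<lambda>_. h) \<cdot> f \<cdot> z) (?P \<cdot> z)"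
    by (rule el_AP[OF 4 z]) (insert P, (assumption | rule sim_AP | erule leaf | erule lift)+)
  show ?thesis by (rule el_cv[OF 5 cvQ[OF sub_ctx_refl natural_el[OF z]] Q])
qed

lemma inh_funext:
  assumes A: "ty \<Gamma> A" and B: "ty \<Gamma> B" and f: "el \<Gamma> f (A \<rightarrow>\<^sub>t B)" and g: "el \<Gamma> g (A \<rightarrow>\<^sub>t B)"
    and h: "inh \<Gamma> (PI A (\<lambda>x. ID B (f \<cdot> x) (g \<cdot> x)))"
  shows "inh \<Gamma> (ID (A \<rightarrow>\<^sub>t B) f g)"
proof -
  let ?P = "LAM (\<lambda>_. B)"
  let ?F = "PI A (\<lambda>x. ?P \<cdot> x)"
  obtain h where h: "el \<Gamma> h (PI A (\<lambda>x. ID B (f \<cdot> x) (g \<cdot> x)))" using h by (auto simp: inh_def)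
  have natB: "sim w B B" if "over \<Gamma> w" for w using sim_ty[OF that B] .
  obtain jA jP where j: "\<forall>i\<ge>jA. el \<Gamma> A (UNI i)" "\<forall>i\<ge>jP. el \<Gamma> ?P (A \<rightarrow>\<^sub>t UNI i)"
    using ty_levels[OF A] motive_levels[where C = "\<lambda>_. B" and \<Gamma> = \<Gamma>, OF A natB ty_sub_ctx[OF _ B]]
    by blast
  define i where "i = max jA jP"
  have A': "el \<Gamma> A (UNI i)" and P: "el \<Gamma> ?P (A \<rightarrow>\<^sub>t UNI i)"
    using j by (auto simp: i_def)
  have cvB: "cv \<Delta> (?P \<cdot> a) B" if "\<Gamma> \<sqsubseteq> \<Delta>" "natural \<Delta> a" for \<Delta> a
    by (rule cv_beta) (use that in \<open>auto intro: natB over_sub_ctx\<close>)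
  have tyF: "ty \<Gamma> ?F"
    by (insert A P, (assumption | rule sim_AP ty_PI ty_app[of _ _ A] | erule leaf | erule lift)+)
  have cvF: "cv \<Gamma> ?F (A \<rightarrow>\<^sub>t B)" by (rule cv_PI[OF cv_refl cvB])
  have f': "el \<Gamma> f ?F" by (rule el_cv[OF f cv_sym[OF cvF] tyF])
  have g': "el \<Gamma> g ?F" by (rule el_cv[OF g cv_sym[OF cvF] tyF])
  have 1: "el \<Gamma> (CON CFunExt \<cdot> A) (PI (A \<rightarrow>\<^sub>t UNI i) (\<lambda>B.
       PI (PI A (\<lambda>x. B \<cdot> x)) (\<lambda>f. PI (PI A (\<lambda>x. B \<cdot> x)) (\<lambda>g.
         PI A (\<lambda>x. ID (B \<cdot> x) (f \<cdot> x) (g \<cdot> x)) \<rightarrow>\<^sub>t ID (PI A (\<lambda>x. B \<cdot> x)) f g))))"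
    by (rule el_AP[OF el_CON[of \<Gamma> CFunExt i, simplified] A']) (assumption | rule form | erule leaf | erule lift)+
  have 2: "el \<Gamma> (CON CFunExt \<cdot> A \<cdot> ?P) (PI ?F (\<lambda>f. PI ?F (\<lambda>g.
         PI A (\<lambda>x. ID (?P \<cdot> x) (f \<cdot> x) (g \<cdot> x)) \<rightarrow>\<^sub>t ID ?F f g)))"
    by (rule el_AP[OF 1 P]) (insert A, (assumption | rule form | erule leaf | erule lift)+)
  have 3: "el \<Gamma> (CON CFunExt \<cdot> A \<cdot> ?P \<cdot> f) (PI ?F (\<lambda>g.
         PI A (\<lambda>x. ID (?P \<cdot> x) (f \<cdot> x) (g \<cdot> x)) \<rightarrow>\<^sub>t ID ?F f g))"
    by (rule el_AP[OF 2 f']) (insert A P, (assumption | rule sim_PI sim_AP sim_CON | erule leaf | erule lift)+)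
  have 4: "el \<Gamma> (CON CFunExt \<cdot> A \<cdot> ?P \<cdot> f \<cdot> g)
         (PI A (\<lambda>x. ID (?P \<cdot> x) (f \<cdot> x) (g \<cdot> x)) \<rightarrow>\<^sub>t ID ?F f g)"
    by (rule el_AP[OF 3 g']) (insert A P f, (assumption | rule sim_PI sim_AP sim_CON | erule leaf | erule lift)+)
  have app: "el \<Delta> (k \<cdot> x) (?P \<cdot> x)" if "\<Gamma> \<sqsubseteq> \<Delta>" "el \<Delta> x A" "el \<Gamma> k ?F" for \<Delta> k x
    by (rule el_AP[OF el_sub_ctx[OF that(1,3)] that(2)])
      (insert P that, (assumption | rule sim_AP | erule leaf | erule lift)+)
  have tyh: "ty \<Gamma> (PI A (\<lambda>x. ID (?P \<cdot> x) (f \<cdot> x) (g \<cdot> x)))"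
    by (rule ty_PI) (insert A P f g f' g', (assumption | rule sim_AP sim_CON ty_ID app ty_app[of _ _ A] | erule leaf | erule lift)+)
  have h': "el \<Gamma> h (PI A (\<lambda>x. ID (?P \<cdot> x) (f \<cdot> x) (g \<cdot> x)))"
    by (rule el_cv[OF h _ tyh]) (intro cv_PI[OF cv_refl] cv_AP cv_refl cv_sym[OF cvB])
  have tyI: "ty \<Gamma> (ID ?F f g)" by (rule ty_ID) fact+
  have 5: "el \<Gamma> (CON CFunExt \<cdot> A \<cdot> ?P \<cdot> f \<cdot> g \<cdot> h) (ID ?F f g)"
    by (rule el_app[OF 4 h' sim_ty[OF _ tyI]])
  have tyAB: "ty \<Gamma> (A \<rightarrow>\<^sub>t B)"
    by (rule ty_PI) (insert A B, (assumption | erule leaf | erule lift)+)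
  have "el \<Gamma> (CON CFunExt \<cdot> A \<cdot> ?P \<cdot> f \<cdot> g \<cdot> h) (ID (A \<rightarrow>\<^sub>t B) f g)"
    by (rule el_cv[OF 5 _ ty_ID[OF tyAB f g]]) (intro cv_AP cv_refl cvF)
  then show ?thesis by (auto simp: inh_def)
qed

section \<open>Formation of the defined types\<close>

text \<open>
  To be a possible domain of a function, a type must be derivable as a type. So each type that occurs
  in the theorem needs two facts: it respects \<open>sim\<close>, and it is well-formed.
\<close>

lemma sim_is_contr [form]: "sim w A A' \<Longrightarrow> sim w (is_contr A) (is_contr A')"
  unfolding is_contr_def by (assumption | rule form app | erule leaf | erule lift)+

lemma ty_is_contr [form]: "ty \<Gamma> A \<Longrightarrow> ty \<Gamma> (is_contr A)"
  unfolding is_contr_def by (assumption | rule form app | erule leaf | erule lift)+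

lemma sim_is_prop [form]: "sim w A A' \<Longrightarrow> sim w (is_prop A) (is_prop A')"
  unfolding is_prop_def by (assumption | rule form app | erule leaf | erule lift)+

lemma ty_is_prop [form]: "ty \<Gamma> A \<Longrightarrow> ty \<Gamma> (is_prop A)"
  unfolding is_prop_def by (assumption | rule form app | erule leaf | erule lift)+

lemma sim_is_set [form]: "sim w A A' \<Longrightarrow> sim w (is_set A) (is_set A')"
  unfolding is_set_def by (assumption | rule form app | erule leaf | erule lift)+

lemma ty_is_set [form]: "ty \<Gamma> A \<Longrightarrow> ty \<Gamma> (is_set A)"
  unfolding is_set_def by (assumption | rule form app | erule leaf | erule lift)+

lemma sim_fiber [form]:
  "sim w A A' \<Longrightarrow> sim w B B' \<Longrightarrow> sim w f f' \<Longrightarrow> sim w y y' \<Longrightarrow> sim w (fiber A B f y) (fiber A' B' f' y')"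
  unfolding fiber_def by (assumption | rule form app | erule leaf | erule lift)+

lemma ty_fiber [form]:
  "ty \<Gamma> A \<Longrightarrow> ty \<Gamma> B \<Longrightarrow> el \<Gamma> f (A \<rightarrow>\<^sub>t B) \<Longrightarrow> el \<Gamma> y B \<Longrightarrow> ty \<Gamma> (fiber A B f y)"
  unfolding fiber_def by (assumption | rule form | rule app | erule leaf | erule lift)+

lemma sim_is_equiv [form]:
  "sim w A A' \<Longrightarrow> sim w B B' \<Longrightarrow> sim w f f' \<Longrightarrow> sim w (is_equiv A B f) (is_equiv A' B' f')"
  unfolding is_equiv_def by (assumption | rule form | rule app | erule leaf | erule lift)+

lemma ty_is_equiv [form]:
  "ty \<Gamma> A \<Longrightarrow> ty \<Gamma> B \<Longrightarrow> el \<Gamma> f (A \<rightarrow>\<^sub>t B) \<Longrightarrow> ty \<Gamma> (is_equiv A B f)"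
  unfolding is_equiv_def by (assumption | rule form | rule app | erule leaf | erule lift)+

lemma sim_fin [form]: "sim w n n' \<Longrightarrow> sim w (fin n) (fin n')"
  unfolding fin_def by (assumption | rule form | rule app | erule leaf | erule lift)+

lemma el_fin: "el \<Gamma> n NAT \<Longrightarrow> el \<Gamma> (fin n) (UNI 0)"
  unfolding fin_def
  by (rule el_NatInd) (assumption | rule form el_LAM | rule app | erule leaf | erule lift)+

lemmas ty_fin [form] = el_fin[THEN ty_el]

text \<open>
  The formation of types rests on the typing of the ring operations alone, so this is what \<open>ring_ops\<close>
  and \<open>alg_ops\<close> record; the laws of a ring are a separate inhabited type.
\<close>

definition sim_ring :: "world \<Rightarrow> ring_data \<Rightarrow> ring_data \<Rightarrow> bool" where
  "sim_ring w K K' \<longleftrightarrow> sim w (car K) (car K') \<and> sim w (rzero K) (rzero K') \<and> sim w (rone K) (rone K')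
     \<and> sim w (radd K) (radd K') \<and> sim w (rneg K) (rneg K') \<and> sim w (rmul K) (rmul K')"

definition ring_ops :: "tm list \<Rightarrow> nat \<Rightarrow> ring_data \<Rightarrow> bool" where
  "ring_ops \<Gamma> l K \<longleftrightarrow> el \<Gamma> (car K) (UNI l) \<and> el \<Gamma> (rzero K) (car K) \<and> el \<Gamma> (rone K) (car K)
     \<and> el \<Gamma> (radd K) (car K \<rightarrow>\<^sub>t car K \<rightarrow>\<^sub>t car K) \<and> el \<Gamma> (rneg K) (car K \<rightarrow>\<^sub>t car K)
     \<and> el \<Gamma> (rmul K) (car K \<rightarrow>\<^sub>t car K \<rightarrow>\<^sub>t car K)"

definition sim_alg :: "world \<Rightarrow> alg_data \<Rightarrow> alg_data \<Rightarrow> bool" where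
  "sim_alg w A A' \<longleftrightarrow> sim_ring w (aring A) (aring A') \<and> sim w (amap A) (amap A')"

definition alg_ops :: "tm list \<Rightarrow> nat \<Rightarrow> ring_data \<Rightarrow> alg_data \<Rightarrow> bool" where
  "alg_ops \<Gamma> l R A \<longleftrightarrow> ring_ops \<Gamma> l (aring A) \<and> el \<Gamma> (amap A) (car R \<rightarrow>\<^sub>t acar A)"

lemma sim_ring_Ring [form]:
  "sim w c c' \<Longrightarrow> sim w z z' \<Longrightarrow> sim w u u' \<Longrightarrow> sim w a a' \<Longrightarrow> sim w n n' \<Longrightarrow> sim w m m'
    \<Longrightarrow> sim_ring w (Ring c z u a n m) (Ring c' z' u' a' n' m')"
  by (simp add: sim_ring_def)

lemma sim_ring_ops [form]:
  "sim_ring w K K' \<Longrightarrow> sim w (car K) (car K')" "sim_ring w K K' \<Longrightarrow> sim w (rzero K) (rzero K')"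
  "sim_ring w K K' \<Longrightarrow> sim w (rone K) (rone K')" "sim_ring w K K' \<Longrightarrow> sim w (radd K) (radd K')"
  "sim_ring w K K' \<Longrightarrow> sim w (rneg K) (rneg K')" "sim_ring w K K' \<Longrightarrow> sim w (rmul K) (rmul K')"
  by (simp_all add: sim_ring_def)

lemma sim_alg_Alg [form]: "sim_ring w K K' \<Longrightarrow> sim w h h' \<Longrightarrow> sim_alg w (Alg K h) (Alg K' h')"
  by (simp add: sim_alg_def)

lemma sim_alg_ops [form]:
  "sim_alg w A A' \<Longrightarrow> sim_ring w (aring A) (aring A')" "sim_alg w A A' \<Longrightarrow> sim w (amap A) (amap A')"
  by (simp_all add: sim_alg_def)

lemma sim_ring_wle [lift]: "wle w w' \<Longrightarrow> sim_ring w K K' \<Longrightarrow> sim_ring w' K K'"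
  by (auto simp: sim_ring_def intro: sim_wle)

lemma sim_alg_wle [lift]: "wle w w' \<Longrightarrow> sim_alg w K K' \<Longrightarrow> sim_alg w' K K'"
  by (auto simp: sim_alg_def intro: sim_wle sim_ring_wle)

lemma ring_ops_Ring [form]:
  "el \<Gamma> c (UNI l) \<Longrightarrow> el \<Gamma> z c \<Longrightarrow> el \<Gamma> u c \<Longrightarrow> el \<Gamma> a (c \<rightarrow>\<^sub>t c \<rightarrow>\<^sub>t c) \<Longrightarrow> el \<Gamma> n (c \<rightarrow>\<^sub>t c)
    \<Longrightarrow> el \<Gamma> m (c \<rightarrow>\<^sub>t c \<rightarrow>\<^sub>t c) \<Longrightarrow> ring_ops \<Gamma> l (Ring c z u a n m)"
  by (simp add: ring_ops_def)

lemma alg_ops_Alg [form]: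
  "ring_ops \<Gamma> l K \<Longrightarrow> el \<Gamma> h (car R \<rightarrow>\<^sub>t car K) \<Longrightarrow> alg_ops \<Gamma> l R (Alg K h)"
  by (simp add: alg_ops_def)

lemma ring_ops_sub_ctx [lift]: "\<Gamma> \<sqsubseteq> \<Delta> \<Longrightarrow> ring_ops \<Gamma> l K \<Longrightarrow> ring_ops \<Delta> l K"
  by (auto simp: ring_ops_def intro: el_sub_ctx)

lemma alg_ops_sub_ctx [lift]: "\<Gamma> \<sqsubseteq> \<Delta> \<Longrightarrow> alg_ops \<Gamma> l R A \<Longrightarrow> alg_ops \<Delta> l R A"
  by (auto simp: alg_ops_def intro: el_sub_ctx ring_ops_sub_ctx)

lemma sim_ring_leaf [leaf]: "over \<Gamma> w \<Longrightarrow> ring_ops \<Gamma> l K \<Longrightarrow> sim_ring w K K"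
  by (auto simp: ring_ops_def sim_ring_def intro: sim_el)

lemma sim_alg_leaf [leaf]: "over \<Gamma> w \<Longrightarrow> alg_ops \<Gamma> l R A \<Longrightarrow> sim_alg w A A"
  by (auto simp: alg_ops_def sim_alg_def intro: sim_el sim_ring_leaf)

lemma ring_ops_el [form]:
  "ring_ops \<Gamma> l K \<Longrightarrow> el \<Gamma> (rzero K) (car K)" "ring_ops \<Gamma> l K \<Longrightarrow> el \<Gamma> (rone K) (car K)"
  "ring_ops \<Gamma> l K \<Longrightarrow> ty \<Gamma> (car K)"
  by (auto simp: ring_ops_def intro: ty_el)

lemma el_plus [form]: "ring_ops \<Gamma> l K \<Longrightarrow> el \<Gamma> x (car K) \<Longrightarrow> el \<Gamma> y (car K) \<Longrightarrow> el \<Gamma> (plus_in K x y) (car K)"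
  unfolding ring_ops_def
  by (elim conjE) (assumption | rule sim_PI | rule app | erule leaf | erule lift)+

lemma el_times [form]: "ring_ops \<Gamma> l K \<Longrightarrow> el \<Gamma> x (car K) \<Longrightarrow> el \<Gamma> y (car K) \<Longrightarrow> el \<Gamma> (times_in K x y) (car K)"
  unfolding ring_ops_def
  by (elim conjE) (assumption | rule sim_PI | rule app | erule leaf | erule lift)+

lemma el_neg [form]: "ring_ops \<Gamma> l K \<Longrightarrow> el \<Gamma> x (car K) \<Longrightarrow> el \<Gamma> (rneg K \<cdot> x) (car K)"
  unfolding ring_ops_def
  by (elim conjE) (assumption | rule app | erule leaf | erule lift)+

lemma alg_ops_ring [form]: "alg_ops \<Gamma> l R A \<Longrightarrow> ring_ops \<Gamma> l (aring A)"
  by (simp add: alg_ops_def)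

lemma el_amap [form]: "alg_ops \<Gamma> l R A \<Longrightarrow> el \<Gamma> x (car R) \<Longrightarrow> el \<Gamma> (amap A \<cdot> x) (acar A)"
  by (rule el_app[OF _ _ sim_ty[OF _ ring_ops_el(3)[OF alg_ops_ring]]]) (auto simp: alg_ops_def)

lemma sim_is_comm_ring [form]: "sim_ring w K K' \<Longrightarrow> sim w (is_comm_ring K) (is_comm_ring K')"
  unfolding is_comm_ring_def by (assumption | rule form | rule app | erule leaf | erule lift)+

lemma ty_is_comm_ring [form]: "ring_ops \<Gamma> l K \<Longrightarrow> ty \<Gamma> (is_comm_ring K)"
  unfolding is_comm_ring_def by (assumption | rule form | rule app | erule leaf | erule lift)+

lemma sim_is_ring_hom [form]:
  "sim_ring w K K' \<Longrightarrow> sim_ring w L L' \<Longrightarrow> sim w f f' \<Longrightarrow> sim w (is_ring_hom K L f) (is_ring_hom K' L' f')"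
  unfolding is_ring_hom_def by (assumption | rule form | rule app | erule leaf | erule lift)+

lemma ty_is_ring_hom [form]:
  "ring_ops \<Gamma> k K \<Longrightarrow> ring_ops \<Gamma> l L \<Longrightarrow> el \<Gamma> f (car K \<rightarrow>\<^sub>t car L) \<Longrightarrow> ty \<Gamma> (is_ring_hom K L f)"
  unfolding is_ring_hom_def by (assumption | rule form | rule app | erule leaf | erule lift)+

text \<open>
  \<open>PI\<close> and \<open>SIG\<close> have the same formation rule, so quantification over rings and algebras is treated
  for both at once.
\<close>

definition quantifier :: "(ex \<Rightarrow> (ex \<Rightarrow> ex) \<Rightarrow> ex) \<Rightarrow> bool" where
  "quantifier Q \<longleftrightarrow> Q = PI \<or> Q = SIG"

lemma quantifier_PI [form]: "quantifier PI" and quantifier_SIG [form]: "quantifier SIG"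
  by (simp_all add: quantifier_def)

lemma sim_quantifier:
  assumes "quantifier Q" "sim w A A'" "\<And>w' x y. wle w w' \<Longrightarrow> sim w' x y \<Longrightarrow> sim w' (F x) (F' y)"
  shows "sim w (Q A F) (Q A' F')"
  using assms(1) sim_PI[OF assms(2,3)] sim_SIG[OF assms(2,3)] by (auto simp: quantifier_def)

lemma ty_quantifier:
  assumes Q: "quantifier Q" and A: "ty \<Gamma> A"
    and nat: "\<And>w x y. over \<Gamma> w \<Longrightarrow> sim w x y \<Longrightarrow> sim w (F x) (F y)"
    and F: "\<And>\<Delta> x. \<Gamma> \<sqsubseteq> \<Delta> \<Longrightarrow> el \<Delta> x A \<Longrightarrow> ty \<Delta> (F x)"
  shows "ty \<Gamma> (Q A F)"
  using Q ty_PI[of \<Gamma> A F, OF A nat F] ty_SIG[of \<Gamma> A F, OF A nat F] by (auto simp: quantifier_def)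

lemma sim_over_rings [form]:
  assumes Q: "quantifier Q"
    and F: "\<And>w' K K'. wle w w' \<Longrightarrow> sim_ring w' K K' \<Longrightarrow> sim w' (F K) (F' K')"
  shows "sim w (over_rings Q l F) (over_rings Q l F')"
  unfolding over_rings_def
  by (assumption | rule F sim_quantifier[OF Q] | rule form | erule leaf | erule lift)+

lemma ty_over_rings [form]:
  assumes Q: "quantifier Q"
    and nat: "\<And>w K K'. over \<Gamma> w \<Longrightarrow> sim_ring w K K' \<Longrightarrow> sim w (F K) (F K')"
    and F: "\<And>\<Delta> K. \<Gamma> \<sqsubseteq> \<Delta> \<Longrightarrow> ring_ops \<Delta> l K \<Longrightarrow> ty \<Delta> (F K)"
  shows "ty \<Gamma> (over_rings Q l F)"
  unfolding over_rings_def
  by (assumption | rule F nat sim_quantifier[OF Q] ty_quantifier[OF Q] | rule form | erule leaf | erule lift)+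

lemma sim_over_algs [form]:
  assumes Q: "quantifier Q" and R: "sim_ring w R R'"
    and F: "\<And>w' A A'. wle w w' \<Longrightarrow> sim_alg w' A A' \<Longrightarrow> sim w' (F A) (F' A')"
  shows "sim w (over_algs Q l R F) (over_algs Q l R' F')"
  unfolding over_algs_def
  by (insert R, (assumption | rule Q F sim_quantifier[OF Q] | rule form | erule leaf | erule lift)+)

lemma ty_over_algs [form]:
  assumes Q: "quantifier Q" and R: "ring_ops \<Gamma> k R"
    and nat: "\<And>w A A'. over \<Gamma> w \<Longrightarrow> sim_alg w A A' \<Longrightarrow> sim w (F A) (F A')"
    and F: "\<And>\<Delta> A. \<Gamma> \<sqsubseteq> \<Delta> \<Longrightarrow> alg_ops \<Delta> l R A \<Longrightarrow> ty \<Delta> (F A)"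
  shows "ty \<Gamma> (over_algs Q l R F)"
  unfolding over_algs_def
  by (insert R, (assumption | rule Q F nat sim_quantifier[OF Q] ty_quantifier[OF Q] | rule form | erule leaf | erule lift)+)

lemma sim_base_alg [form]: "sim_ring w R R' \<Longrightarrow> sim_alg w (base_alg R) (base_alg R')"
  unfolding base_alg_def by (assumption | rule form | erule leaf | erule lift)+

lemma alg_ops_base_alg [form]: "ring_ops \<Gamma> l R \<Longrightarrow> alg_ops \<Gamma> l R (base_alg R)"
  unfolding base_alg_def by (assumption | rule form el_LAM | erule leaf | erule lift)+

lemma sim_alg_hom [form]:
  "sim_ring w R R' \<Longrightarrow> sim_alg w A A' \<Longrightarrow> sim_alg w B B' \<Longrightarrow> sim w (alg_hom R A B) (alg_hom R' A' B')"
  unfolding alg_hom_def by (assumption | rule form | erule leaf | erule lift)+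

lemma ty_alg_hom [form]:
  "ring_ops \<Gamma> k R \<Longrightarrow> alg_ops \<Gamma> l R A \<Longrightarrow> alg_ops \<Gamma> m R B \<Longrightarrow> ty \<Gamma> (alg_hom R A B)"
  unfolding alg_hom_def by (assumption | rule form | rule app | erule leaf | erule lift)+

lemma el_alg_hom_FST [form]:
  assumes "el \<Gamma> h (alg_hom R A B)" "alg_ops \<Gamma> l R A" "alg_ops \<Gamma> m R B"
  shows "el \<Gamma> (FST h) (acar A \<rightarrow>\<^sub>t acar B)"
  by (rule el_FST[OF assms(1)[unfolded alg_hom_def]])
    (insert assms(2,3), (assumption | rule form | rule app | erule leaf | erule lift)+)

lemma sim_alg_equiv [form]:
  "sim_ring w R R' \<Longrightarrow> sim_alg w A A' \<Longrightarrow> sim_alg w B B' \<Longrightarrow> sim w (alg_equiv R A B) (alg_equiv R' A' B')"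
  unfolding alg_equiv_def by (assumption | rule form | erule leaf | erule lift)+

lemma ty_alg_equiv [form]:
  "ring_ops \<Gamma> k R \<Longrightarrow> alg_ops \<Gamma> l R A \<Longrightarrow> alg_ops \<Gamma> m R B \<Longrightarrow> ty \<Gamma> (alg_equiv R A B)"
  unfolding alg_equiv_def by (assumption | rule form | rule app | erule leaf | erule lift)+

lemma sim_Spec [form]:
  "sim_ring w R R' \<Longrightarrow> sim_alg w A A' \<Longrightarrow> sim w (Spec R A) (Spec R' A')"
  unfolding Spec_def by (assumption | rule form | erule leaf | erule lift)+

lemma ty_Spec [form]:
  "ring_ops \<Gamma> l R \<Longrightarrow> alg_ops \<Gamma> m R A \<Longrightarrow> ty \<Gamma> (Spec R A)"
  unfolding Spec_def by (assumption | rule form | rule app | erule leaf | erule lift)+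

lemma el_Spec_FST [form]:
  assumes "el \<Gamma> h (Spec R A)" "ring_ops \<Gamma> l R" "alg_ops \<Gamma> m R A"
  shows "el \<Gamma> (FST h) (acar A \<rightarrow>\<^sub>t car R)"
  using el_alg_hom_FST[OF assms(1)[unfolded Spec_def] assms(3) alg_ops_base_alg[OF assms(2)]]
  by (simp add: base_alg_def)

lemma sim_has_inv [form]: "sim_ring w R R' \<Longrightarrow> sim w x x' \<Longrightarrow> sim w (has_inv R x) (has_inv R' x')"
  unfolding has_inv_def by (assumption | rule form | erule leaf | erule lift)+

lemma ty_has_inv [form]: "ring_ops \<Gamma> l R \<Longrightarrow> el \<Gamma> x (car R) \<Longrightarrow> ty \<Gamma> (has_inv R x)"
  unfolding has_inv_def by (assumption | rule form | rule app | erule leaf | erule lift)+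

lemma sim_is_poly_alg [form]:
  "sim_ring w R R' \<Longrightarrow> sim w n n' \<Longrightarrow> sim_alg w P P' \<Longrightarrow> sim w X X'
    \<Longrightarrow> sim w (is_poly_alg l R n P X) (is_poly_alg l R' n' P' X')"
  unfolding is_poly_alg_def by (assumption | rule form | erule leaf | erule lift)+

lemma ty_is_poly_alg [form]:
  "ring_ops \<Gamma> l R \<Longrightarrow> el \<Gamma> n NAT \<Longrightarrow> alg_ops \<Gamma> l R P \<Longrightarrow> el \<Gamma> X (fin n \<rightarrow>\<^sub>t acar P)
    \<Longrightarrow> ty \<Gamma> (is_poly_alg l R n P X)"
  unfolding is_poly_alg_def by (assumption | rule form | rule app | erule leaf | erule lift)+

lemma sim_is_quotient_alg [form]:
  "sim_ring w R R' \<Longrightarrow> sim_alg w P P' \<Longrightarrow> sim w m m' \<Longrightarrow> sim w f f' \<Longrightarrow> sim_alg w Q Q' \<Longrightarrow> sim w q q'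
    \<Longrightarrow> sim w (is_quotient_alg l R P m f Q q) (is_quotient_alg l R' P' m' f' Q' q')"
  unfolding is_quotient_alg_def by (assumption | rule form | erule leaf | erule lift)+

lemma ty_is_quotient_alg [form]:
  "ring_ops \<Gamma> l R \<Longrightarrow> alg_ops \<Gamma> l R P \<Longrightarrow> el \<Gamma> m NAT \<Longrightarrow> el \<Gamma> f (fin m \<rightarrow>\<^sub>t acar P)
    \<Longrightarrow> alg_ops \<Gamma> l R Q \<Longrightarrow> el \<Gamma> q (alg_hom R P Q) \<Longrightarrow> ty \<Gamma> (is_quotient_alg l R P m f Q q)"
  unfolding is_quotient_alg_def by (assumption | rule form | rule app | erule leaf | erule lift)+

lemma sim_is_localization [form]:
  "sim_ring w R R' \<Longrightarrow> sim w r r' \<Longrightarrow> sim_alg w L L' \<Longrightarrow> sim w (is_localization l R r L) (is_localization l R' r' L')"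
  unfolding is_localization_def by (assumption | rule form | erule leaf | erule lift)+

lemma ty_is_localization [form]:
  "ring_ops \<Gamma> l R \<Longrightarrow> el \<Gamma> r (car R) \<Longrightarrow> alg_ops \<Gamma> l R L \<Longrightarrow> ty \<Gamma> (is_localization l R r L)"
  unfolding is_localization_def by (assumption | rule form | rule app | erule leaf | erule lift)+

lemma sim_is_fp [form]:
  "sim_ring w R R' \<Longrightarrow> sim_alg w A A' \<Longrightarrow> sim w (is_fp l R A) (is_fp l R' A')"
  unfolding is_fp_def by (assumption | rule form | erule leaf | erule lift)+

lemma ty_is_fp [form]: "ring_ops \<Gamma> l R \<Longrightarrow> alg_ops \<Gamma> l R A \<Longrightarrow> ty \<Gamma> (is_fp l R A)"
  unfolding is_fp_def by (assumption | rule form | rule app | erule leaf | erule lift)+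

lemma sim_axiom_duality [form]: "sim_ring w R R' \<Longrightarrow> sim w (axiom_duality l R) (axiom_duality l R')"
  unfolding axiom_duality_def by (assumption | rule form | erule leaf | erule lift)+

lemma ty_axiom_duality [form]: "ring_ops \<Gamma> l R \<Longrightarrow> ty \<Gamma> (axiom_duality l R)"
  unfolding axiom_duality_def by (assumption | rule form el_LAM | rule app | erule leaf | erule lift)+

lemma sim_axiom_choice [form]: "sim_ring w R R' \<Longrightarrow> sim w (axiom_choice l R) (axiom_choice l R')"
  unfolding axiom_choice_def by (assumption | rule form | erule leaf | erule lift)+

lemma ty_axiom_choice [form]: "ring_ops \<Gamma> l R \<Longrightarrow> ty \<Gamma> (axiom_choice l R)"
  unfolding axiom_choice_def by (assumption | rule form | rule app | erule leaf | erule lift)+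

lemma sim_axiom_constant [form]: "sim_ring w R R' \<Longrightarrow> sim w (axiom_constant l R) (axiom_constant l R')"
  unfolding axiom_constant_def by (assumption | rule form | erule leaf | erule lift)+

lemma ty_axiom_constant [form]: "ring_ops \<Gamma> l R \<Longrightarrow> ty \<Gamma> (axiom_constant l R)"
  unfolding axiom_constant_def by (assumption | rule form el_LAM | rule app | erule leaf | erule lift)+

section \<open>Finite types, sums and unimodular sequences\<close>

lemma cv_NatZero: "cv \<Gamma> (CON CNatInd \<cdot> P \<cdot> z \<cdot> s \<cdot> ZERO) z"
  using conv_NatZero by (auto simp: cv_def AP_def CON_def)

lemma cv_NatSucc: "cv \<Gamma> (CON CNatInd \<cdot> P \<cdot> z \<cdot> s \<cdot> SUCC n) (s \<cdot> n \<cdot> (CON CNatInd \<cdot> P \<cdot> z \<cdot> s \<cdot> n))"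
  using conv_NatSucc by (auto simp: cv_def AP_def CON_def)

lemma cv_SumInl: "cv \<Gamma> (CON CSumInd \<cdot> A \<cdot> B \<cdot> P \<cdot> l \<cdot> r \<cdot> INL A' B' a) (l \<cdot> a)"
  using conv_SumInl by (auto simp: cv_def AP_def CON_def)

lemma cv_SumInr: "cv \<Gamma> (CON CSumInd \<cdot> A \<cdot> B \<cdot> P \<cdot> l \<cdot> r \<cdot> INR A' B' b) (r \<cdot> b)"
  using conv_SumInr by (auto simp: cv_def AP_def CON_def)

lemma cv_beta2:
  assumes nat: "\<And>w x y p q. over \<Gamma> w \<Longrightarrow> sim w x y \<Longrightarrow> sim w p q \<Longrightarrow> sim w (F x p) (F y q)"
    and a: "natural \<Gamma> a" and b: "natural \<Gamma> b"
  shows "cv \<Gamma> (LAM (\<lambda>x. LAM (F x)) \<cdot> a \<cdot> b) (F a b)"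
proof -
  have "cv \<Gamma> (LAM (\<lambda>x. LAM (F x)) \<cdot> a) (LAM (F a))"
    by (rule cv_beta[OF _ a]) (auto intro!: sim_LAM nat intro: over_wle sim_wle)
  moreover have "cv \<Gamma> (LAM (F a) \<cdot> b) (F a b)"
    by (rule cv_beta[OF _ b]) (auto intro!: nat intro: sim_natural a)
  ultimately show ?thesis by (blast intro: cv_trans cv_AP cv_refl)
qed

lemma cv_fin_ZERO: "cv \<Gamma> (fin ZERO) EMPTY"
  unfolding fin_def by (rule cv_NatZero)

lemma cv_fin_SUCC:
  assumes "el \<Gamma> n NAT"
  shows "cv \<Gamma> (fin (SUCC n)) (PLUS (fin n) UNIT)"
proof -
  have n: "natural \<Gamma> n" "natural \<Gamma> (fin n)" using assms el_fin[OF assms] by (auto intro: natural_el)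
  show ?thesis
    using cv_trans[OF cv_NatSucc cv_beta2[OF _ n[unfolded fin_def], of "\<lambda>_ F. PLUS F UNIT"]]
    unfolding fin_def[symmetric] by (auto simp: fin_def[symmetric] intro!: sim_AP sim_CON)
qed

lemma el_fin_INL [form]: "el \<Gamma> n NAT \<Longrightarrow> el \<Gamma> i (fin n) \<Longrightarrow> el \<Gamma> (INL (fin n) UNIT i) (fin (SUCC n))"
  by (rule el_cv[OF el_INL cv_sym[OF cv_fin_SUCC]])
    (assumption | rule form | rule app | erule leaf | erule lift)+

lemma el_fin_INR [form]: "el \<Gamma> n NAT \<Longrightarrow> el \<Gamma> i UNIT \<Longrightarrow> el \<Gamma> (INR (fin n) UNIT i) (fin (SUCC n))"
  by (rule el_cv[OF el_INR cv_sym[OF cv_fin_SUCC]])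
    (assumption | rule form | rule app | erule leaf | erule lift)+

lemma sim_big_sum [form]:
  "sim_ring w K K' \<Longrightarrow> sim w n n' \<Longrightarrow> sim w f f' \<Longrightarrow> sim w (big_sum K n f) (big_sum K' n' f')"
  unfolding big_sum_def by (assumption | rule form | erule leaf | erule lift)+

lemma el_big_sum [form]:
  assumes "ring_ops \<Gamma> l K" "el \<Gamma> n NAT" "el \<Gamma> f (fin n \<rightarrow>\<^sub>t car K)"
  shows "el \<Gamma> (big_sum K n f) (car K)"
  unfolding big_sum_def
proof (rule el_app[OF el_NatInd[where C = "\<lambda>k. (fin k \<rightarrow>\<^sub>t car K) \<rightarrow>\<^sub>t car K"] assms(3)])
qed (insert assms(1,2), (assumption | rule form el_LAM | rule app | erule leaf | erule lift)+)

lemma sim_Um [form]: "sim_ring w R R' \<Longrightarrow> sim w (Um R) (Um R')"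
  unfolding Um_def by (assumption | rule form | erule leaf | erule lift)+

lemma ty_Um [form]: "ring_ops \<Gamma> l R \<Longrightarrow> ty \<Gamma> (Um R)"
  unfolding Um_def by (assumption | rule form el_LAM | rule app | erule leaf | erule lift)+

lemma el_Um_FST [form]: "el \<Gamma> u (Um R) \<Longrightarrow> el \<Gamma> (FST u) NAT"
  unfolding Um_def by (erule el_FST) (rule form)

lemma el_Um_FST_SND [form]:
  assumes R: "ring_ops \<Gamma> l R" and u: "el \<Gamma> u (Um R)"
  shows "el \<Gamma> (FST (SND u)) (fin (FST u) \<rightarrow>\<^sub>t car R)"
proof -
  have n: "el \<Gamma> (FST u) NAT" using u by (rule el_Um_FST)
  show ?thesis
    by (rule el_FST[OF el_SND[OF u[unfolded Um_def]]])
      (insert R n, (assumption | rule form el_LAM | rule app | erule leaf | erule lift)+)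
qed

lemma sim_D [form]: "sim_ring w R R' \<Longrightarrow> sim w r r' \<Longrightarrow> sim w (D l R r) (D l R' r')"
  unfolding D_def by (assumption | rule form | erule leaf | erule lift)+

lemma ty_D [form]: "ring_ops \<Gamma> l R \<Longrightarrow> el \<Gamma> r (car R) \<Longrightarrow> ty \<Gamma> (D l R r)"
  unfolding D_def by (assumption | rule form | rule app | erule leaf | erule lift)+

lemma sim_D_Um [form]: "sim_ring w R R' \<Longrightarrow> sim w u u' \<Longrightarrow> sim w (D_Um l R u) (D_Um l R' u')"
  unfolding D_Um_def by (assumption | rule form | erule leaf | erule lift)+

lemma ty_D_Um [form]: "ring_ops \<Gamma> l R \<Longrightarrow> el \<Gamma> u (Um R) \<Longrightarrow> ty \<Gamma> (D_Um l R u)"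
  unfolding D_Um_def by (assumption | rule form | rule app | erule leaf | erule lift)+

lemma sim_is_modal [form]: "sim_ring w R R' \<Longrightarrow> sim w T T' \<Longrightarrow> sim w (is_modal l R T) (is_modal l R' T')"
  unfolding is_modal_def by (assumption | rule form | erule leaf | erule lift)+

lemma ty_is_modal [form]: "ring_ops \<Gamma> l R \<Longrightarrow> ty \<Gamma> T \<Longrightarrow> ty \<Gamma> (is_modal l R T)"
  unfolding is_modal_def by (assumption | rule form el_LAM | rule app | erule leaf | erule lift)+

lemma sim_is_sheafification [form]:
  "sim_ring w R R' \<Longrightarrow> sim w P P' \<Longrightarrow> sim w S S' \<Longrightarrow> sim w (is_sheafification l R P S) (is_sheafification l R' P' S')"
  unfolding is_sheafification_def by (assumption | rule form | erule leaf | erule lift)+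

lemma ty_is_sheafification [form]:
  "ring_ops \<Gamma> l R \<Longrightarrow> ty \<Gamma> P \<Longrightarrow> ty \<Gamma> S \<Longrightarrow> ty \<Gamma> (is_sheafification l R P S)"
  unfolding is_sheafification_def by (assumption | rule form | rule app | erule leaf | erule lift)+

lemma sim_sheafified [form]: "sim_ring w R R' \<Longrightarrow> sim w P P' \<Longrightarrow> sim w (sheafified l R P) (sheafified l R' P')"
  unfolding sheafified_def by (assumption | rule form | erule leaf | erule lift)+

lemma ty_sheafified [form]: "ring_ops \<Gamma> l R \<Longrightarrow> ty \<Gamma> P \<Longrightarrow> ty \<Gamma> (sheafified l R P)"
  unfolding sheafified_def by (assumption | rule form | rule app | erule leaf | erule lift)+

lemma sim_sheaf_local [form]: "sim_ring w R R' \<Longrightarrow> sim w (sheaf_local l R) (sheaf_local l R')"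
  unfolding sheaf_local_def sheaf_empty_def sheaf_trunc_def
  by (assumption | rule form | erule leaf | erule lift)+

section \<open>Propositions as inhabited types\<close>

lemma inh_el: "el \<Gamma> X T \<Longrightarrow> inh \<Gamma> T"
  by (auto simp: inh_def)

lemma inh_AP:
  assumes "inh \<Gamma> (PI A B)" "el \<Gamma> a A" "\<And>w x y. over \<Gamma> w \<Longrightarrow> sim w x y \<Longrightarrow> sim w (B x) (B y)"
  shows "inh \<Gamma> (B a)"
  using assms(1) el_AP[where B = B, OF _ assms(2,3)] by (auto simp: inh_def)

lemma inh_app:
  assumes "inh \<Gamma> (A \<rightarrow>\<^sub>t B)" "inh \<Gamma> A" "ty \<Gamma> B"
  shows "inh \<Gamma> B"
proof -
  obtain a where a: "el \<Gamma> a A" using assms(2) by (auto simp: inh_def)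
  show ?thesis by (rule inh_AP[OF assms(1) a sim_ty[OF _ assms(3)]])
qed

lemma inh_arr:
  assumes "ty \<Gamma> A" "ty \<Gamma> B" "\<And>\<Delta>. \<Gamma> \<sqsubseteq> \<Delta> \<Longrightarrow> inh \<Delta> A \<Longrightarrow> inh \<Delta> B"
  shows "inh \<Gamma> (A \<rightarrow>\<^sub>t B)"
  by (rule inh_PI[OF assms(1) sim_ty[OF _ assms(2)]]) (auto intro: assms(3) inh_el)

lemma inh_SIG:
  assumes "ty \<Gamma> (SIG A B)" "el \<Gamma> a A" "inh \<Gamma> (B a)"
    "\<And>w x y. over \<Gamma> w \<Longrightarrow> sim w x y \<Longrightarrow> sim w (B x) (B y)"
  shows "inh \<Gamma> (SIG A B)"
  using assms(3) el_PAIR[where B = B, OF assms(1,2) _ assms(4)] by (auto simp: inh_def)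

lemma inh_SIG_cases:
  assumes "inh \<Gamma> (SIG A B)" "ty \<Gamma> A" "\<And>w x y. over \<Gamma> w \<Longrightarrow> sim w x y \<Longrightarrow> sim w (B x) (B y)"
  obtains a where "el \<Gamma> a A" "inh \<Gamma> (B a)"
  proof -
  obtain p where p: "el \<Gamma> p (SIG A B)" using assms(1) by (auto simp: inh_def)
  show thesis by (rule that[OF el_FST[OF p assms(2)] inh_el[OF el_SND[OF p assms(3)]]])
qed

lemma inh_pair:
  assumes "ty \<Gamma> A" "ty \<Gamma> B" "inh \<Gamma> A" "inh \<Gamma> B"
  shows "inh \<Gamma> (A \<times>\<^sub>t B)"
proof -
  obtain a where a: "el \<Gamma> a A" using assms(3) by (auto simp: inh_def)
  have "ty \<Gamma> (A \<times>\<^sub>t B)"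
    by (rule ty_SIG[OF assms(1) sim_ty[OF _ assms(2)] ty_sub_ctx[OF _ assms(2)]])
  then show ?thesis by (rule inh_SIG[OF _ a assms(4) sim_ty[OF _ assms(2)]])
qed

lemma inh_fst: "inh \<Gamma> (A \<times>\<^sub>t B) \<Longrightarrow> ty \<Gamma> A \<Longrightarrow> inh \<Gamma> A"
  by (auto simp: inh_def intro: el_FST)

lemma inh_snd:
  assumes "inh \<Gamma> (A \<times>\<^sub>t B)" "\<And>w. over \<Gamma> w \<Longrightarrow> sim w B B"
  shows "inh \<Gamma> B"
  using assms el_SND[of \<Gamma> _ A "\<lambda>_. B"] by (auto simp: inh_def)

lemma id_subst:
  assumes p: "inh \<Gamma> (ID A a b)" and a: "el \<Gamma> a A" and b: "el \<Gamma> b A" and c: "inh \<Gamma> (C a)"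
    and A: "ty \<Gamma> A"
    and nat: "\<And>w x y. over \<Gamma> w \<Longrightarrow> sim w x y \<Longrightarrow> sim w (C x) (C y)"
    and C: "\<And>\<Delta> x. \<Gamma> \<sqsubseteq> \<Delta> \<Longrightarrow> el \<Delta> x A \<Longrightarrow> ty \<Delta> (C x)"
  shows "inh \<Gamma> (C b)"
  using p c el_J[where C = "\<lambda>x _. C x", OF A a nat C _ b] by (auto simp: inh_def)

lemma id_sym:
  assumes A: "ty \<Gamma> A" and a: "el \<Gamma> a A" and b: "el \<Gamma> b A" and p: "inh \<Gamma> (ID A a b)"
  shows "inh \<Gamma> (ID A b a)"
  by (rule id_subst[OF p a b, where C = "\<lambda>x. ID A x a"])
    (insert A a, (assumption | rule form inh_el[OF el_REFL] | erule leaf | erule lift)+)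

lemma id_trans:
  assumes A: "ty \<Gamma> A" and a: "el \<Gamma> a A" and b: "el \<Gamma> b A" and c: "el \<Gamma> c A"
    and p: "inh \<Gamma> (ID A a b)" and q: "inh \<Gamma> (ID A b c)"
  shows "inh \<Gamma> (ID A a c)"
  by (rule id_subst[OF q b c, where C = "\<lambda>x. ID A a x"])
    (insert A a p, (assumption | rule form | erule leaf | erule lift)+)

lemma trunc_elim:
  assumes A: "ty \<Gamma> A" and Q: "ty \<Gamma> Q" and "inh \<Gamma> (is_prop Q)" "inh \<Gamma> (A \<rightarrow>\<^sub>t Q)" "inh \<Gamma> (TRUNC A)"
  shows "inh \<Gamma> Q"
  using assms(3-5) el_TrInd[OF A Q] by (auto simp: inh_def is_prop_def)

section \<open>The unit type is modal\<close>

text \<open>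
  With \<open>h\<close> a proof that \<open>A\<close> is a proposition, every path \<open>q : a = y\<close> equals the composite of the
  inverse of \<open>h a a\<close> with \<open>h a y\<close>; this is clear for \<open>q = refl\<close>, and the composite does not depend on
  \<open>q\<close>. For \<open>s : a = x\<close>, an element of \<open>E x s\<close> is a function that composes paths out of \<open>a\<close> with the
  inverse of \<open>s\<close>, together with the one property that is needed: it takes \<open>s\<close> to \<open>refl\<close>.
\<close>

lemma prop_is_set:
  assumes A: "ty \<Gamma> A" and pr: "inh \<Gamma> (is_prop A)" and a: "el \<Gamma> a A" and b: "el \<Gamma> b A"
    and p: "el \<Gamma> p (ID A a b)" and q: "el \<Gamma> q (ID A a b)"
  shows "inh \<Gamma> (ID (ID A a b) p q)"
proof -
  obtain h where h: "el \<Gamma> h (PI A (\<lambda>x. PI A (\<lambda>y. ID A x y)))"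
    using pr by (auto simp: inh_def is_prop_def)
  have ha: "el \<Gamma> (h \<cdot> a) (PI A (\<lambda>y. ID A a y))"
    by (rule el_AP[OF h a]) (insert A, (assumption | rule form | erule leaf | erule lift)+)
  have hay: "el \<Delta> (h \<cdot> a \<cdot> y) (ID A a y)" if "\<Gamma> \<sqsubseteq> \<Delta>" "el \<Delta> y A" for \<Delta> y
    by (rule el_AP[OF el_sub_ctx[OF that(1) ha] that(2)])
      (insert A a that(1), (assumption | rule form | erule leaf | erule lift)+)
  define E where "E x s = SIG (PI A (\<lambda>z. ID A a z \<rightarrow>\<^sub>t ID A x z)) (\<lambda>c. ID (ID A x x) (c \<cdot> x \<cdot> s) (REFL A x))"
    for x s
  define k where "k = LAM (\<lambda>z. LAM (\<lambda>q. q))"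
  have k: "el \<Gamma> k (PI A (\<lambda>z. ID A a z \<rightarrow>\<^sub>t ID A a z))"
    unfolding k_def by (insert A a, (assumption | rule form el_LAM | erule leaf | erule lift)+)
  have cap: "el \<Delta> (c \<cdot> x \<cdot> s) (ID A x' x)"
    if "\<Gamma> \<sqsubseteq> \<Delta>" "el \<Delta> c (PI A (\<lambda>z. ID A a z \<rightarrow>\<^sub>t ID A x' z))" "el \<Delta> x A" "el \<Delta> x' A" "el \<Delta> s (ID A a x)" for \<Delta> c x x' s
    by (rule el_app[OF el_AP[OF that(2,3)] that(5)])
      (insert A a that, (assumption | rule form | erule leaf | erule lift)+)
  have r: "el \<Gamma> (REFL A a) (ID A a a)" by (insert A a, (assumption | rule form)+)
  have tyE: "ty \<Delta> (E x s)" if "\<Gamma> \<sqsubseteq> \<Delta>" "el \<Delta> x A" "el \<Delta> s (ID A a x)" for \<Delta> x s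
    unfolding E_def
    by (insert A a that, (assumption | rule form cap | erule leaf | erule lift)+)
  have "inh \<Gamma> (E a (REFL A a))"
    unfolding E_def
  proof (rule inh_SIG[OF tyE[OF sub_ctx_refl a r, unfolded E_def] k])
    have "cv \<Gamma> (k \<cdot> a \<cdot> REFL A a) (REFL A a)"
      unfolding k_def by (rule cv_beta2[where F = "\<lambda>_ q. q"]) (auto intro: natural_el a r)
    then have "cv \<Gamma> (ID (ID A a a) (REFL A a) (REFL A a)) (ID (ID A a a) (k \<cdot> a \<cdot> REFL A a) (REFL A a))"
      by (intro cv_AP[OF cv_AP[OF cv_refl]] cv_refl) (rule cv_sym)
    then show "inh \<Gamma> (ID (ID A a a) (k \<cdot> a \<cdot> REFL A a) (REFL A a))"
      by (rule inh_cv[OF inh_el[OF el_REFL[OF ty_ID[OF A a a] r]]])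
        (rule ty_ID[OF ty_ID[OF A a a] cap[OF sub_ctx_refl k a a r] r])
  qed (insert A a, (assumption | rule form | erule leaf | erule lift)+)
  then obtain e where e: "el \<Gamma> e (E a (REFL A a))" by (auto simp: inh_def)
  have "inh \<Gamma> (E a (h \<cdot> a \<cdot> a))"
    by (rule inh_el[OF el_J[where C = E, OF A a _ tyE e a hay[OF sub_ctx_refl a]]])
      (insert A a, unfold E_def, (assumption | rule form | erule leaf | erule lift)+)
  then obtain c where c: "el \<Gamma> c (PI A (\<lambda>z. ID A a z \<rightarrow>\<^sub>t ID A a z))"
    and "inh \<Gamma> (ID (ID A a a) (c \<cdot> a \<cdot> (h \<cdot> a \<cdot> a)) (REFL A a))"
    unfolding E_def
    by (rule inh_SIG_cases) (insert A a h, (assumption | rule form | erule leaf | erule lift)+)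
  then obtain g where g: "el \<Gamma> g (ID (ID A a a) (c \<cdot> a \<cdot> (h \<cdot> a \<cdot> a)) (REFL A a))"
    by (auto simp: inh_def)
  let ?t = "c \<cdot> b \<cdot> (h \<cdot> a \<cdot> b)"
  have eq: "inh \<Gamma> (ID (ID A a b) ?t q)" if "el \<Gamma> q (ID A a b)" for q
    by (rule inh_el[OF el_J[where C = "\<lambda>y q. ID (ID A a y) (c \<cdot> y \<cdot> (h \<cdot> a \<cdot> y)) q", OF A a _ _ g b that]])
      (insert A a c h, (assumption | rule form cap hay | erule leaf | erule lift)+)
  have t: "el \<Gamma> ?t (ID A a b)" by (rule cap[OF sub_ctx_refl c b a hay[OF sub_ctx_refl b]])
  have I: "ty \<Gamma> (ID A a b)" by (rule ty_ID) fact+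
  show ?thesis
    by (rule id_trans[OF I p t q id_sym[OF I t p eq[OF p]] eq[OF q]])
qed

lemma unit_ind:
  assumes nat: "\<And>w x y. over \<Gamma> w \<Longrightarrow> sim w x y \<Longrightarrow> sim w (C x) (C y)"
    and C: "\<And>\<Delta> x. \<Gamma> \<sqsubseteq> \<Delta> \<Longrightarrow> el \<Delta> x UNIT \<Longrightarrow> ty \<Delta> (C x)"
    and c: "inh \<Gamma> (C STAR)" and x: "el \<Gamma> x UNIT"
  shows "inh \<Gamma> (C x)"
  using c el_UnitInd[where C = C, OF nat C _ x] by (auto simp: inh_def)

lemma unit_prop: "inh \<Gamma> (is_prop UNIT)"
  unfolding is_prop_def
proof (rule inh_PI; (rule inh_PI)?)
  fix \<Delta> \<Theta> x y assume "\<Gamma> \<sqsubseteq> \<Delta>" and x: "el \<Delta> x UNIT" and "\<Delta> \<sqsubseteq> \<Theta>" and y: "el \<Theta> y UNIT"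
  have x: "el \<Theta> x UNIT" by (rule el_sub_ctx) fact+
  have "inh \<Theta> (ID UNIT STAR y)"
    by (rule unit_ind[where C = "\<lambda>y. ID UNIT STAR y", OF _ _ _ y])
      (assumption | rule form inh_el[OF el_REFL] | erule leaf | erule lift)+
  then show "inh \<Theta> (ID UNIT x y)"
    by (intro unit_ind[where C = "\<lambda>x. ID UNIT x y", OF _ _ _ x])
      (insert y, (assumption | rule form | erule leaf | erule lift)+)
qed ((assumption | rule form | erule leaf | erule lift)+)

lemma prop_arr:
  assumes A: "ty \<Gamma> A" and B: "ty \<Gamma> B" and pr: "inh \<Gamma> (is_prop B)"
  shows "inh \<Gamma> (is_prop (A \<rightarrow>\<^sub>t B))"
  unfolding is_prop_def
proof (rule inh_PI; (rule inh_PI)?)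
  fix \<Delta> \<Theta> f g assume 1: "\<Gamma> \<sqsubseteq> \<Delta>" and f: "el \<Delta> f (A \<rightarrow>\<^sub>t B)" and 2: "\<Delta> \<sqsubseteq> \<Theta>" and g: "el \<Theta> g (A \<rightarrow>\<^sub>t B)"
  have 3: "\<Gamma> \<sqsubseteq> \<Theta>" using 1 2 by (rule sub_ctx_trans)
  have f: "el \<Theta> f (A \<rightarrow>\<^sub>t B)" by (rule el_sub_ctx) fact+
  have A: "ty \<Theta> A" and B: "ty \<Theta> B" by (rule ty_sub_ctx[OF 3], fact)+
  have ap: "inh \<Xi> (ID B x y)" if "\<Theta> \<sqsubseteq> \<Xi>" "el \<Xi> x B" "el \<Xi> y B" for \<Xi> x y
  proof -
    have B': "ty \<Xi> B" by (rule ty_sub_ctx) fact+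
    have p: "inh \<Xi> (PI B (\<lambda>x. PI B (\<lambda>y. ID B x y)))"
      using inh_sub_ctx[OF sub_ctx_trans[OF 3 that(1)] pr] by (simp add: is_prop_def)
    have "inh \<Xi> (PI B (\<lambda>y. ID B x y))"
      by (rule inh_AP[OF p that(2)]) (insert B', (assumption | rule form | erule leaf | erule lift)+)
    then show ?thesis
      by (rule inh_AP[OF _ that(3)]) (insert B' that(2), (assumption | rule form | erule leaf | erule lift)+)
  qed
  show "inh \<Theta> (ID (A \<rightarrow>\<^sub>t B) f g)"
    by (rule inh_funext[OF A B f g], rule inh_PI)
      (insert A B f g, (assumption | rule form ap app | erule leaf | erule lift)+)
next
qed (insert A B, (assumption | rule form | erule leaf | erule lift)+)

text \<open>
  The fiber over \<open>y\<close> has an element since \<open>B\<close> is a proposition. Any other element is equal to it: its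
  first component is \<open>STAR\<close> by induction, and its second component lies in an identity type of \<open>B\<close>,
  which is a proposition by \<open>prop_is_set\<close>.
\<close>

lemma unit_equiv_prop:
  assumes B: "ty \<Gamma> B" and pr: "inh \<Gamma> (is_prop B)" and k: "el \<Gamma> k (UNIT \<rightarrow>\<^sub>t B)"
  shows "inh \<Gamma> (is_equiv UNIT B k)"
  unfolding is_equiv_def
proof (rule inh_PI[OF B])
  fix \<Delta> y assume \<Delta>: "\<Gamma> \<sqsubseteq> \<Delta>" and y: "el \<Delta> y B"
  have B: "ty \<Delta> B" and k: "el \<Delta> k (UNIT \<rightarrow>\<^sub>t B)" and pr: "inh \<Delta> (is_prop B)"
    by (rule ty_sub_ctx[OF \<Delta> B] el_sub_ctx[OF \<Delta> k] inh_sub_ctx[OF \<Delta> pr])+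
  have kS: "el \<Delta> (k \<cdot> STAR) B"
    by (rule el_app[OF k]) (insert B, (assumption | rule form | erule leaf | erule lift)+)
  have p1: "inh \<Delta> (PI B (\<lambda>y. ID B (k \<cdot> STAR) y))"
    by (rule inh_AP[OF pr[unfolded is_prop_def] kS]) (insert B, (assumption | rule form | erule leaf | erule lift)+)
  have "inh \<Delta> (ID B (k \<cdot> STAR) y)"
    by (rule inh_AP[OF p1 y]) (insert B k, (assumption | rule form | erule leaf | erule lift)+)
  then obtain p where p: "el \<Delta> p (ID B (k \<cdot> STAR) y)" by (auto simp: inh_def)
  let ?F = "SIG UNIT (\<lambda>x. ID B (k \<cdot> x) y)"
  have F: "ty \<Delta> ?F"
    by (insert B k y, (assumption | rule form | rule app | erule leaf | erule lift)+)
  have c: "el \<Delta> (PAIR STAR p) ?F"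
    by (rule el_PAIR) (insert F p B k y, (assumption | rule form | rule app | erule leaf | erule lift)+)
  have pair: "el \<Theta> (PAIR a b) ?F" if "\<Delta> \<sqsubseteq> \<Theta>" "el \<Theta> a UNIT" "el \<Theta> b (ID B (k \<cdot> a) y)" for \<Theta> a b
    by (rule el_PAIR[OF ty_sub_ctx[OF that(1) F] that(2,3)])
      (insert that(1) B k y, (assumption | rule form | rule app | erule leaf | erule lift)+)
  have star: "inh \<Delta> (PI (ID B (k \<cdot> STAR) y) (\<lambda>b. ID ?F (PAIR STAR p) (PAIR STAR b)))"
  proof (rule inh_PI)
    fix \<Theta> b assume \<Theta>: "\<Delta> \<sqsubseteq> \<Theta>" and b: "el \<Theta> b (ID B (k \<cdot> STAR) y)"
    have *: "ty \<Theta> B" "el \<Theta> (k \<cdot> STAR) B" "el \<Theta> y B" "el \<Theta> p (ID B (k \<cdot> STAR) y)" "inh \<Theta> (is_prop B)"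
      "el \<Theta> (PAIR STAR p) ?F" "ty \<Theta> ?F" "el \<Theta> k (UNIT \<rightarrow>\<^sub>t B)"
      by (rule ty_sub_ctx[OF \<Theta>] el_sub_ctx[OF \<Theta>] inh_sub_ctx[OF \<Theta>], fact)+
    show "inh \<Theta> (ID ?F (PAIR STAR p) (PAIR STAR b))"
      by (rule id_subst[where C = "\<lambda>b. ID ?F (PAIR STAR p) (PAIR STAR b)", OF
            prop_is_set[OF *(1,5,2,3,4) b] *(4) b inh_el[OF el_REFL[OF *(7,6)]]])
        (insert * \<Theta>, (assumption | rule form pair | rule app | erule leaf | erule lift)+)
  qed (insert B k p y F, (assumption | rule form | rule app | erule leaf | erule lift)+)
  have "inh \<Delta> (PI UNIT (\<lambda>a. PI (ID B (k \<cdot> a) y) (\<lambda>b. ID ?F (PAIR STAR p) (PAIR a b))))"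
  proof (rule inh_PI)
    fix \<Theta> a assume \<Theta>: "\<Delta> \<sqsubseteq> \<Theta>" and a: "el \<Theta> a UNIT"
    show "inh \<Theta> (PI (ID B (k \<cdot> a) y) (\<lambda>b. ID ?F (PAIR STAR p) (PAIR a b)))"
      by (rule unit_ind[where C = "\<lambda>a. PI (ID B (k \<cdot> a) y) (\<lambda>b. ID ?F (PAIR STAR p) (PAIR a b))",
            OF _ _ inh_sub_ctx[OF \<Theta> star] a])
        (insert B k p y F c \<Theta>, (assumption | rule form pair | rule app | erule leaf | erule lift)+)
  qed (insert B k p y F, (assumption | rule form | rule app | erule leaf | erule lift)+)
  then obtain f where f: "el \<Delta> f (PI UNIT (\<lambda>a. PI (ID B (k \<cdot> a) y) (\<lambda>b. ID ?F (PAIR STAR p) (PAIR a b))))"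
    by (auto simp: inh_def)
  have contr: "inh \<Delta> (PI ?F (\<lambda>z. ID ?F (PAIR STAR p) z))"
  proof (rule inh_PI)
    fix \<Theta> z assume \<Theta>: "\<Delta> \<sqsubseteq> \<Theta>" and z: "el \<Theta> z ?F"
    show "inh \<Theta> (ID ?F (PAIR STAR p) z)"
    proof (rule inh_el[OF el_SigInd[where C = "\<lambda>z. ID ?F (PAIR STAR p) z" and B = "\<lambda>x. ID B (k \<cdot> x) y",
            OF _ _ _ _ _ el_sub_ctx[OF \<Theta> f] z]])
      fix w u v assume h: "over \<Theta> w" "sim w u v"
      show "sim w (ID B (k \<cdot> u) y) (ID B (k \<cdot> v) y)"
        by (insert h B k p y F c \<Theta>, (assumption | rule form | rule app | erule leaf | erule lift)+)
    next
      fix w u v assume h: "over \<Theta> w" "sim w u v"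
      show "sim w (ID ?F (PAIR STAR p) u) (ID ?F (PAIR STAR p) v)"
        by (insert h B k p y F c \<Theta>, (assumption | rule form | rule app | erule leaf | erule lift)+)
    next
      fix \<Xi> u assume h: "\<Theta> \<sqsubseteq> \<Xi>" "el \<Xi> u UNIT"
      show "ty \<Xi> (ID B (k \<cdot> u) y)"
        by (insert h B k p y F c \<Theta>, (assumption | rule form | rule app | erule leaf | erule lift)+)
    next
      fix \<Xi> u assume h: "\<Theta> \<sqsubseteq> \<Xi>" "el \<Xi> u ?F"
      show "ty \<Xi> (ID ?F (PAIR STAR p) u)"
        by (insert h B k p y F c \<Theta>, (assumption | rule form | rule app | erule leaf | erule lift)+)
    qed (rule form)
  qed (insert B k p y F, (assumption | rule form | rule app | erule leaf | erule lift)+)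
  show "inh \<Delta> (is_contr (fiber UNIT B k y))"
    unfolding is_contr_def fiber_def
    by (rule inh_SIG[where B = "\<lambda>c. PI ?F (\<lambda>x. ID ?F c x)", OF _ c contr])
      (insert B k p y F c, (assumption | rule form | rule app | erule leaf | erule lift)+)
next
qed (insert B k, (assumption | rule form | erule leaf | erule lift)+)

lemma unit_modal:
  assumes R: "ring_ops \<Gamma> l R"
  shows "inh \<Gamma> (is_modal l R UNIT)"
  unfolding is_modal_def
  by (rule inh_PI)
    (insert R, (assumption | rule unit_equiv_prop prop_arr unit_prop form el_LAM | erule leaf | erule lift)+)

section \<open>Modal propositions and sheafification\<close>

text \<open>
  Modality extends an element of \<open>Q\<close> that is given on \<open>D(u)\<close>: the fiber over it is contractible, and
  the first component of the center is the extension.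
\<close>

lemma modal_elim:
  assumes R: "ring_ops \<Gamma> l R" and Q: "ty \<Gamma> Q" and m: "inh \<Gamma> (is_modal l R Q)"
    and u: "el \<Gamma> u (Um R)" and f: "inh \<Gamma> (D_Um l R u \<rightarrow>\<^sub>t Q)"
  shows "inh \<Gamma> Q"
proof -
  let ?k = "LAM (\<lambda>t. LAM (\<lambda>_. t))"
  let ?T = "D_Um l R u \<rightarrow>\<^sub>t Q"
  obtain g where g: "el \<Gamma> g ?T" using f by (auto simp: inh_def)
  have k: "el \<Gamma> ?k (Q \<rightarrow>\<^sub>t ?T)"
    by (insert R Q u, (assumption | rule form el_LAM | erule leaf | erule lift)+)
  have "inh \<Gamma> (is_equiv Q ?T ?k)"
    by (rule inh_AP[OF m[unfolded is_modal_def] u])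
      (insert R Q, (assumption | rule form | erule leaf | erule lift)+)
  then have "inh \<Gamma> (is_contr (fiber Q ?T ?k g))"
    unfolding is_equiv_def
    by (rule inh_AP[OF _ g]) (insert R Q u, (assumption | rule form | erule leaf | erule lift)+)
  then obtain c where c: "el \<Gamma> c (fiber Q ?T ?k g)"
    unfolding is_contr_def
    by (rule inh_SIG_cases) (insert R Q u k g, (assumption | rule form | erule leaf | erule lift)+)
  show ?thesis by (rule inh_el[OF el_FST[OF c[unfolded fiber_def] Q]])
qed

text \<open>
  The sheafification exhibited here is the unit type; being initial among the modal propositions
  implied by \<open>P\<close> means for it that all of them are inhabited.
\<close>

lemma sheafified_intro:
  assumes R: "ring_ops \<Gamma> l R" and P: "ty \<Gamma> P"
    and univ: "\<And>\<Delta> Q. \<Gamma> \<sqsubseteq> \<Delta> \<Longrightarrow> ty \<Delta> Q \<Longrightarrow> inh \<Delta> (is_prop Q) \<Longrightarrow> inh \<Delta> (is_modal l R Q)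
      \<Longrightarrow> inh \<Delta> (P \<rightarrow>\<^sub>t Q) \<Longrightarrow> inh \<Delta> Q"
  shows "inh \<Gamma> (sheafified l R P)"
  unfolding sheafified_def
proof (rule inh_SIG[where B = "\<lambda>S. is_sheafification l R P S \<times>\<^sub>t S"])
  have 1: "inh \<Gamma> (P \<rightarrow>\<^sub>t UNIT)"
    by (rule inh_arr[OF P _ inh_el[OF el_STAR]]) (rule form)
  have 2: "inh \<Gamma> (PI (UNI l) (\<lambda>Q. is_prop Q \<rightarrow>\<^sub>t is_modal l R Q \<rightarrow>\<^sub>t (P \<rightarrow>\<^sub>t Q) \<rightarrow>\<^sub>t UNIT \<rightarrow>\<^sub>t Q))"
  proof (rule inh_PI)
    fix \<Delta> Q assume \<Delta>: "\<Gamma> \<sqsubseteq> \<Delta>" and Q: "el \<Delta> Q (UNI l)"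
    show "inh \<Delta> (is_prop Q \<rightarrow>\<^sub>t is_modal l R Q \<rightarrow>\<^sub>t (P \<rightarrow>\<^sub>t Q) \<rightarrow>\<^sub>t UNIT \<rightarrow>\<^sub>t Q)"
    proof (intro inh_arr)
      fix \<Delta>1 \<Delta>2 \<Delta>3 \<Delta>4
      assume d: "\<Delta> \<sqsubseteq> \<Delta>1" "\<Delta>1 \<sqsubseteq> \<Delta>2" "\<Delta>2 \<sqsubseteq> \<Delta>3" "\<Delta>3 \<sqsubseteq> \<Delta>4"
        and h: "inh \<Delta>1 (is_prop Q)" "inh \<Delta>2 (is_modal l R Q)" "inh \<Delta>3 (P \<rightarrow>\<^sub>t Q)"
      show "inh \<Delta>4 Q"
        by (rule univ) (insert d h \<Delta> Q, (assumption | erule leaf | erule lift)+)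
    qed (insert R P \<Delta> Q, (assumption | rule form | erule leaf | erule lift)+)
  qed (insert R P, (assumption | rule form | erule leaf | erule lift)+)
  show "inh \<Gamma> (is_sheafification l R P UNIT \<times>\<^sub>t UNIT)"
    unfolding is_sheafification_def
    by (intro inh_pair unit_prop unit_modal[OF R] 1 2 inh_el[OF el_STAR])
      (insert R P, (assumption | rule form | erule leaf | erule lift)+)
qed (insert R P, (assumption | rule form | erule leaf | erule lift)+)

section \<open>Basic open propositions\<close>

lemma over_rings_cases:
  assumes d: "inh \<Gamma> (over_rings SIG l F)"
    and nat: "\<And>w K K'. over \<Gamma> w \<Longrightarrow> sim_ring w K K' \<Longrightarrow> sim w (F K) (F K')"
  obtains K where "ring_ops \<Gamma> l K" "inh \<Gamma> (F K)"
proof -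
  obtain K where K: "el \<Gamma> K (UNI l)" and d1: "inh \<Gamma> (SIG K (\<lambda>z. SIG K (\<lambda>u. SIG (K \<rightarrow>\<^sub>t K \<rightarrow>\<^sub>t K) (\<lambda>a.
      SIG (K \<rightarrow>\<^sub>t K) (\<lambda>n. SIG (K \<rightarrow>\<^sub>t K \<rightarrow>\<^sub>t K) (\<lambda>m.
       SIG (is_comm_ring (Ring K z u a n m)) (\<lambda>_. F (Ring K z u a n m))))))))"
    using d unfolding over_rings_def
    by (rule inh_SIG_cases) (assumption | rule nat | rule form | erule leaf | erule lift)+
  obtain z where z: "el \<Gamma> z K" and d2: "inh \<Gamma> (SIG K (\<lambda>u. SIG (K \<rightarrow>\<^sub>t K \<rightarrow>\<^sub>t K) (\<lambda>a.
      SIG (K \<rightarrow>\<^sub>t K) (\<lambda>n. SIG (K \<rightarrow>\<^sub>t K \<rightarrow>\<^sub>t K) (\<lambda>m.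
       SIG (is_comm_ring (Ring K z u a n m)) (\<lambda>_. F (Ring K z u a n m)))))))"
    using d1 by (rule inh_SIG_cases) (insert K, (assumption | rule nat | rule form | erule leaf | erule lift)+)
  obtain u where u: "el \<Gamma> u K" and d3: "inh \<Gamma> (SIG (K \<rightarrow>\<^sub>t K \<rightarrow>\<^sub>t K) (\<lambda>a.
      SIG (K \<rightarrow>\<^sub>t K) (\<lambda>n. SIG (K \<rightarrow>\<^sub>t K \<rightarrow>\<^sub>t K) (\<lambda>m.
       SIG (is_comm_ring (Ring K z u a n m)) (\<lambda>_. F (Ring K z u a n m))))))"
    using d2 by (rule inh_SIG_cases) (insert K z, (assumption | rule nat | rule form | erule leaf | erule lift)+)
  obtain a where a: "el \<Gamma> a (K \<rightarrow>\<^sub>t K \<rightarrow>\<^sub>t K)" and d4: "inh \<Gamma> (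
      SIG (K \<rightarrow>\<^sub>t K) (\<lambda>n. SIG (K \<rightarrow>\<^sub>t K \<rightarrow>\<^sub>t K) (\<lambda>m.
       SIG (is_comm_ring (Ring K z u a n m)) (\<lambda>_. F (Ring K z u a n m)))))"
    using d3 by (rule inh_SIG_cases) (insert K z u, (assumption | rule nat | rule form | erule leaf | erule lift)+)
  obtain n where n: "el \<Gamma> n (K \<rightarrow>\<^sub>t K)" and d5: "inh \<Gamma> (SIG (K \<rightarrow>\<^sub>t K \<rightarrow>\<^sub>t K) (\<lambda>m.
       SIG (is_comm_ring (Ring K z u a n m)) (\<lambda>_. F (Ring K z u a n m))))"
    using d4 by (rule inh_SIG_cases) (insert K z u a, (assumption | rule nat | rule form | erule leaf | erule lift)+)
  obtain m where m: "el \<Gamma> m (K \<rightarrow>\<^sub>t K \<rightarrow>\<^sub>t K)" and d6: "inh \<Gamma> (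
       SIG (is_comm_ring (Ring K z u a n m)) (\<lambda>_. F (Ring K z u a n m)))"
    using d5 by (rule inh_SIG_cases) (insert K z u a n, (assumption | rule nat | rule form | erule leaf | erule lift)+)
  have r: "ring_ops \<Gamma> l (Ring K z u a n m)" by (rule ring_ops_Ring) fact+
  have "inh \<Gamma> (F (Ring K z u a n m))"
    by (rule inh_snd[OF d6]) (insert r, (assumption | rule nat | erule leaf | erule lift)+)
  with r show thesis by (rule that)
qed

lemma over_algs_cases:
  assumes d: "inh \<Gamma> (over_algs SIG l R F)" and R: "ring_ops \<Gamma> k R"
    and nat: "\<And>w A A'. over \<Gamma> w \<Longrightarrow> sim_alg w A A' \<Longrightarrow> sim w (F A) (F A')"
  obtains A where "alg_ops \<Gamma> l R A" "inh \<Gamma> (F A)"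
proof -
  obtain K where K: "ring_ops \<Gamma> l K"
    and d1: "inh \<Gamma> (SIG (car R \<rightarrow>\<^sub>t car K) (\<lambda>h. SIG (is_ring_hom R K h) (\<lambda>_. F (Alg K h))))"
    using d unfolding over_algs_def
    by (rule over_rings_cases) (insert R, (assumption | rule nat | rule form | erule leaf | erule lift)+)
  obtain h where h: "el \<Gamma> h (car R \<rightarrow>\<^sub>t car K)" and d2: "inh \<Gamma> (SIG (is_ring_hom R K h) (\<lambda>_. F (Alg K h)))"
    using d1 by (rule inh_SIG_cases) (insert R K, (assumption | rule nat | rule form | erule leaf | erule lift)+)
  have A: "alg_ops \<Gamma> l R (Alg K h)" by (rule alg_ops_Alg) fact+
  have "inh \<Gamma> (F (Alg K h))"
    by (rule inh_snd[OF d2]) (insert A, (assumption | rule nat | erule leaf | erule lift)+)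
  with A show thesis by (rule that)
qed

text \<open>
  A point of \<open>D(r)\<close> consists of a localization \<open>L\<close> at \<open>r\<close> and an algebra homomorphism \<open>f : L \<rightarrow> R\<close>. If
  \<open>v\<close> is inverse to the image of \<open>r\<close> in \<open>L\<close>, then \<open>r \<cdot> f v = f (r v) = f 1 = 1\<close>.
\<close>

lemma D_has_inv:
  assumes R: "ring_ops \<Gamma> l R" and r: "el \<Gamma> r (car R)" and d: "inh \<Gamma> (D l R r)"
  shows "inh \<Gamma> (has_inv R r)"
proof -
  obtain L where L: "alg_ops \<Gamma> l R L" and d1: "inh \<Gamma> (is_localization l R r L \<times>\<^sub>t Spec R L)"
    using d unfolding D_def
    by (rule over_algs_cases[OF _ R]) (insert R r, (assumption | rule form | erule leaf | erule lift)+)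
  have loc: "inh \<Gamma> (is_localization l R r L)"
    by (rule inh_fst[OF d1]) (insert R r L, (assumption | rule form | erule leaf | erule lift)+)
  have spec: "inh \<Gamma> (Spec R L)"
    by (rule inh_snd[OF d1]) (insert R r L, (assumption | rule form | erule leaf | erule lift)+)
  let ?i = "amap L \<cdot> r" and ?L = "aring L"
  have LR: "ring_ops \<Gamma> l ?L" and i: "el \<Gamma> ?i (acar L)"
    by (insert R r L, (assumption | rule form | erule leaf | erule lift)+)
  have "inh \<Gamma> (has_inv ?L ?i)"
    by (rule inh_fst[OF loc[unfolded is_localization_def]])
      (insert R r L LR i, (assumption | rule form | erule leaf | erule lift)+)
  then obtain v where v: "el \<Gamma> v (acar L)" and iv: "inh \<Gamma> (eq_in ?L (times_in ?L ?i v) (rone ?L))"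
    unfolding has_inv_def
    by (rule inh_SIG_cases) (insert R r L i, (assumption | rule form | erule leaf | erule lift)+)
  have B: "aring (base_alg R) = R" by (simp add: base_alg_def)
  obtain f where f: "el \<Gamma> f (acar L \<rightarrow>\<^sub>t car R)"
    and hom: "inh \<Gamma> (is_ring_hom ?L R f
       \<times>\<^sub>t PI (car R) (\<lambda>r. ID (car R) (f \<cdot> (amap L \<cdot> r)) (amap (base_alg R) \<cdot> r)))"
    using spec unfolding Spec_def alg_hom_def B
    by (rule inh_SIG_cases) (insert R L, (assumption | rule form | erule leaf | erule lift)+)
  have fe: "el \<Gamma> (f \<cdot> x) (car R)" if "el \<Gamma> x (acar L)" for x
    by (rule el_app[OF f that]) (insert R, (assumption | rule form | erule leaf | erule lift)+)
  have "inh \<Gamma> (ID (car R) (f \<cdot> ?i) (amap (base_alg R) \<cdot> r))"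
    by (rule inh_AP[OF inh_snd[OF hom] r])
      (insert R L f, (assumption | rule form | erule leaf | erule lift)+)
  moreover have "cv \<Gamma> (ID (car R) (f \<cdot> ?i) (amap (base_alg R) \<cdot> r)) (ID (car R) (f \<cdot> ?i) r)"
    by (rule cv_AP[OF cv_refl]) (auto simp: base_alg_def intro: cv_beta natural_el r)
  moreover have "ty \<Gamma> (ID (car R) (f \<cdot> ?i) r)"
    by (rule ty_ID[OF ring_ops_el(3)[OF R] fe[OF i] r])
  ultimately have fi: "inh \<Gamma> (eq_in R (f \<cdot> ?i) r)" by (rule inh_cv)
  have rh: "inh \<Gamma> (is_ring_hom ?L R f)"
    by (rule inh_fst[OF hom]) (insert R L LR f, (assumption | rule form | erule leaf | erule lift)+)
  have one: "inh \<Gamma> (eq_in R (f \<cdot> rone ?L) (rone R))"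
    by (rule inh_fst[OF rh[unfolded is_ring_hom_def]])
      (insert R L LR f, (assumption | rule form | rule app | erule leaf | erule lift)+)
  have mult: "inh \<Gamma> (PI (acar L) (\<lambda>x. PI (acar L) (\<lambda>y.
      eq_in R (f \<cdot> times_in ?L x y) (times_in R (f \<cdot> x) (f \<cdot> y)))))"
    by (rule inh_snd[OF inh_snd[OF rh[unfolded is_ring_hom_def]]])
      (insert R L LR f, (assumption | rule form | erule leaf | erule lift)+)
  have "inh \<Gamma> (PI (acar L) (\<lambda>y. eq_in R (f \<cdot> times_in ?L ?i y) (times_in R (f \<cdot> ?i) (f \<cdot> y))))"
    by (rule inh_AP[OF mult i]) (insert R L LR f, (assumption | rule form | erule leaf | erule lift)+)
  then have mult: "inh \<Gamma> (eq_in R (f \<cdot> times_in ?L ?i v) (times_in R (f \<cdot> ?i) (f \<cdot> v)))"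
    by (rule inh_AP[OF _ v]) (insert R L LR f r, (assumption | rule form | erule leaf | erule lift)+)
  have iv': "el \<Gamma> (times_in ?L ?i v) (acar L)" and o: "el \<Gamma> (rone ?L) (acar L)" and cL: "ty \<Gamma> (acar L)"
    by (insert L LR i v, (assumption | rule form)+)
  have fi': "el \<Gamma> (f \<cdot> ?i) (car R)" and fv: "el \<Gamma> (f \<cdot> v) (car R)" and fiv: "el \<Gamma> (f \<cdot> times_in ?L ?i v) (car R)"
    using fe i v iv' by auto
  have tm: "el \<Gamma> (times_in R (f \<cdot> ?i) (f \<cdot> v)) (car R)" by (rule el_times) fact+
  have cR: "ty \<Gamma> (car R)" by (rule ring_ops_el(3)) fact
  have "inh \<Gamma> (eq_in R (f \<cdot> times_in ?L ?i v) (rone R))"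
    by (rule id_subst[OF id_sym[OF cL iv' o iv] o iv', where C = "\<lambda>t. eq_in R (f \<cdot> t) (rone R)"])
      (insert one R L LR f, (assumption | rule form | rule app | erule leaf | erule lift)+)
  then have "inh \<Gamma> (eq_in R (times_in R (f \<cdot> ?i) (f \<cdot> v)) (rone R))"
    by (rule id_subst[OF mult fiv tm, where C = "\<lambda>t. eq_in R t (rone R)"])
      (insert R, (assumption | rule form | erule leaf | erule lift)+)
  then have "inh \<Gamma> (eq_in R (times_in R r (f \<cdot> v)) (rone R))"
    by (rule id_subst[OF fi fi' r, where C = "\<lambda>t. eq_in R (times_in R t (f \<cdot> v)) (rone R)"])
      (insert R L f v fv, (assumption | rule form | erule leaf | erule lift)+)
  then show ?thesis
    unfolding has_inv_def
    by (intro inh_SIG[where B = "\<lambda>z. eq_in R (times_in R r z) (rone R)", OF _ fv])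
      (insert R r, (assumption | rule form | erule leaf | erule lift)+)
qed

lemma cv_has_inv: "cv \<Gamma> r r' \<Longrightarrow> cv \<Gamma> (has_inv R r) (has_inv R r')"
  unfolding has_inv_def by (intro cv_SIG cv_AP cv_refl) (rule cv_sub_ctx)

section \<open>Descent along a basic open cover\<close>

text \<open>
  The sequence is an iterated pair. Remembering its components up to conversion only keeps the large
  coefficient proof inside the pair out of later goals.
\<close>

lemma Um_intro:
  assumes R: "ring_ops \<Gamma> l R"
    and n: "el \<Gamma> n NAT" and f: "el \<Gamma> f (fin n \<rightarrow>\<^sub>t car R)" and c: "el \<Gamma> c (fin n \<rightarrow>\<^sub>t car R)"
    and sum: "inh \<Gamma> (eq_in R (big_sum R n (LAM (\<lambda>i. times_in R (c \<cdot> i) (f \<cdot> i)))) (rone R))"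
  obtains u where "el \<Gamma> u (Um R)" "cv \<Gamma> (FST u) n" "cv \<Gamma> (FST (SND u)) f"
proof -
  let ?E = "\<lambda>n f c. eq_in R (big_sum R n (LAM (\<lambda>i. times_in R (c \<cdot> i) (f \<cdot> i)))) (rone R)"
  let ?T = "\<lambda>n f. SIG (fin n \<rightarrow>\<^sub>t car R) (?E n f)"
  have T: "ty \<Gamma> (?T n f)"
    by (insert R n f, (assumption | rule form el_LAM | rule app | erule leaf | erule lift)+)
  have "inh \<Gamma> (?T n f)"
    by (rule inh_SIG[where B = "?E n f", OF T c sum])
      (insert R n f, (assumption | rule form | erule leaf | erule lift)+)
  then obtain s where s: "el \<Gamma> s (?T n f)" by (auto simp: inh_def)
  let ?t = "TRIN (?T n f) s"
  have t: "el \<Gamma> ?t (TRUNC (?T n f))" by (rule el_TRIN[OF T s])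
  have p: "el \<Gamma> (PAIR f ?t) (SIG (fin n \<rightarrow>\<^sub>t car R) (\<lambda>f. TRUNC (?T n f)))"
    by (rule el_PAIR[where B = "\<lambda>f. TRUNC (?T n f)", OF _ f t])
      (insert R n, (assumption | rule form el_LAM | rule app | erule leaf | erule lift)+)
  show thesis
  proof (rule that)
    show "el \<Gamma> (PAIR n (PAIR f ?t)) (Um R)"
      unfolding Um_def
      by (rule el_PAIR[where B = "\<lambda>n. SIG (fin n \<rightarrow>\<^sub>t car R) (\<lambda>f. TRUNC (?T n f))", OF _ n p])
        (insert R, (assumption | rule form el_LAM | rule app | erule leaf | erule lift)+)
    show "cv \<Gamma> (FST (PAIR n (PAIR f ?t))) n" by (rule cv_FST_PAIR)
    show "cv \<Gamma> (FST (SND (PAIR n (PAIR f ?t)))) f"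
      by (rule cv_trans[OF cv_FST[OF cv_SND_PAIR] cv_FST_PAIR])
  qed
qed

text \<open>
  By \<open>modal_elim\<close>, \<open>Q\<close> may be proved on \<open>D(u)\<close> for the sequence \<open>u\<close> with entries \<open>f\<close>. As \<open>Q\<close> is a
  proposition, the truncation in \<open>D(u)\<close> can be eliminated, which yields an index \<open>i\<close> with a point of
  \<open>D(f i)\<close>, so \<open>f i\<close> is invertible.
\<close>

lemma cover_elim:
  assumes R: "ring_ops \<Gamma> l R"
    and Q: "ty \<Gamma> Q" "inh \<Gamma> (is_prop Q)" "inh \<Gamma> (is_modal l R Q)"
    and n: "el \<Gamma> n NAT" and f: "el \<Gamma> f (fin n \<rightarrow>\<^sub>t car R)" and c: "el \<Gamma> c (fin n \<rightarrow>\<^sub>t car R)"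
    and sum: "inh \<Gamma> (eq_in R (big_sum R n (LAM (\<lambda>i. times_in R (c \<cdot> i) (f \<cdot> i)))) (rone R))"
    and loc: "\<And>\<Delta> i. \<Gamma> \<sqsubseteq> \<Delta> \<Longrightarrow> el \<Delta> i (fin n) \<Longrightarrow> inh \<Delta> (has_inv R (f \<cdot> i)) \<Longrightarrow> inh \<Delta> Q"
  shows "inh \<Gamma> Q"
proof -
  obtain u where u: "el \<Gamma> u (Um R)" and cvn: "cv \<Gamma> (FST u) n" and cvf: "cv \<Gamma> (FST (SND u)) f"
    using R n f c sum by (rule Um_intro)
  show ?thesis
  proof (rule modal_elim[OF R Q(1,3) u], rule inh_arr)
    fix \<Delta> assume \<Delta>: "\<Gamma> \<sqsubseteq> \<Delta>" and d: "inh \<Delta> (D_Um l R u)"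
    let ?A = "SIG (fin (FST u)) (\<lambda>i. D l R (FST (SND u) \<cdot> i))"
    have R': "ring_ops \<Delta> l R" and Q': "ty \<Delta> Q" "inh \<Delta> (is_prop Q)" and u': "el \<Delta> u (Um R)"
      using \<Delta> R Q u by (blast intro: ring_ops_sub_ctx ty_sub_ctx inh_sub_ctx el_sub_ctx)+
    have A: "ty \<Delta> ?A"
      by (insert R' u', (assumption | rule form | rule app | erule leaf | erule lift)+)
    show "inh \<Delta> Q"
    proof (rule trunc_elim[OF A Q' _ d[unfolded D_Um_def]], rule inh_PI[OF A])
      fix \<Theta> s assume \<Theta>: "\<Delta> \<sqsubseteq> \<Theta>" and s: "el \<Theta> s ?A"
      have \<Gamma>: "\<Gamma> \<sqsubseteq> \<Theta>" by (rule sub_ctx_trans[OF \<Delta> \<Theta>])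
      have R'': "ring_ops \<Theta> l R" and u'': "el \<Theta> u (Um R)" and n'': "el \<Theta> n NAT"
        using \<Gamma> R u n by (blast intro: ring_ops_sub_ctx el_sub_ctx)+
      let ?i = "FST s"
      let ?r = "FST (SND u) \<cdot> ?i"
      have i: "el \<Theta> ?i (fin (FST u))"
        by (rule el_FST[OF s]) (insert u'', (assumption | rule form)+)
      have r: "el \<Theta> ?r (car R)"
        by (insert R'' u'' i, (assumption | rule form | rule app | erule leaf | erule lift)+)
      have "el \<Theta> (SND s) (D l R ?r)"
        by (rule el_SND[OF s]) (insert R'' u'', (assumption | rule form | erule leaf | erule lift)+)
      then have inv: "inh \<Theta> (has_inv R ?r)" by (rule D_has_inv[OF R'' r inh_el])
      have i': "el \<Theta> ?i (fin n)"
        by (rule el_cv[OF i _ ty_fin[OF n'']])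
          (unfold fin_def, rule cv_AP[OF cv_refl cv_sub_ctx[OF \<Gamma> cvn]])
      have "cv \<Theta> (has_inv R ?r) (has_inv R (f \<cdot> ?i))"
        by (intro cv_has_inv cv_AP[OF cv_sub_ctx[OF \<Gamma> cvf] cv_refl])
      moreover have "el \<Theta> (f \<cdot> ?i) (car R)"
        by (rule el_app[OF el_sub_ctx[OF \<Gamma> f] i'])
          (insert R'', (assumption | rule form | erule leaf | erule lift)+)
      ultimately have "inh \<Theta> (has_inv R (f \<cdot> ?i))"
        by (intro inh_cv[OF inv] ty_has_inv[OF R''])
      then show "inh \<Theta> Q" by (rule loc[OF \<Gamma> i'])
    next
    qed (insert Q', (assumption | erule leaf | erule lift)+)
  next
  qed (insert R Q u, (assumption | rule form)+)
qed

lemma cv_big_sum_ZERO: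
  assumes "ring_ops \<Gamma> l K" "natural \<Gamma> g"
  shows "cv \<Gamma> (big_sum K ZERO g) (rzero K)"
proof -
  have "cv \<Gamma> (LAM (\<lambda>_. rzero K) \<cdot> g) (rzero K)"
    by (rule cv_beta[OF _ assms(2)]) (insert assms(1), (assumption | rule form | erule leaf | erule lift)+)
  then show ?thesis unfolding big_sum_def by (rule cv_trans[OF cv_AP[OF cv_NatZero cv_refl]])
qed

lemma cv_big_sum_SUCC:
  assumes K: "ring_ops \<Gamma> l K" and k: "natural \<Gamma> k" and g: "natural \<Gamma> g"
  shows "cv \<Gamma> (big_sum K (SUCC k) g)
    (plus_in K (big_sum K k (LAM (\<lambda>i. g \<cdot> INL (fin k) UNIT i))) (g \<cdot> INR (fin k) UNIT STAR))"
proof -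
  let ?C = "LAM (\<lambda>k. (fin k \<rightarrow>\<^sub>t car K) \<rightarrow>\<^sub>t car K)" and ?z = "LAM (\<lambda>_. rzero K)"
  let ?b = "\<lambda>k s g. plus_in K (s \<cdot> LAM (\<lambda>i. g \<cdot> INL (fin k) UNIT i)) (g \<cdot> INR (fin k) UNIT STAR)"
  let ?s = "LAM (\<lambda>k. LAM (\<lambda>s. LAM (\<lambda>g. ?b k s g)))"
  let ?N = "CON CNatInd \<cdot> ?C \<cdot> ?z \<cdot> ?s"
  have N: "natural \<Gamma> (?N \<cdot> k)"
    unfolding natural_def
    by (intro allI impI) (insert K k, (assumption | rule form | erule leaf | erule lift)+)
  have 1: "cv \<Gamma> (?s \<cdot> k \<cdot> (?N \<cdot> k)) (LAM (\<lambda>g. ?b k (?N \<cdot> k) g))"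
    by (rule cv_beta2[where F = "\<lambda>k s. LAM (\<lambda>g. ?b k s g)", OF _ k N])
      (insert K, (assumption | rule form | erule leaf | erule lift)+)
  have 2: "cv \<Gamma> (LAM (\<lambda>g. ?b k (?N \<cdot> k) g) \<cdot> g) (?b k (?N \<cdot> k) g)"
    by (rule cv_beta[OF _ g]) (insert K k, (assumption | rule form | erule leaf | erule lift)+)
  show ?thesis
    unfolding big_sum_def
    by (rule cv_trans[OF cv_AP[OF cv_NatSucc cv_refl] cv_trans[OF cv_AP[OF 1 cv_refl] 2]])
qed

section \<open>Ring identities\<close>

lemma zero_add:
  assumes R: "ring_ops \<Gamma> l R" and c: "inh \<Gamma> (is_comm_ring R)" and x: "el \<Gamma> x (car R)"
  shows "inh \<Gamma> (eq_in R (plus_in R (rzero R) x) x)"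
proof -
  have "inh \<Gamma> (PI (car R) (\<lambda>x. eq_in R (plus_in R (rzero R) x) x))"
    by (rule inh_fst[OF inh_snd[OF inh_snd[OF inh_snd[OF c[unfolded is_comm_ring_def]]]]])
      (insert R, (assumption | rule form | erule leaf | erule lift)+)
  then show ?thesis
    by (rule inh_AP[OF _ x]) (insert R, (assumption | rule form | erule leaf | erule lift)+)
qed

lemma times_comm:
  assumes R: "ring_ops \<Gamma> l R" and c: "inh \<Gamma> (is_comm_ring R)" and x: "el \<Gamma> x (car R)" and y: "el \<Gamma> y (car R)"
  shows "inh \<Gamma> (eq_in R (times_in R x y) (times_in R y x))"
proof -
  have "inh \<Gamma> (PI (car R) (\<lambda>x. PI (car R) (\<lambda>y. eq_in R (times_in R x y) (times_in R y x))))"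
    by (rule inh_fst[OF inh_snd[OF inh_snd[OF inh_snd[OF inh_snd[OF inh_snd[OF inh_snd[OF
          c[unfolded is_comm_ring_def]]]]]]]])
      (insert R, (assumption | rule form | erule leaf | erule lift)+)
  then have "inh \<Gamma> (PI (car R) (\<lambda>y. eq_in R (times_in R x y) (times_in R y x)))"
    by (rule inh_AP[OF _ x]) (insert R, (assumption | rule form | erule leaf | erule lift)+)
  then show ?thesis
    by (rule inh_AP[OF _ y]) (insert R x, (assumption | rule form | erule leaf | erule lift)+)
qed

lemma distrib_left:
  assumes R: "ring_ops \<Gamma> l R" and c: "inh \<Gamma> (is_comm_ring R)"
    and x: "el \<Gamma> x (car R)" and y: "el \<Gamma> y (car R)" and z: "el \<Gamma> z (car R)"
  shows "inh \<Gamma> (eq_in R (times_in R x (plus_in R y z)) (plus_in R (times_in R x y) (times_in R x z)))"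
proof -
  have "inh \<Gamma> (PI (car R) (\<lambda>x. PI (car R) (\<lambda>y. PI (car R) (\<lambda>z.
      eq_in R (times_in R x (plus_in R y z)) (plus_in R (times_in R x y) (times_in R x z))))))"
    by (rule inh_snd[OF inh_snd[OF inh_snd[OF inh_snd[OF inh_snd[OF inh_snd[OF inh_snd[OF inh_snd[OF
          c[unfolded is_comm_ring_def]]]]]]]]])
      (insert R, (assumption | rule form | erule leaf | erule lift)+)
  then have "inh \<Gamma> (PI (car R) (\<lambda>y. PI (car R) (\<lambda>z.
      eq_in R (times_in R x (plus_in R y z)) (plus_in R (times_in R x y) (times_in R x z)))))"
    by (rule inh_AP[OF _ x]) (insert R, (assumption | rule form | erule leaf | erule lift)+)
  then have "inh \<Gamma> (PI (car R) (\<lambda>z.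
      eq_in R (times_in R x (plus_in R y z)) (plus_in R (times_in R x y) (times_in R x z))))"
    by (rule inh_AP[OF _ y]) (insert R x, (assumption | rule form | erule leaf | erule lift)+)
  then show ?thesis
    by (rule inh_AP[OF _ z]) (insert R x y, (assumption | rule form | erule leaf | erule lift)+)
qed

text \<open>
  The left-hand side is the value of \<open>big_sum\<close> for the sequence \<open>(x, y)\<close> with coefficients \<open>(v, v)\<close>;
  the summand \<open>0\<close> is the empty sum.
\<close>

lemma invertible_sum_cover:
  assumes R: "ring_ops \<Gamma> l R" and c: "inh \<Gamma> (is_comm_ring R)"
    and x: "el \<Gamma> x (car R)" and y: "el \<Gamma> y (car R)" and v: "el \<Gamma> v (car R)"
    and inv: "inh \<Gamma> (eq_in R (times_in R (plus_in R x y) v) (rone R))"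
  shows "inh \<Gamma> (eq_in R (plus_in R (plus_in R (rzero R) (times_in R v x)) (times_in R v y)) (rone R))"
proof -
  let ?vx = "times_in R v x" and ?vy = "times_in R v y"
  have els: "ty \<Gamma> (car R)" "el \<Gamma> ?vx (car R)" "el \<Gamma> ?vy (car R)" "el \<Gamma> (plus_in R x y) (car R)"
    "el \<Gamma> (times_in R (plus_in R x y) v) (car R)" "el \<Gamma> (times_in R v (plus_in R x y)) (car R)"
    "el \<Gamma> (plus_in R ?vx ?vy) (car R)" "el \<Gamma> (plus_in R (rzero R) ?vx) (car R)"
    by (insert R x y v, (assumption | rule form)+)
  have "inh \<Gamma> (eq_in R (times_in R v (plus_in R x y)) (rone R))"
    by (rule id_subst[OF times_comm[OF R c els(4) v] els(5,6), where C = "\<lambda>t. eq_in R t (rone R)"])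
      (insert R inv, (assumption | rule form | erule leaf | erule lift)+)
  then have "inh \<Gamma> (eq_in R (plus_in R ?vx ?vy) (rone R))"
    by (rule id_subst[OF distrib_left[OF R c v x y] els(6,7), where C = "\<lambda>t. eq_in R t (rone R)"])
      (insert R, (assumption | rule form | erule leaf | erule lift)+)
  then show ?thesis
    by (rule id_subst[OF id_sym[OF els(1,8,2) zero_add[OF R c els(2)]] els(2,8),
          where C = "\<lambda>t. eq_in R (plus_in R t ?vy) (rone R)"])
      (insert R v y, (assumption | rule form | erule leaf | erule lift)+)
qed

section \<open>Locality in the sheaf model\<close>

text \<open>
  The empty sum is \<open>0\<close>, so the empty sequence is unimodular if \<open>1 = 0\<close>, and nothing has to be proved
  for its entries.
\<close>

lemma trivial_ring_sheaf_empty: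
  assumes R: "ring_ops \<Gamma> l R" and triv: "inh \<Gamma> (eq_in R (rone R) (rzero R))"
  shows "inh \<Gamma> (sheaf_empty l R)"
  unfolding sheaf_empty_def
proof (rule sheafified_intro[OF R])
  fix \<Delta> Q assume \<Delta>: "\<Gamma> \<sqsubseteq> \<Delta>" and Q: "ty \<Delta> Q" "inh \<Delta> (is_prop Q)" "inh \<Delta> (is_modal l R Q)"
  have R': "ring_ops \<Delta> l R" and triv': "inh \<Delta> (eq_in R (rone R) (rzero R))"
    using \<Delta> R triv by (blast intro: ring_ops_sub_ctx inh_sub_ctx)+
  \<comment> \<open>The type \<open>fin ZERO\<close> is convertible to the empty type.\<close>
  have efq: "inh \<Theta> A" if "el \<Theta> i (fin ZERO)" "ty \<Theta> A" for \<Theta> i A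
    by (rule inh_el[OF el_EmptyInd[OF that(2) el_cv[OF that(1) cv_fin_ZERO]]]) (rule form)
  have "inh \<Delta> (fin ZERO \<rightarrow>\<^sub>t car R)"
    by (rule inh_PI) (insert R', (assumption | rule form efq | erule leaf | erule lift)+)
  then obtain f where f: "el \<Delta> f (fin ZERO \<rightarrow>\<^sub>t car R)" by (auto simp: inh_def)
  let ?g = "LAM (\<lambda>i. times_in R (f \<cdot> i) (f \<cdot> i))"
  have g: "el \<Delta> ?g (fin ZERO \<rightarrow>\<^sub>t car R)"
    by (insert R' f, (assumption | rule form el_LAM | rule app | erule leaf | erule lift)+)
  have 01: "inh \<Delta> (eq_in R (rzero R) (rone R))"
    by (rule id_sym) (insert R' triv', (assumption | rule form)+)
  have sum: "inh \<Delta> (eq_in R (big_sum R ZERO ?g) (rone R))"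
  proof (rule inh_cv[OF 01])
    show "cv \<Delta> (eq_in R (rzero R) (rone R)) (eq_in R (big_sum R ZERO ?g) (rone R))"
      by (rule cv_AP[OF cv_AP[OF cv_refl cv_sym[OF cv_big_sum_ZERO[OF R' natural_el[OF g]]]] cv_refl])
  qed (insert R' g, (assumption | rule form)+)
  show "inh \<Delta> Q"
    by (rule cover_elim[OF R' Q el_ZERO f f sum]) (insert Q, (assumption | rule efq | erule lift)+)
qed (rule form)

text \<open>
  The cover belongs to the sequence \<open>(x, y)\<close>. On each of its two pieces one of \<open>x\<close> and \<open>y\<close> is
  invertible, which gives the proposition that is to be sheafified, and hence \<open>Q\<close>.
\<close>

lemma invertible_sum_sheaf_local:
  assumes R: "ring_ops \<Gamma> l R" and c: "inh \<Gamma> (is_comm_ring R)"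
    and x: "el \<Gamma> x (car R)" and y: "el \<Gamma> y (car R)" and inv: "inh \<Gamma> (has_inv R (plus_in R x y))"
  shows "inh \<Gamma> (sheaf_trunc l R (PLUS (has_inv R x) (has_inv R y)))"
  unfolding sheaf_trunc_def
proof (rule sheafified_intro[OF R])
  let ?P = "PLUS (has_inv R x) (has_inv R y)"
  show "ty \<Gamma> (TRUNC ?P)" by (insert R x y, (assumption | rule form)+)
  fix \<Delta> Q assume \<Delta>: "\<Gamma> \<sqsubseteq> \<Delta>" and Q: "ty \<Delta> Q" "inh \<Delta> (is_prop Q)" "inh \<Delta> (is_modal l R Q)"
    and PQ: "inh \<Delta> (TRUNC ?P \<rightarrow>\<^sub>t Q)"
  have R': "ring_ops \<Delta> l R" and c': "inh \<Delta> (is_comm_ring R)" and x': "el \<Delta> x (car R)"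
    and y': "el \<Delta> y (car R)" and inv': "inh \<Delta> (has_inv R (plus_in R x y))"
    using \<Delta> R c x y inv by (blast intro: ring_ops_sub_ctx inh_sub_ctx el_sub_ctx)+
  obtain v where v: "el \<Delta> v (car R)" and xyv: "inh \<Delta> (eq_in R (times_in R (plus_in R x y) v) (rone R))"
    using inv' unfolding has_inv_def
    by (rule inh_SIG_cases) (insert R' x' y', (assumption | rule form | erule leaf | erule lift)+)
  let ?one = "SUCC ZERO"
  let ?two = "SUCC ?one"
  let ?c = "LAM (\<lambda>_. v)"
  \<comment> \<open>The sequence \<open>(x, y)\<close>, by cases on \<open>fin 2 = fin 1 + 1\<close>; on the one element of \<open>fin 1\<close> it may be
    taken constant.\<close>
  let ?f = "\<lambda>i. CON CSumInd \<cdot> fin ?one \<cdot> UNIT \<cdot> LAM (\<lambda>_. car R)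
    \<cdot> LAM (\<lambda>_. x) \<cdot> LAM (\<lambda>_. y) \<cdot> i"
  define f where "f = LAM ?f"
  have cv2: "cv \<Theta> (fin ?two) (PLUS (fin ?one) UNIT)" for \<Theta> by (rule cv_fin_SUCC) (rule form)+
  have ty2: "ty \<Theta> (PLUS (fin ?one) UNIT)" for \<Theta> by (rule form)+
  have cl: "el \<Delta> (LAM (\<lambda>_. x)) (fin ?one \<rightarrow>\<^sub>t car R)" and cr: "el \<Delta> (LAM (\<lambda>_. y)) (UNIT \<rightarrow>\<^sub>t car R)"
    by (insert R' x' y', (assumption | rule form el_LAM | erule leaf | erule lift)+)
  have caseI: "el \<Theta> (?f i) (car R)"
    if "\<Delta> \<sqsubseteq> \<Theta>" "el \<Theta> i (PLUS (fin ?one) UNIT)" for \<Theta> i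
    by (rule el_SumInd[where C = "\<lambda>_. car R", OF _ _ _ _ el_sub_ctx[OF that(1) cl] el_sub_ctx[OF that(1) cr] that(2)])
      (insert R' that(1), (assumption | rule form | erule leaf | erule lift)+)
  have fP: "el \<Delta> f (PLUS (fin ?one) UNIT \<rightarrow>\<^sub>t car R)"
    unfolding f_def
    by (rule el_LAM) (insert R' x' y', (assumption | rule caseI | rule form | erule leaf | erule lift)+)
  have f: "el \<Delta> f (fin ?two \<rightarrow>\<^sub>t car R)"
    by (rule el_cv[OF fP cv_PI[OF cv_sym[OF cv2] cv_refl]])
      (insert R', (assumption | rule form | erule leaf | erule lift)+)
  have g: "el \<Delta> ?c (fin ?two \<rightarrow>\<^sub>t car R)"
    by (insert R' v, (assumption | rule form el_LAM | erule leaf | erule lift)+)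
  have natf: "sim w (?f i) (?f j)"
    if "over \<Delta> w" "sim w i j" for w i j
    by (insert R' x' y' that, (assumption | rule form | erule leaf | erule lift)+)
  have f_inl: "cv \<Theta> (f \<cdot> INL (fin ?one) UNIT j) x" if "\<Delta> \<sqsubseteq> \<Theta>" "natural \<Theta> j" for \<Theta> j
  proof -
    have "natural \<Theta> (INL (fin ?one) UNIT j)"
      unfolding natural_def by (intro allI impI) (insert that(2), (assumption | rule form | erule leaf | erule lift)+)
    then have 1: "cv \<Theta> (f \<cdot> INL (fin ?one) UNIT j) (?f (INL (fin ?one) UNIT j))"
      unfolding f_def by (intro cv_beta[where F = ?f] natf[OF over_sub_ctx[OF that(1)]])
    have 2: "cv \<Theta> (LAM (\<lambda>_. x) \<cdot> j) x"
      by (rule cv_beta[OF sim_el[OF _ el_sub_ctx[OF that(1) x']] that(2)])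
    show ?thesis by (rule cv_trans[OF 1 cv_trans[OF cv_SumInl 2]])
  qed
  have f_inr: "cv \<Theta> (f \<cdot> INR (fin ?one) UNIT j) y" if "\<Delta> \<sqsubseteq> \<Theta>" "natural \<Theta> j" for \<Theta> j
  proof -
    have "natural \<Theta> (INR (fin ?one) UNIT j)"
      unfolding natural_def by (intro allI impI) (insert that(2), (assumption | rule form | erule leaf | erule lift)+)
    then have 1: "cv \<Theta> (f \<cdot> INR (fin ?one) UNIT j) (?f (INR (fin ?one) UNIT j))"
      unfolding f_def by (intro cv_beta[where F = ?f] natf[OF over_sub_ctx[OF that(1)]])
    have 2: "cv \<Theta> (LAM (\<lambda>_. y) \<cdot> j) y"
      by (rule cv_beta[OF sim_el[OF _ el_sub_ctx[OF that(1) y']] that(2)])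
    show ?thesis by (rule cv_trans[OF 1 cv_trans[OF cv_SumInr 2]])
  qed
  let ?g = "LAM (\<lambda>i. times_in R (?c \<cdot> i) (f \<cdot> i))"
  let ?h = "LAM (\<lambda>i. ?g \<cdot> INL (fin ?one) UNIT i)"
  have cv_g: "cv \<Delta> (?g \<cdot> j) (times_in R v z)" if "cv \<Delta> (f \<cdot> j) z" "natural \<Delta> j" for j z
  proof -
    have "cv \<Delta> (?g \<cdot> j) (times_in R (?c \<cdot> j) (f \<cdot> j))"
      by (rule cv_beta[OF _ that(2)]) (insert R' v f, (assumption | rule form | erule leaf | erule lift)+)
    moreover have "cv \<Delta> (?c \<cdot> j) v"
      by (rule cv_beta[OF sim_el[OF _ v] that(2)])
    ultimately show ?thesis
      by (rule cv_trans[OF _ cv_AP[OF cv_AP[OF cv_refl] that(1)]])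
  qed
  have natural1: "natural \<Delta> (INR (fin ZERO) UNIT STAR)" and natural1': "natural \<Delta> (INL (fin ?one) UNIT (INR (fin ZERO) UNIT STAR))"
    and natural2: "natural \<Delta> (INR (fin ?one) UNIT STAR)" and ambS: "natural \<Delta> STAR" and natural_one: "natural \<Delta> ?one" and natural_zero: "natural \<Delta> ZERO"
    unfolding natural_def by (intro allI impI, (rule form)+)+
  have naturalg: "natural \<Delta> ?g" and naturalh: "natural \<Delta> ?h" and natural0: "natural \<Delta> (LAM (\<lambda>i. ?h \<cdot> INL (fin ZERO) UNIT i))"
    unfolding natural_def
    by (intro allI impI, insert R' v f, (assumption | rule form | erule leaf | erule lift)+)+
  have "cv \<Delta> (?h \<cdot> INR (fin ZERO) UNIT STAR) (?g \<cdot> INL (fin ?one) UNIT (INR (fin ZERO) UNIT STAR))"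
    by (rule cv_beta[OF _ natural1]) (insert R' v f, (assumption | rule form | erule leaf | erule lift)+)
  then have h1: "cv \<Delta> (?h \<cdot> INR (fin ZERO) UNIT STAR) (times_in R v x)"
    by (rule cv_trans[OF _ cv_g[OF f_inl[OF sub_ctx_refl natural1] natural1']])
  have sum1: "cv \<Delta> (big_sum R ?one ?h) (plus_in R (rzero R) (times_in R v x))"
    by (rule cv_trans[OF cv_big_sum_SUCC[OF R' natural_zero naturalh]
          cv_AP[OF cv_AP[OF cv_refl cv_big_sum_ZERO[OF R' natural0]] h1]])
  have sum2: "cv \<Delta> (big_sum R ?two ?g) (plus_in R (plus_in R (rzero R) (times_in R v x)) (times_in R v y))"
    by (rule cv_trans[OF cv_big_sum_SUCC[OF R' natural_one naturalg]
          cv_AP[OF cv_AP[OF cv_refl sum1] cv_g[OF f_inr[OF sub_ctx_refl ambS] natural2]]])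
  have cv_sum: "cv \<Delta> (eq_in R (plus_in R (plus_in R (rzero R) (times_in R v x)) (times_in R v y)) (rone R))
      (eq_in R (big_sum R ?two ?g) (rone R))"
    by (rule cv_AP[OF cv_AP[OF cv_refl cv_sym[OF sum2]] cv_refl])
  have "el \<Delta> ?g (fin ?two \<rightarrow>\<^sub>t car R)"
    by (rule el_LAM) (insert R' f v g, (assumption | rule form | rule app | erule leaf | erule lift)+)
  then have "ty \<Delta> (eq_in R (big_sum R ?two ?g) (rone R))"
    by (intro ty_ID el_big_sum[OF R'] ring_ops_el(2,3)[OF R'] el_SUCC el_ZERO)
  then have sum: "inh \<Delta> (eq_in R (big_sum R ?two ?g) (rone R))"
    by (rule inh_cv[OF invertible_sum_cover[OF R' c' x' y' v xyv] cv_sum])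
  show "inh \<Delta> Q"
  proof (rule cover_elim[OF R' Q _ f g sum])
    show "el \<Delta> ?two NAT" by (rule form)+
    fix \<Theta> i assume \<Theta>: "\<Delta> \<sqsubseteq> \<Theta>" and i: "el \<Theta> i (fin ?two)" and fi: "inh \<Theta> (has_inv R (f \<cdot> i))"
    have R'': "ring_ops \<Theta> l R" and x'': "el \<Theta> x (car R)" and y'': "el \<Theta> y (car R)" and Q'': "ty \<Theta> Q"
      and PQ'': "inh \<Theta> (TRUNC ?P \<rightarrow>\<^sub>t Q)" and fP'': "el \<Theta> f (PLUS (fin ?one) UNIT \<rightarrow>\<^sub>t car R)"
      using \<Theta> R' x' y' Q PQ fP by (blast intro: ring_ops_sub_ctx inh_sub_ctx el_sub_ctx ty_sub_ctx)+
    have hx: "ty \<Xi> (has_inv R x)" and hy: "ty \<Xi> (has_inv R y)" if "\<Theta> \<sqsubseteq> \<Xi>" for \<Xi>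
      by (insert R'' x'' y'' that, (assumption | rule form | erule leaf | erule lift)+)
    have toQ: "inh \<Xi> Q" if "\<Theta> \<sqsubseteq> \<Xi>" "el \<Xi> p ?P" for \<Xi> p
      by (rule inh_app[OF inh_sub_ctx[OF that(1) PQ''] inh_el[OF el_TRIN[OF ty_PLUS[OF hx hy] that(2)]]])
        (insert Q'' that(1), (assumption | erule lift)+)
    have fj: "ty \<Xi> (has_inv R (f \<cdot> j))" if "\<Theta> \<sqsubseteq> \<Xi>" "el \<Xi> j (PLUS (fin ?one) UNIT)" for \<Xi> j
      by (insert R'' fP'' that, (assumption | rule form | rule app | erule leaf | erule lift)+)
    have inl: "inh \<Theta> (PI (fin ?one) (\<lambda>j. has_inv R (f \<cdot> INL (fin ?one) UNIT j) \<rightarrow>\<^sub>t Q))"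
    proof (rule inh_PI; (rule inh_PI)?)
      fix \<Xi> \<Xi>' j p assume h: "\<Theta> \<sqsubseteq> \<Xi>" "el \<Xi> j (fin ?one)" "\<Xi> \<sqsubseteq> \<Xi>'" "el \<Xi>' p (has_inv R (f \<cdot> INL (fin ?one) UNIT j))"
      have \<Xi>': "\<Theta> \<sqsubseteq> \<Xi>'" by (rule sub_ctx_trans[OF h(1,3)])
      have "el \<Xi>' p (has_inv R x)"
        by (rule el_cv[OF h(4) cv_has_inv[OF f_inl[OF sub_ctx_trans[OF \<Theta> \<Xi>'] natural_sub_ctx[OF h(3) natural_el[OF h(2)]]]] hx[OF \<Xi>']])
      then show "inh \<Xi>' Q" by (rule toQ[OF \<Xi>' el_INL[OF hx[OF \<Xi>'] hy[OF \<Xi>']]])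
    next
    qed (insert R'' fP'' Q'', (assumption | rule fj | rule form | erule leaf | erule lift)+)
    have inr: "inh \<Theta> (PI UNIT (\<lambda>j. has_inv R (f \<cdot> INR (fin ?one) UNIT j) \<rightarrow>\<^sub>t Q))"
    proof (rule inh_PI; (rule inh_PI)?)
      fix \<Xi> \<Xi>' j p assume h: "\<Theta> \<sqsubseteq> \<Xi>" "el \<Xi> j UNIT" "\<Xi> \<sqsubseteq> \<Xi>'" "el \<Xi>' p (has_inv R (f \<cdot> INR (fin ?one) UNIT j))"
      have \<Xi>': "\<Theta> \<sqsubseteq> \<Xi>'" by (rule sub_ctx_trans[OF h(1,3)])
      have "el \<Xi>' p (has_inv R y)"
        by (rule el_cv[OF h(4) cv_has_inv[OF f_inr[OF sub_ctx_trans[OF \<Theta> \<Xi>'] natural_sub_ctx[OF h(3) natural_el[OF h(2)]]]] hy[OF \<Xi>']])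
      then show "inh \<Xi>' Q" by (rule toQ[OF \<Xi>' el_INR[OF hx[OF \<Xi>'] hy[OF \<Xi>']]])
    next
    qed (insert R'' fP'' Q'', (assumption | rule fj | rule form | erule leaf | erule lift)+)
    obtain a b where a: "el \<Theta> a (PI (fin ?one) (\<lambda>j. has_inv R (f \<cdot> INL (fin ?one) UNIT j) \<rightarrow>\<^sub>t Q))"
      and b: "el \<Theta> b (PI UNIT (\<lambda>j. has_inv R (f \<cdot> INR (fin ?one) UNIT j) \<rightarrow>\<^sub>t Q))"
      using inl inr by (auto simp: inh_def)
    have "inh \<Theta> (has_inv R (f \<cdot> i) \<rightarrow>\<^sub>t Q)"
      by (rule inh_el[OF el_SumInd[where C = "\<lambda>i. has_inv R (f \<cdot> i) \<rightarrow>\<^sub>t Q", OF _ _ _ _ a b el_cv[OF i cv2 ty2]]])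
        (insert R'' fP'' Q'', (assumption | rule fj | rule form | erule leaf | erule lift)+)
    then show "inh \<Theta> Q" using fi Q'' by (rule inh_app)
  qed
qed

lemma inh_sheaf_local:
  assumes R: "ring_ops \<Gamma> l R" and c: "inh \<Gamma> (is_comm_ring R)"
  shows "inh \<Gamma> (sheaf_local l R)"
  unfolding sheaf_local_def
proof (rule inh_pair)
  show "inh \<Gamma> (eq_in R (rone R) (rzero R) \<rightarrow>\<^sub>t sheaf_empty l R)"
    by (rule inh_arr) (insert R, (assumption | rule trivial_ring_sheaf_empty | rule form
      | rule ty_sheafified[of _ _ _ EMPTY, folded sheaf_empty_def] | erule lift)+)
  show "inh \<Gamma> (PI (car R) (\<lambda>x. PI (car R) (\<lambda>y. has_inv R (plus_in R x y)
      \<rightarrow>\<^sub>t sheaf_trunc l R (PLUS (has_inv R x) (has_inv R y)))))"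
  proof (rule inh_PI; (rule inh_PI; (rule inh_arr)?)?)
    fix \<Delta>1 \<Delta>2 \<Delta>3 x y
    assume d: "\<Gamma> \<sqsubseteq> \<Delta>1" "\<Delta>1 \<sqsubseteq> \<Delta>2" "\<Delta>2 \<sqsubseteq> \<Delta>3" and xy: "el \<Delta>1 x (car R)" "el \<Delta>2 y (car R)"
      and inv: "inh \<Delta>3 (has_inv R (plus_in R x y))"
    show "inh \<Delta>3 (sheaf_trunc l R (PLUS (has_inv R x) (has_inv R y)))"
      by (rule invertible_sum_sheaf_local[OF _ _ _ _ inv])
        (insert d xy R c, (assumption | erule lift)+)
  next
  qed (insert R, unfold sheaf_trunc_def, (assumption | rule form | erule leaf | erule lift)+)
next
qed (insert R, unfold sheaf_empty_def sheaf_trunc_def, (assumption | rule form | erule leaf | erule lift)+)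

lemma inh_over_rings:
  assumes nat: "\<And>w K K'. over \<Gamma> w \<Longrightarrow> sim_ring w K K' \<Longrightarrow> sim w (F K) (F K')"
    and F: "\<And>\<Delta> K. \<Gamma> \<sqsubseteq> \<Delta> \<Longrightarrow> ring_ops \<Delta> l K \<Longrightarrow> inh \<Delta> (is_comm_ring K) \<Longrightarrow> inh \<Delta> (F K)"
  shows "inh \<Gamma> (over_rings PI l F)"
  unfolding over_rings_def
  by (assumption | rule inh_PI F inh_el nat | rule form | erule leaf | erule lift)+

theorem proposition8p1p6:
  fixes l :: nat
  shows "inhabited (over_rings PI l (\<lambda>R.
           axiom_duality l R \<rightarrow>\<^sub>t axiom_choice l R \<rightarrow>\<^sub>t axiom_constant l R \<rightarrow>\<^sub>t sheaf_local l R))"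
    (is "inhabited ?X")
proof -
  have "inh [] ?X"
  proof (rule inh_over_rings)
    fix \<Delta> R assume R: "ring_ops \<Delta> l R" and c: "inh \<Delta> (is_comm_ring R)"
    show "inh \<Delta> (axiom_duality l R \<rightarrow>\<^sub>t axiom_choice l R \<rightarrow>\<^sub>t axiom_constant l R \<rightarrow>\<^sub>t sheaf_local l R)"
      by (insert R c, (assumption | rule inh_PI inh_sheaf_local | rule form | erule leaf | erule lift)+)
  next
  qed (assumption | rule form | erule lift)+
  then show ?thesis by (auto simp: inh_def el_def inhabited_def)
qed

end
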